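(* Let $d\ge 2$ and $1\le p\le\infty$. Let $T$ be a $\lceil p\rceil$-weakly isotropic random field on $\mathbb{S}^d$. Let $h$ be a needlet filter satisfying $h\in C^{\kappa}(\mathbb{R}_+)$ with $\kappa\ge\lfloor\frac{d+3}{2}\rfloor$. Then $T$ admits the needlet decomposition $T\sim\sum_{j=0}^{\infty}U_j(T)$ (whose partial sums are $V_J(T)=\sum_{j=0}^{J}U_j(T)$), with convergence in the following sense: (i) for $1\le p<\infty$, $\displaystyle\lim_{J\to\infty}\mathbb{E}\big[\|T-V_J(T)\|_{L_p(\mathbb{S}^d)}^p\big]=0$; (ii) for $p=\infty$, $\displaystyle\lim_{J\to\infty}\mathbb{E}\big[\|T-V_J(T)\|_{L_\infty(\mathbb{S}^d)}\big]=0$.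
   Context: $\mathbb{S}^d\subset\mathbb{R}^{d+1}$ is the unit sphere, $\sigma_d$ its normalised surface measure ($\sigma_d(\mathbb{S}^d)=1$), $L_p(\mathbb{S}^d)=L_p(\mathbb{S}^d,\sigma_d)$ (real-valued) for $1\le p<\infty$, and by convention $L_\infty(\mathbb{S}^d):=C(\mathbb{S}^d)$ with the sup norm. $(\Omega,\mathcal{F},P)$ is a probability space with expectation $\mathbb{E}$. $\lceil\cdot\rceil$ is the ceiling function and $\lceil\infty\rceil:=\infty$. Random fields. A random field on $\mathbb{S}^d$ is an $\mathcal{F}\otimes\mathscr{B}(\mathbb{S}^d)$-measurable function $T:\Omega\times\mathbb{S}^d\to\mathbb{R}$; write $T(x)=T(\cdot,x)$ and $T(\omega)=T(\omega,\cdot)$. For an integer $n\ge1$, $T$ is $n$-weakly isotropic if $\mathbb{E}[|T(x)|^n]<\infty$ for all $x\in\mathbb{S}^d$ and, for $k=1,\dots,n$, all $x_1,\dots,x_k\in\mathbb{S}^d$ and all rotations $\rho\in SO(d+1)$, $\mathbb{E}[T(x_1)\cdots T(x_k)]=\mathbb{E}[T(\rho x_1)\cdots T(\rho x_k)]$. $T$ is $\infty$-weakly isotropic if it is $n$-weakly isotropic for every positive integer $n$, $\mathbb{E}[\|T\|_{L_\infty(\mathbb{S}^d)}]<\infty$, and $T(\omega)$ is continuous on $\mathbb{S}^d$ $P$-almost surely. Standing assumption, for $p=\infty$ only: for each $k\in\mathbb{N}$ and $x_1,\dots,x_k\in\mathbb{S}^d$ the joint distribution of $T(x_1),\dots,T(x_k)$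 is determined by its moments; hence $T$ is strongly isotropic, i.e. $(T(x_1),\dots,T(x_k))$ and $(T(\rho x_1),\dots,T(\rho x_k))$ have the same law for all $k$, all points and all rotations $\rho$. Needlets. $Z(d,\ell)=(2\ell+d-1)\frac{\Gamma(\ell+d-1)}{\Gamma(d)\Gamma(\ell+1)}$ is the dimension of the space of spherical harmonics of degree $\ell$, and $P_\ell^{(d+1)}$ is the Gegenbauer (Jacobi, with parameters $(\frac{d-2}{2},\frac{d-2}{2})$) polynomial of degree $\ell$ normalised by $P_\ell^{(d+1)}(1)=1$. A needlet filter of smoothness $\kappa\ge1$ is $h:[0,\infty)\to[0,\infty)$ with $h\in C^\kappa(\mathbb{R}_+)$, $\operatorname{supp}h=[1/2,2]$ and $h(t)^2+h(2t)^2=1$ for $t\in[1/2,1]$. For each $j\ge0$ fix a needlet quadrature $\{(w_{jk},x_{jk}):k=1,\dots,N_j\}$, with $w_{jk}>0$, $x_{jk}\in\mathbb{S}^d$, exact (with respect to $\sigma_d$) for spherical polynomials of degree up to $2^{j+1}-1$. The needlets are $\psi_{0k}(x):=\sqrt{w_{0k}}$ and, for $j\ge1$, $\psi_{jk}(x):=\sqrt{w_{jk}}\sum_{\ell=0}^\infty h\big(\frac{\ell}{2^{j-1}}\big)Z(d,\ell)P_\ell^{(d+1)}(x\cdot x_{jk})$. For $f\in L_1(\mathbb{S}^d)$, $(f,\psi_{jk})=\int_{\mathbb{S}^d}f\psi_{jk}\,d\sigma_d$. The order-$j$ contribution is $U_j(T;\omega,x)=\sum_{k=1}^{N_j}(T(\omega),\psi_{jk})\psi_{jk}(x)$,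 and the semidiscrete needlet approximation of order $J\in\mathbb{N}_0$ is $V_J(T;\omega,x)=\sum_{j=0}^J\sum_{k=1}^{N_j}(T(\omega),\psi_{jk})\psi_{jk}(x)$.
   Formalization: For finite p with ⌈p⌉ odd, the finiteness of E‖T‖_{L_p}^p is assumed in addition; ⌈p⌉-weak isotropy does not imply it for odd order, and without it the convergence in (i) fails (e.g. for p = 1). *)

theory Defs
  imports "HOL-Probability.Probability"
begin

text \<open>
  The sphere of dimension \<open>d\<close> is \<open>sphere 0 1\<close> in \<open>real ^ 'n\<close> with \<open>CARD('n) = d + 1\<close>. A function on
  the sphere is a function on all of \<open>real ^ 'n\<close> of which only the values on \<open>sphere 0 1\<close> matter.
\<close>

section \<open>Normalised surface measure and norms\<close>

text \<open>
  The measure of \<open>A\<close> is the normalised Lebesgue measure of the cone \<open>{t *\<^sub>R x | x \<in> A, 0 < t < 1}\<close>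
  (polar coordinates); \<open>sgn x\<close> is the radial projection of \<open>x\<close>.
\<close>
definition sphere_measure :: "(real ^ 'n) measure" where
  "sphere_measure =
     restrict_space (distr (uniform_measure lborel (ball 0 1)) borel sgn) (sphere 0 1)"

definition enn_powr :: "ennreal \<Rightarrow> real \<Rightarrow> ennreal" where
  "enn_powr a r = (if a = \<infinity> then \<infinity> else ennreal (enn2real a powr r))"

text \<open>
  The norms take values in \<open>[0, \<infinity>]\<close>. For \<open>p = \<infinity>\<close> this is the supremum over the sphere, not the
  essential supremum: the corresponding space is the space of continuous functions.
\<close>
definition Lp_norm :: "ennreal \<Rightarrow> (real ^ 'n \<Rightarrow> real) \<Rightarrow> ennreal" where
  "Lp_norm p f =
     (if p = \<infinity> then (SUP x\<in>sphere 0 1. ennreal \<bar>f x\<bar>)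
      else enn_powr (\<integral>\<^sup>+ x. ennreal (\<bar>f x\<bar> powr enn2real p) \<partial>sphere_measure) (1 / enn2real p))"

section \<open>Random fields\<close>

definition random_field :: "'w measure \<Rightarrow> ('w \<Rightarrow> real ^ 'n \<Rightarrow> real) \<Rightarrow> bool" where
  "random_field M T \<longleftrightarrow>
     (\<lambda>(\<omega>, x). T \<omega> x) \<in> borel_measurable (M \<Otimes>\<^sub>M restrict_space borel (sphere 0 1))"

definition fin_weakly_isotropic :: "'w measure \<Rightarrow> nat \<Rightarrow> ('w \<Rightarrow> real ^ 'n \<Rightarrow> real) \<Rightarrow> bool" where
  "fin_weakly_isotropic M n T \<longleftrightarrow>
     (\<forall>x\<in>sphere 0 1. integrable M (\<lambda>\<omega>. \<bar>T \<omega> x\<bar> ^ n)) \<and>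
     (\<forall>k\<in>{1..n}. \<forall>x :: nat \<Rightarrow> real ^ 'n. \<forall>\<rho> :: real ^ 'n ^ 'n.
        (\<forall>i<k. x i \<in> sphere 0 1) \<longrightarrow> rotation_matrix \<rho> \<longrightarrow>
        (\<integral>\<omega>. (\<Prod>i<k. T \<omega> (x i)) \<partial>M) = (\<integral>\<omega>. (\<Prod>i<k. T \<omega> (\<rho> *v x i)) \<partial>M))"

text \<open>
  For odd finite \<open>N\<close> only signed moments are invariant, so \<open>x \<mapsto> E \<bar>T x\<bar> ^ N\<close> need be neither constant nor
  integrable over the sphere. In that case weak isotropy does not give a finite \<open>p\<close>-th moment of the
  \<open>L\<^sub>p\<close> norm for \<open>ceil_ennreal p = N\<close>, which has to be assumed separately.
\<close>
definition weakly_isotropic :: "'w measure \<Rightarrow> enat \<Rightarrow> ('w \<Rightarrow> real ^ 'n \<Rightarrow> real) \<Rightarrow> bool" where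
  "weakly_isotropic M N T \<longleftrightarrow>
     (case N of
        enat n \<Rightarrow> n \<ge> 1 \<and> fin_weakly_isotropic M n T
      | \<infinity> \<Rightarrow> (\<forall>n\<ge>1. fin_weakly_isotropic M n T) \<and>
             (\<integral>\<^sup>+ \<omega>. Lp_norm \<infinity> (T \<omega>) \<partial>M) < \<infinity> \<and>
             (AE \<omega> in M. continuous_on (sphere 0 1) (T \<omega>)))"

definition ceil_ennreal :: "ennreal \<Rightarrow> enat" where
  "ceil_ennreal p = (if p = \<infinity> then \<infinity> else enat (nat \<lceil>enn2real p\<rceil>))"

definition determined_by_moments :: "nat \<Rightarrow> (nat \<Rightarrow> real) measure \<Rightarrow> bool" where
  "determined_by_moments k \<mu> \<longleftrightarrow>
     (\<forall>\<nu>. prob_space \<nu> \<longrightarrow> sets \<nu> = sets (\<Pi>\<^sub>M i\<in>{..<k}. borel) \<longrightarrow>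
        (\<forall>a :: nat \<Rightarrow> nat. integrable \<nu> (\<lambda>y. \<Prod>i<k. y i ^ a i) \<and>
           (\<integral>y. (\<Prod>i<k. y i ^ a i) \<partial>\<nu>) = (\<integral>y. (\<Prod>i<k. y i ^ a i) \<partial>\<mu>)) \<longrightarrow>
        \<nu> = \<mu>)"

definition laws_determined_by_moments :: "'w measure \<Rightarrow> ('w \<Rightarrow> real ^ 'n \<Rightarrow> real) \<Rightarrow> bool" where
  "laws_determined_by_moments M T \<longleftrightarrow>
     (\<forall>k. \<forall>x :: nat \<Rightarrow> real ^ 'n. (\<forall>i<k. x i \<in> sphere 0 1) \<longrightarrow>
        determined_by_moments k
          (distr M (\<Pi>\<^sub>M i\<in>{..<k}. borel) (\<lambda>\<omega>. \<lambda>i\<in>{..<k}. T \<omega> (x i))))"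

section \<open>Needlets\<close>

definition harmonic_dim :: "nat \<Rightarrow> nat \<Rightarrow> real" where
  "harmonic_dim d l =
     (2 * real l + real d - 1) * Gamma (real l + real d - 1) / (Gamma (real d) * Gamma (real l + 1))"

definition jacobi_poly :: "nat \<Rightarrow> real \<Rightarrow> real \<Rightarrow> real \<Rightarrow> real" where
  "jacobi_poly l \<alpha> \<beta> t =
     (\<Sum>s\<le>l. ((real l + \<alpha>) gchoose (l - s)) * ((real l + \<beta>) gchoose s) *
        ((t - 1) / 2) ^ s * ((t + 1) / 2) ^ (l - s))"

definition gegenbauer :: "nat \<Rightarrow> nat \<Rightarrow> real \<Rightarrow> real" where
  "gegenbauer d l t =
     (let \<alpha> = (real d - 2) / 2 in jacobi_poly l \<alpha> \<alpha> t / jacobi_poly l \<alpha> \<alpha> 1)"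

text \<open>At a boundary point of \<open>S\<close> contained in \<open>S\<close> the derivatives are one-sided.\<close>
definition Ck_on :: "nat \<Rightarrow> real set \<Rightarrow> (real \<Rightarrow> real) \<Rightarrow> bool" where
  "Ck_on k S f \<longleftrightarrow>
     (\<exists>D :: nat \<Rightarrow> real \<Rightarrow> real.
        (\<forall>t\<in>S. D 0 t = f t) \<and>
        (\<forall>m<k. \<forall>t\<in>S. (D m has_real_derivative D (Suc m) t) (at t within S)) \<and>
        continuous_on S (D k))"

definition needlet_filter :: "nat \<Rightarrow> (real \<Rightarrow> real) \<Rightarrow> bool" where
  "needlet_filter \<kappa> h \<longleftrightarrow>
     \<kappa> \<ge> 1 \<and> (\<forall>t\<ge>0. h t \<ge> 0) \<and> Ck_on \<kappa> {0..} h \<and>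
     closure {t. t \<ge> 0 \<and> h t \<noteq> 0} = {1/2..2} \<and>
     (\<forall>t\<in>{1/2..1}. (h t)\<^sup>2 + (h (2 * t))\<^sup>2 = 1)"

text \<open>Restrictions to the sphere of polynomials of total degree at most \<open>L\<close>.\<close>
definition spherical_polynomial :: "nat \<Rightarrow> (real ^ 'n \<Rightarrow> real) \<Rightarrow> bool" where
  "spherical_polynomial L q \<longleftrightarrow>
     (\<exists>c :: ('n \<Rightarrow> nat) \<Rightarrow> real. \<forall>x\<in>sphere 0 1.
        q x = (\<Sum>a | (\<Sum>i\<in>UNIV. a i) \<le> L. c a * (\<Prod>i\<in>UNIV. (x $ i) ^ a i)))"

definition needlet_quadrature ::
    "nat \<Rightarrow> nat \<Rightarrow> (nat \<Rightarrow> real) \<Rightarrow> (nat \<Rightarrow> real ^ 'n) \<Rightarrow> bool" where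
  "needlet_quadrature j N w \<xi> \<longleftrightarrow>
     (\<forall>k\<in>{1..N}. w k > 0 \<and> \<xi> k \<in> sphere 0 1) \<and>
     (\<forall>q. spherical_polynomial (2 ^ (j + 1) - 1) q \<longrightarrow>
        (\<integral>x. q x \<partial>sphere_measure) = (\<Sum>k=1..N. w k * q (\<xi> k)))"

text \<open>The series over \<open>l\<close> has only finitely many nonzero terms, since \<open>h\<close> vanishes beyond \<open>2\<close>.\<close>
definition needlet ::
    "nat \<Rightarrow> (real \<Rightarrow> real) \<Rightarrow> (nat \<Rightarrow> nat \<Rightarrow> real) \<Rightarrow> (nat \<Rightarrow> nat \<Rightarrow> real ^ 'n) \<Rightarrow>
     nat \<Rightarrow> nat \<Rightarrow> real ^ 'n \<Rightarrow> real" where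
  "needlet d h w \<xi> j k x =
     (if j = 0 then sqrt (w 0 k)
      else sqrt (w j k) *
        (\<Sum>l. h (real l / 2 ^ (j - 1)) * harmonic_dim d l * gegenbauer d l (x \<bullet> \<xi> j k)))"

definition sphere_inner :: "(real ^ 'n \<Rightarrow> real) \<Rightarrow> (real ^ 'n \<Rightarrow> real) \<Rightarrow> real" where
  "sphere_inner f g = (\<integral>x. f x * g x \<partial>sphere_measure)"

definition order_contribution ::
    "nat \<Rightarrow> (real \<Rightarrow> real) \<Rightarrow> (nat \<Rightarrow> nat) \<Rightarrow> (nat \<Rightarrow> nat \<Rightarrow> real) \<Rightarrow> (nat \<Rightarrow> nat \<Rightarrow> real ^ 'n) \<Rightarrow>
     nat \<Rightarrow> ('w \<Rightarrow> real ^ 'n \<Rightarrow> real) \<Rightarrow> 'w \<Rightarrow> real ^ 'n \<Rightarrow> real" where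
  "order_contribution d h N w \<xi> j T \<omega> x =
     (\<Sum>k=1..N j. sphere_inner (T \<omega>) (needlet d h w \<xi> j k) * needlet d h w \<xi> j k x)"

definition needlet_approx ::
    "nat \<Rightarrow> (real \<Rightarrow> real) \<Rightarrow> (nat \<Rightarrow> nat) \<Rightarrow> (nat \<Rightarrow> nat \<Rightarrow> real) \<Rightarrow> (nat \<Rightarrow> nat \<Rightarrow> real ^ 'n) \<Rightarrow>
     nat \<Rightarrow> ('w \<Rightarrow> real ^ 'n \<Rightarrow> real) \<Rightarrow> 'w \<Rightarrow> real ^ 'n \<Rightarrow> real" where
  "needlet_approx d h N w \<xi> J T \<omega> x =
     (\<Sum>j\<le>J. \<Sum>k=1..N j. sphere_inner (T \<omega>) (needlet d h w \<xi> j k) * needlet d h w \<xi> j k x)"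

end

theory Submission
  imports Defs
begin

text \<open>
  By exactness of the quadratures and the reproducing property of zonal harmonics, the approximation of order
  \<open>J \<ge> 1\<close> is convolution with the zonal kernel \<open>K\<^sub>N = \<Sum>\<^sub>l a\<^sub>l Z\<^sub>l P\<^sub>l\<close>, where \<open>N = 2 ^ (J - 1)\<close> and \<open>a\<^sub>l\<close> is \<open>1\<close> for
  \<open>l \<le> N\<close> and \<open>h (l / N)\<^sup>2\<close> beyond. Everything follows once \<open>K\<^sub>N\<close> is an approximate identity: the \<open>L\<^sub>1\<close> norms are
  bounded and the mass away from the diagonal tends to \<open>0\<close>. Then convolution converges uniformly on continuous
  functions, hence on \<open>L\<^sub>p\<close> by density, and dominated convergence handles the expectation; the dominating
  function is a multiple of \<open>\<parallel>T\<parallel>\<^sup>p\<close> (or of \<open>\<parallel>T\<parallel>\<close> for \<open>p = \<infinity>\<close>).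

  The approximate identity property comes from the weighted bound
  \<open>\<integral> (1 - x \<bullet> z)\<^sup>s K\<^sub>N (x \<bullet> z)\<^sup>2 \<le> C N\<^sup>d / N\<^sup>2\<^sup>s\<close> for \<open>s = 0\<close> and for \<open>s = \<lfloor>d / 2\<rfloor> + 1 > d / 2\<close>, combined with the
  measure of spherical caps. Summing by parts \<open>s\<close> times replaces \<open>a\<^sub>l\<close> by its Newton divided difference of order
  \<open>s\<close> at the nodes \<open>(l + (d - 1) / 2)\<^sup>2\<close>, and \<open>Z\<^sub>l P\<^sub>l\<close> by iterated partial sums, which are Christoffel kernels and
  therefore orthogonal for the weight \<open>(1 - t)\<^sup>s\<close>. The mean value theorem for divided differences bounds the
  new coefficients by \<open>C / N\<^sup>2\<^sup>s\<close>.
\<close>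

section \<open>Normalised Gegenbauer polynomials\<close>

text \<open>The kernel may oscillate, so its \<open>L\<^sub>1\<close> norm is reached through square
  norms: for \<open>w = 1 + (N\<^sup>2 (1 - x \<bullet> z)) ^ s\<close> one has
  \<open>\<bar>K\<bar> \<le> K\<^sup>2 w / N ^ d + N ^ d / w\<close>. The weighted bounds for
  \<open>0\<close> and \<open>s\<close> control the first term, and \<open>2 s > d\<close> makes the
  integral of the second bounded. Each unit of \<open>s\<close> costs one derivative of the filter;
  \<open>d div 2 + 1\<close> is the least integer that qualifies. The nodes are the eigenvalues
  \<open>l (l + d - 1)\<close> shifted by the constant that completes the square. Scaling partial
  sums by their gaps reproduces a Christoffel--Darboux formula at the next level, and their roots
  are affine in \<open>l\<close>, so the filter is a smooth function of the root of the node.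
  Orthogonality is drawn from rotation invariance: integrals are differentiated along rotations in
  coordinate planes, which yields Green's formula for zonal functions with different centres. The
  kernel estimates use products with one common centre only, so the reproducing property can be
  deduced from them without a circle.\<close>

fun geg :: "nat \<Rightarrow> nat \<Rightarrow> real poly" where
  "geg d 0 = 1"
| "geg d (Suc 0) = [:0, 1:]"
| "geg d (Suc (Suc l)) =
     smult (1 / (real l + real d))
       (smult (2 * real l + real d + 1) ([:0, 1:] * geg d (Suc l)) - smult (real l + 1) (geg d l))"

lemma geg_rec:
  assumes "d \<ge> 2"
  shows "(real l + real d) * poly (geg d (Suc (Suc l))) t =
    (2 * real l + real d + 1) * t * poly (geg d (Suc l)) t - (real l + 1) * poly (geg d l) t"
  using assms by (simp add: field_simps)

lemma geg_one [simp]: "d \<ge> 2 \<Longrightarrow> poly (geg d l) 1 = 1"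
proof (induction d l rule: geg.induct)
  case (3 d l)
  then show ?case by (simp add: field_simps)
qed auto

section \<open>First-order relations and the Gegenbauer differential equation\<close>

lemma pderiv_geg_rec:
  assumes "d \<ge> 2"
  shows "(real l + real d) * poly (pderiv (geg d (Suc (Suc l)))) t =
    (2 * real l + real d + 1) * (poly (geg d (Suc l)) t + t * poly (pderiv (geg d (Suc l))) t)
      - (real l + 1) * poly (pderiv (geg d l)) t"
  using assms by (simp add: field_simps pderiv_smult pderiv_mult pderiv_diff pderiv_pCons)

text \<open>The two relations have to be proved together: at the next index the first one uses both
  of the present index through the differentiated recurrence, and the second one follows from the
  first of the present index.\<close>

lemma geg_deriv:
  assumes d: "d \<ge> 2"
  shows "(1 - t\<^sup>2) * poly (pderiv (geg d (Suc l))) t =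
           (real l + 1) * (poly (geg d l) t - t * poly (geg d (Suc l)) t)
       \<and> (1 - t\<^sup>2) * poly (pderiv (geg d l)) t =
           (real l + real d - 1) * (t * poly (geg d l) t - poly (geg d (Suc l)) t)"
proof (induction l)
  case 0
  show ?case by (simp add: pderiv_pCons power2_eq_square)
next
  case (Suc l)
  define a b c where "a = poly (geg d l) t" and "b = poly (geg d (Suc l)) t"
    and "c = poly (geg d (Suc (Suc l))) t"
  define a' b' c' where "a' = poly (pderiv (geg d l)) t" and "b' = poly (pderiv (geg d (Suc l))) t"
    and "c' = poly (pderiv (geg d (Suc (Suc l)))) t"
  define L D where "L = real l" and "D = real d"
  have pos: "L + D > 0" using d by (simp add: L_def D_def)
  have r: "(L + D) * c = (2 * L + D + 1) * t * b - (L + 1) * a"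
    using geg_rec[OF d, of l t] by (simp only: a_def b_def c_def L_def D_def)
  have r': "(L + D) * c' = (2 * L + D + 1) * (b + t * b') - (L + 1) * a'"
    using pderiv_geg_rec[OF d, of l t]
    by (simp only: a'_def b'_def c'_def a_def b_def L_def D_def)
  have 1: "(1 - t\<^sup>2) * b' = (L + 1) * (a - t * b)" and 2: "(1 - t\<^sup>2) * a' = (L + D - 1) * (t * a - b)"
    using Suc by (simp_all only: a'_def b'_def a_def b_def L_def D_def)
  have "(L + D) * ((1 - t\<^sup>2) * c') = (L + D) * ((L + 2) * (b - t * c))"
    using r r' 1 2 by algebra
  then have A: "(1 - t\<^sup>2) * c' = (L + 2) * (b - t * c)" using pos by simp
  have B: "(1 - t\<^sup>2) * b' = (L + D) * (t * b - c)"
    using r 1 by algebra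
  show ?case
    using A B by (simp add: a_def b_def c_def b'_def c'_def L_def D_def add_ac del: geg.simps)
qed

text \<open>The first relation is differentiated once. The derivatives this brings in are known only
  after multiplication by \<open>1 - t\<^sup>2\<close>, which is why that factor survives; it is
  cancelled afterwards in the integral domain of polynomials.\<close>

lemma geg_ode_aux:
  assumes d: "d \<ge> 2"
  shows "(1 - t\<^sup>2) * ((1 - t\<^sup>2) * poly (pderiv (pderiv (geg d l))) t
     - real d * t * poly (pderiv (geg d l)) t + real l * (real l + real d - 1) * poly (geg d l) t) = 0"
proof (cases l)
  case (Suc k)
  have eq: "[:1, 0, -1:] * pderiv (geg d (Suc k)) =
        smult (real k + 1) (geg d k - [:0, 1:] * geg d (Suc k))"
    unfolding poly_eq_poly_eq_iff[symmetric]
    using geg_deriv[OF d, of _ k] by (intro ext) (simp add: power2_eq_square algebra_simps)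
  have "poly (pderiv ([:1, 0, -1:] * pderiv (geg d (Suc k)))) t
      = poly (pderiv (smult (real k + 1) (geg d k - [:0, 1:] * geg d (Suc k)))) t"
    by (simp only: eq)
  then have 1: "(1 - t\<^sup>2) * poly (pderiv (pderiv (geg d (Suc k)))) t - 2 * t * poly (pderiv (geg d (Suc k))) t
    = (real k + 1) * (poly (pderiv (geg d k)) t - poly (geg d (Suc k)) t - t * poly (pderiv (geg d (Suc k))) t)"
    by (simp add: pderiv_smult pderiv_mult pderiv_diff pderiv_add pderiv_minus pderiv_pCons algebra_simps power2_eq_square)
  define a b a' b' b'' where "a = poly (geg d k) t" and "b = poly (geg d (Suc k)) t"
    and "a' = poly (pderiv (geg d k)) t" and "b' = poly (pderiv (geg d (Suc k))) t"
    and "b'' = poly (pderiv (pderiv (geg d (Suc k)))) t"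
  define K D where "K = real k" and "D = real d"
  have 2: "(1 - t\<^sup>2) * b'' - 2 * t * b' = (K + 1) * (a' - b - t * b')"
    using 1 by (simp only: a'_def b_def b'_def b''_def K_def)
  have 3: "(1 - t\<^sup>2) * b' = (K + 1) * (a - t * b)" and 4: "(1 - t\<^sup>2) * a' = (K + D - 1) * (t * a - b)"
    using geg_deriv[OF d, of t k] by (simp_all only: a'_def b'_def a_def b_def K_def D_def)
  have "(1 - t\<^sup>2) * ((1 - t\<^sup>2) * b'' - D * t * b' + (K + 1) * (K + 1 + D - 1) * b) = 0"
    using 2 3 4 by algebra
  then show ?thesis
    by (simp add: Suc a_def b_def b'_def b''_def K_def D_def add_ac del: geg.simps)
qed simp

lemma poly_eq_0_if_mult:
  assumes "(q :: real poly) \<noteq> 0" and "\<And>t. poly q t * poly p t = 0"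
  shows "p = 0"
proof -
  have "q * p = 0" using assms(2) by (intro poly_ext) simp
  with assms(1) show ?thesis by simp
qed

text \<open>The Laplace--Beltrami operator of the \<open>d\<close>-sphere on zonal functions, read
  in the variable \<open>t = x \<bullet> z\<close>.\<close>

definition geg_op :: "nat \<Rightarrow> real poly \<Rightarrow> real poly" where
  "geg_op d q = [:1, 0, -1:] * pderiv (pderiv q) - smult (real d) ([:0, 1:] * pderiv q)"

lemma poly_geg_op: "poly (geg_op d q) t =
   (1 - t\<^sup>2) * poly (pderiv (pderiv q)) t - real d * t * poly (pderiv q) t"
  by (simp add: geg_op_def power2_eq_square algebra_simps)

lemma geg_ode:
  assumes d: "d \<ge> 2"
  shows "geg_op d (geg d l) = smult (- real l * (real l + real d - 1)) (geg d l)"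
proof -
  have "geg_op d (geg d l) + smult (real l * (real l + real d - 1)) (geg d l) = 0"
  proof (rule poly_eq_0_if_mult)
    show "[:1, 0, -1:] \<noteq> (0::real poly)" by simp
    show "poly [:1, 0, -1:] t * poly (geg_op d (geg d l) + smult (real l * (real l + real d - 1)) (geg d l)) t = 0" for t
      using geg_ode_aux[OF d, of t l] by (simp add: poly_geg_op power2_eq_square algebra_simps)
  qed
  then show ?thesis by (simp add: eq_neg_iff_add_eq_0)
qed

text \<open>
  Differentiating the equation \<open>n\<close> times and evaluating at \<open>1\<close> expresses the derivative of order \<open>n + 1\<close> of \<open>q\<close>
  at \<open>1\<close> by the one of order \<open>n\<close>, so all of them vanish.
\<close>
lemma geg_op_unique:
  assumes d: "d \<ge> 1" and ode: "geg_op d q = smult c q" and one: "poly q 1 = 0"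
  shows "q = 0"
proof -
  have ex: "\<exists>c. [:1, 0, -1:] * (pderiv ^^ (n + 2)) q - smult (real d + 2 * real n) ([:0, 1:] * (pderiv ^^ (n + 1)) q)
       = smult c ((pderiv ^^ n) q)" for n
  proof (induction n)
    case 0
    show ?case using ode by (auto simp: geg_op_def)
  next
    case (Suc n)
    then obtain c where "[:1, 0, -1:] * (pderiv ^^ (n + 2)) q - smult (real d + 2 * real n) ([:0, 1:] * (pderiv ^^ (n + 1)) q)
       = smult c ((pderiv ^^ n) q)" by blast
    then have "pderiv ([:1, 0, -1:] * (pderiv ^^ (n + 2)) q - smult (real d + 2 * real n) ([:0, 1:] * (pderiv ^^ (n + 1)) q))
       = pderiv (smult c ((pderiv ^^ n) q))" by simp
    then have "[:1, 0, -1:] * (pderiv ^^ (Suc n + 2)) q - smult (real d + 2 * real (Suc n)) ([:0, 1:] * (pderiv ^^ (Suc n + 1)) q)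
       = smult (c + (real d + 2 * real n)) ((pderiv ^^ (Suc n)) q)"
      unfolding poly_eq_poly_eq_iff[symmetric] fun_eq_iff
      by (simp add: pderiv_mult pderiv_diff pderiv_add pderiv_minus pderiv_smult pderiv_pCons algebra_simps)
    then show ?case by blast
  qed
  have zero: "poly ((pderiv ^^ n) q) 1 = 0" for n
  proof (induction n)
    case (Suc n)
    obtain c where "[:1, 0, -1:] * (pderiv ^^ (n + 2)) q - smult (real d + 2 * real n) ([:0, 1:] * (pderiv ^^ (n + 1)) q)
       = smult c ((pderiv ^^ n) q)" using ex by blast
    then have "poly ([:1, 0, -1:] * (pderiv ^^ (n + 2)) q - smult (real d + 2 * real n) ([:0, 1:] * (pderiv ^^ (n + 1)) q)) 1
       = poly (smult c ((pderiv ^^ n) q)) 1" by simp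
    then have "(real d + 2 * real n) * poly ((pderiv ^^ (Suc n)) q) 1 = 0" using Suc by simp
    then show ?case using d by simp
  qed (use one in simp)
  \<comment> \<open>For nonzero \<open>q\<close> the derivative of order \<open>degree q\<close> is
    a nonzero constant, which contradicts its vanishing at \<open>1\<close>.\<close>
  have "degree q = 0 \<and> False" if "q \<noteq> 0"
  proof -
    have "degree ((pderiv ^^ n) q) = degree q - n \<and> (n \<le> degree q \<longrightarrow> (pderiv ^^ n) q \<noteq> 0)" for n
      using that by (induction n) (auto simp: degree_pderiv pderiv_eq_0_iff)
    from this[of "degree q"] obtain a where "(pderiv ^^ degree q) q = [:a:]" "a \<noteq> 0"
      by (metis degree_0_id diff_self_eq_0 order_refl pCons_0_0)
    with zero[of "degree q"] show ?thesis by simp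
  qed
  then show ?thesis by blast
qed

section \<open>The Jacobi polynomials solve the same equation\<close>

definition jac_coeff :: "nat \<Rightarrow> real \<Rightarrow> nat \<Rightarrow> real" where
  "jac_coeff l a s = ((real l + a) gchoose (l - s)) * ((real l + a) gchoose s)"

definition jac :: "nat \<Rightarrow> real \<Rightarrow> real poly" where
  "jac l a = (\<Sum>s\<le>l. smult (jac_coeff l a s) ([:-1/2, 1/2:] ^ s * [:1/2, 1/2:] ^ (l - s)))"

lemma poly_jac: "poly (jac l a) t = jacobi_poly l a a t"
  unfolding jac_def jacobi_poly_def jac_coeff_def poly_sum
  by (intro sum.cong refl) (simp add: algebra_simps diff_divide_distrib add_divide_distrib)

text \<open>Absorption in both binomial coefficients, whose lower indices move in opposite
  directions. Cleared of denominators, it is what lets neighbouring terms trade places in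
  \<open>jac_ode\<close>.\<close>

lemma jac_coeff_Suc:
  assumes "s < l"
  shows "(real s + 1) * (real s + a + 1) * jac_coeff l a (Suc s) =
    real (l - s) * (real (l - s) + a) * jac_coeff l a s"
proof -
  obtain r where r: "l - s = Suc r" using assms by (metis Suc_diff_Suc)
  then have l: "l = s + Suc r" using assms by simp
  have 1: "(real s + 1) * ((real l + a) gchoose Suc s) = (real l + a - real s) * ((real l + a) gchoose s)"
    using gbinomial_absorb_comp[of "real l + a" s] gbinomial_absorption[of s "real l + a"]
    by (simp add: add.commute)
  have 2: "(real r + 1) * ((real l + a) gchoose Suc r) = (real l + a - real r) * ((real l + a) gchoose r)"
    using gbinomial_absorb_comp[of "real l + a" r] gbinomial_absorption[of r "real l + a"]
    by (simp add: add.commute)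
  have "l - Suc s = r" using l by simp
  then have "(real s + 1) * (real s + a + 1) * jac_coeff l a (Suc s) =
     ((real l + a - real r) * ((real l + a) gchoose r)) * ((real s + 1) * ((real l + a) gchoose Suc s))"
    by (simp add: jac_coeff_def l algebra_simps)
  also have "\<dots> = real (l - s) * (real (l - s) + a) * jac_coeff l a s"
    unfolding 1 2[symmetric] by (simp add: jac_coeff_def r) (simp add: l algebra_simps)
  finally show ?thesis .
qed

text \<open>With \<open>t = X + Y\<close> and \<open>1 - t\<^sup>2 = - 4 X Y\<close> the operator
  keeps the total degree \<open>s + r\<close> in \<open>X\<close> and \<open>Y\<close>, so only the
  monomial itself and its two neighbours occur. Where an exponent is truncated at \<open>0\<close>
  the coefficient vanishes.\<close>

lemma jac_term_op:
  fixes s r d :: nat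
  defines "X \<equiv> [:-1/2, 1/2:] :: real poly" and "Y \<equiv> [:1/2, 1/2:]"
  defines "m \<equiv> real d / 2 - 1"
  shows "geg_op d (X ^ s * Y ^ r) =
    - (smult (real s * (real s + m)) (X ^ (s - 1) * Y ^ (r + 1)) + smult (real r * (real r + m)) (X ^ (s + 1) * Y ^ (r - 1))
      + smult (2 * real s * real r + (real d / 2) * (real s + real r)) (X ^ s * Y ^ r))"
proof -
  have X': "pderiv X = [:1/2:]" and Y': "pderiv Y = [:1/2:]" by (simp_all add: X_def Y_def pderiv_pCons)
  have pX: "poly X t = (t - 1) / 2" and pY: "poly Y t = (t + 1) / 2" for t
    by (simp_all add: X_def Y_def field_simps)
  have D1: "poly (pderiv (X ^ s * Y ^ r)) t = (real s * poly X t ^ (s - 1) * poly Y t ^ r + real r * poly X t ^ s * poly Y t ^ (r - 1)) / 2" for s r t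
    by (simp add: pderiv_mult pderiv_power X' Y' algebra_simps)
  have D1': "pderiv (X ^ s * Y ^ r) = smult (real s / 2) (X ^ (s - 1) * Y ^ r) + smult (real r / 2) (X ^ s * Y ^ (r - 1))" for s r
    by (intro poly_ext) (simp add: D1 field_simps)
  have D2: "poly (pderiv (pderiv (X ^ s * Y ^ r))) t =
    (real s * real (s - 1) * poly X t ^ (s - 2) * poly Y t ^ r + 2 * real s * real r * poly X t ^ (s - 1) * poly Y t ^ (r - 1)
      + real r * real (r - 1) * poly X t ^ s * poly Y t ^ (r - 2)) / 4" for t
    unfolding D1' pderiv_add pderiv_smult by (simp add: D1' algebra_simps)
      (simp add: field_simps numeral_2_eq_2)
  show ?thesis
  proof (intro poly_ext)
    fix t
    define x y where "x = poly X t" and "y = poly Y t"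
    have t: "t = x + y" "1 - t\<^sup>2 = - 4 * x * y"
      by (simp_all add: x_def y_def pX pY field_simps power2_eq_square)
    have "poly (geg_op d (X ^ s * Y ^ r)) t = - x * y * (real s * real (s - 1) * x ^ (s - 2) * y ^ r + 2 * real s * real r * x ^ (s - 1) * y ^ (r - 1)
      + real r * real (r - 1) * x ^ s * y ^ (r - 2)) - real d / 2 * (x + y) * (real s * x ^ (s - 1) * y ^ r + real r * x ^ s * y ^ (r - 1))"
      by (simp only: poly_geg_op D1 D2 t(2) x_def[symmetric] y_def[symmetric] t(1)[symmetric])
    also have "\<dots> = - (real s * (real s + m) * (x ^ (s - 1) * y ^ (r + 1)) + real r * (real r + m) * (x ^ (s + 1) * y ^ (r - 1))
      + (2 * real s * real r + (real d / 2) * (real s + real r)) * (x ^ s * y ^ r))"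
    proof -
      have aux: "real n * real (n - 1) * (z ^ (n - 2) * z) = real n * (real n - 1) * z ^ (n - 1)"
        "real n * (z ^ (n - 1) * z) = real n * z ^ n" for n and z :: real
        by (cases n; cases "n - 1"; simp)+
      define xs ys xs1 ys1 xs2 ys2 where "xs = x ^ s" and "ys = y ^ r" and "xs1 = x ^ (s - 1)"
        and "ys1 = y ^ (r - 1)" and "xs2 = x ^ (s - 2)" and "ys2 = y ^ (r - 2)"
      define S R S1 R1 D where "S = real s" and "R = real r" and "S1 = real (s - 1)" and "R1 = real (r - 1)" and "D = real d / 2"
      have a: "S * S1 * (xs2 * x) = S * (S - 1) * xs1" "S * (xs1 * x) = S * xs"
        "R * R1 * (ys2 * y) = R * (R - 1) * ys1" "R * (ys1 * y) = R * ys"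
        unfolding S_def S1_def R_def R1_def xs_def xs1_def xs2_def ys_def ys1_def ys2_def
        by (rule aux)+
      have "- x * y * (S * S1 * xs2 * ys + 2 * S * R * xs1 * ys1 + R * R1 * xs * ys2) - D * (x + y) * (S * xs1 * ys + R * xs * ys1)
        = - (S * (S + (D - 1)) * (xs1 * (ys * y)) + R * (R + (D - 1)) * ((xs * x) * ys1) + (2 * S * R + D * (S + R)) * (xs * ys))"
        using a by algebra
      then show ?thesis
        unfolding S_def S1_def R_def R1_def xs_def xs1_def xs2_def ys_def ys1_def ys2_def D_def m_def
        by (simp add: mult_ac)
    qed
    finally show "poly (geg_op d (X ^ s * Y ^ r)) t = poly (- (smult (real s * (real s + m)) (X ^ (s - 1) * Y ^ (r + 1)) + smult (real r * (real r + m)) (X ^ (s + 1) * Y ^ (r - 1))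
      + smult (2 * real s * real r + (real d / 2) * (real s + real r)) (X ^ s * Y ^ r))) t"
      by (simp add: x_def y_def)
  qed
qed

lemma geg_op_add: "geg_op d (p + q) = geg_op d p + geg_op d q"
  by (intro poly_ext) (simp add: poly_geg_op pderiv_add algebra_simps)
lemma geg_op_smult: "geg_op d (smult c q) = smult c (geg_op d q)"
  by (intro poly_ext) (simp add: poly_geg_op pderiv_smult algebra_simps)
lemma geg_op_sum: "geg_op d (\<Sum>i\<in>A. f i) = (\<Sum>i\<in>A. geg_op d (f i))"
proof (induction A rule: infinite_finite_induct)
  case empty
  then show ?case by (simp add: geg_op_def)
qed (simp_all add: geg_op_add, simp add: geg_op_def)

text \<open>By \<open>jac_coeff_Suc\<close> the lowered and the raised terms exchange their
  coefficients, so all three sums become diagonal in the monomials \<open>M s\<close>. For each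
  \<open>s\<close> the coefficients then add up to the same number
  \<open>l (l + d - 1)\<close>.\<close>

lemma jac_ode:
  "geg_op d (jac l (real d / 2 - 1)) = smult (- real l * (real l + real d - 1)) (jac l (real d / 2 - 1))"
proof -
  define m where "m = real d / 2 - 1"
  define X Y where "X = ([:-1/2, 1/2:] :: real poly)" and "Y = ([:1/2, 1/2:] :: real poly)"
  define A where "A = jac_coeff l m"
  have A: "(real s + 1) * (real s + 1 + m) * A (Suc s) = real (l - s) * (real (l - s) + m) * A s" if "s < l" for s
    using jac_coeff_Suc[OF that, of m] by (simp add: A_def algebra_simps)
  define M where "M s = X ^ s * Y ^ (l - s)" for s
  have J: "jac l m = (\<Sum>s\<le>l. smult (A s) (M s))"
    by (simp add: jac_def A_def M_def X_def Y_def)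
  have T: "geg_op d (M s) = - (smult (real s * (real s + m)) (X ^ (s - 1) * Y ^ (l - s + 1))
      + smult (real (l - s) * (real (l - s) + m)) (X ^ (s + 1) * Y ^ (l - s - 1))
      + smult (2 * real s * real (l - s) + (real d / 2) * (real s + real (l - s))) (M s))" for s
    unfolding M_def X_def Y_def jac_term_op m_def ..
  have "geg_op d (jac l m) = - ((\<Sum>s\<le>l. smult (A s * (real s * (real s + m))) (X ^ (s - 1) * Y ^ (l - s + 1)))
      + (\<Sum>s\<le>l. smult (A s * (real (l - s) * (real (l - s) + m))) (X ^ (s + 1) * Y ^ (l - s - 1)))
      + (\<Sum>s\<le>l. smult (A s * (2 * real s * real (l - s) + (real d / 2) * (real s + real (l - s)))) (M s)))"
    unfolding J geg_op_sum geg_op_smult T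
    by (simp only: smult_add_right smult_minus_right smult_smult sum.distrib sum_negf)
  also have "(\<Sum>s\<le>l. smult (A s * (real s * (real s + m))) (X ^ (s - 1) * Y ^ (l - s + 1)))
     = (\<Sum>s\<in>{Suc 0..l}. smult (A s * (real s * (real s + m))) (X ^ (s - 1) * Y ^ (l - s + 1)))"
    by (rule sum.mono_neutral_right) (auto simp: not_less_eq_eq)
  also have "\<dots> = (\<Sum>s<l. smult (A (Suc s) * (real (Suc s) * (real (Suc s) + m))) (X ^ (Suc s - 1) * Y ^ (l - Suc s + 1)))"
    by (rule sum.reindex_bij_witness[of _ Suc "\<lambda>s. s - 1"]) auto
  also have "\<dots> = (\<Sum>s<l. smult (A s * (real (l - s) * (real (l - s) + m))) (M s))"
  proof (rule sum.cong)
    fix s assume s: "s \<in> {..<l}"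
    then have "A (Suc s) * (real (Suc s) * (real (Suc s) + m)) = A s * (real (l - s) * (real (l - s) + m))"
      using A[of s] by (simp add: algebra_simps)
    moreover have "l - Suc s + 1 = l - s" using s by auto
    ultimately show "smult (A (Suc s) * (real (Suc s) * (real (Suc s) + m))) (X ^ (Suc s - 1) * Y ^ (l - Suc s + 1))
      = smult (A s * (real (l - s) * (real (l - s) + m))) (M s)" by (simp only: M_def diff_Suc_1)
  qed simp
  also have "\<dots> = (\<Sum>s\<le>l. smult (A s * (real (l - s) * (real (l - s) + m))) (M s))"
    by (rule sum.mono_neutral_left) auto
  also have "(\<Sum>s\<le>l. smult (A s * (real (l - s) * (real (l - s) + m))) (X ^ (s + 1) * Y ^ (l - s - 1)))
     = (\<Sum>s<l. smult (A s * (real (l - s) * (real (l - s) + m))) (X ^ (s + 1) * Y ^ (l - s - 1)))"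
    by (rule sum.mono_neutral_right) auto
  also have "\<dots> = (\<Sum>s<l. smult (A (Suc s) * (real (Suc s) * (real (Suc s) + m))) (M (Suc s)))"
  proof (rule sum.cong)
    fix s assume s: "s \<in> {..<l}"
    then have "A (Suc s) * (real (Suc s) * (real (Suc s) + m)) = A s * (real (l - s) * (real (l - s) + m))"
      using A[of s] by (simp add: algebra_simps)
    then show "smult (A s * (real (l - s) * (real (l - s) + m))) (X ^ (s + 1) * Y ^ (l - s - 1)) =
      smult (A (Suc s) * (real (Suc s) * (real (Suc s) + m))) (M (Suc s))" by (simp only: M_def) simp
  qed simp
  also have "\<dots> = (\<Sum>s\<in>{Suc 0..l}. smult (A s * (real s * (real s + m))) (M s))"
    by (rule sum.reindex_bij_witness[of _ "\<lambda>s. s - 1" Suc]) auto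
  also have "\<dots> = (\<Sum>s\<le>l. smult (A s * (real s * (real s + m))) (M s))"
    by (rule sum.mono_neutral_left) (auto simp: not_less_eq_eq)
  finally have "geg_op d (jac l m) = - (\<Sum>s\<le>l. smult (A s * (real (l - s) * (real (l - s) + m))) (M s)
     + smult (A s * (real s * (real s + m))) (M s)
     + smult (A s * (2 * real s * real (l - s) + (real d / 2) * (real s + real (l - s)))) (M s))"
    by (simp only: sum.distrib)
  also have "\<dots> = - (\<Sum>s\<le>l. smult (real l * (real l + real d - 1)) (smult (A s) (M s)))"
  proof (intro arg_cong[where f = uminus] sum.cong refl)
    fix s assume "s \<in> {..l}"
    then obtain r where l: "l = s + r" by (metis atMost_iff le_Suc_ex)
    have "A s * (real (l - s) * (real (l - s) + m)) + A s * (real s * (real s + m)) +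
       A s * (2 * real s * real (l - s) + (real d / 2) * (real s + real (l - s))) = real l * (real l + real d - 1) * A s"
      by (simp add: l m_def field_simps)
    then show "smult (A s * (real (l - s) * (real (l - s) + m))) (M s)
     + smult (A s * (real s * (real s + m))) (M s)
     + smult (A s * (2 * real s * real (l - s) + (real d / 2) * (real s + real (l - s)))) (M s) =
     smult (real l * (real l + real d - 1)) (smult (A s) (M s))"
      by (simp only: smult_add_left[symmetric] smult_smult)
  qed
  also have "\<dots> = smult (- real l * (real l + real d - 1)) (jac l m)"
    unfolding J by (intro poly_ext) (simp add: poly_sum sum_distrib_left mult_ac)
  finally show ?thesis by (simp only: m_def)
qed

lemma jac_one: "poly (jac l m) 1 = (real l + m) gchoose l"
proof -
  have "poly (jac l m) 1 = (\<Sum>s\<le>l. jac_coeff l m s * 0 ^ s)" by (simp add: jac_def poly_sum)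
  also have "\<dots> = (\<Sum>s\<in>{0}. jac_coeff l m s * 0 ^ s)"
    by (rule sum.mono_neutral_right) auto
  finally show ?thesis by (simp add: jac_coeff_def)
qed

text \<open>Both polynomials are eigenfunctions of \<open>geg_op\<close> for one eigenvalue, so a
  combination that vanishes at \<open>1\<close> is zero. The multiple \<open>c\<close> is the value
  of the Jacobi polynomial at \<open>1\<close>; it is positive because \<open>m \<ge> 0\<close>, so
  the normalisation may divide by it.\<close>

lemma gegenbauer_eq_geg:
  assumes d: "d \<ge> 2"
  shows "gegenbauer d l t = poly (geg d l) t"
proof -
  define m where "m = real d / 2 - 1"
  have m0: "m \<ge> 0" using d by (simp add: m_def)
  define c where "c = (real l + m) gchoose l"
  have "(real l + m) gchoose l > 0"
    using m0 unfolding gbinomial_prod_rev by (intro divide_pos_pos prod_pos) auto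
  then have c: "c \<noteq> 0" by (simp add: c_def)
  have "jac l m - smult c (geg d l) = 0"
  proof (rule geg_op_unique)
    have "geg_op d (jac l m - smult c (geg d l)) = geg_op d (jac l m + smult (-c) (geg d l))" by simp
    also have "\<dots> = smult (- real l * (real l + real d - 1)) (jac l m - smult c (geg d l))"
      unfolding geg_op_add geg_op_smult geg_ode[OF d] jac_ode m_def
      by (intro poly_ext) (simp add: algebra_simps)
    finally show "geg_op d (jac l m - smult c (geg d l)) = smult (- real l * (real l + real d - 1)) (jac l m - smult c (geg d l))" .
    show "poly (jac l m - smult c (geg d l)) 1 = 0" using d by (simp add: jac_one c_def)
  qed (use d in simp)
  then have J: "jac l m = smult c (geg d l)" by simp
  have "gegenbauer d l t = poly (jac l m) t / poly (jac l m) 1"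
    by (simp add: gegenbauer_def poly_jac m_def diff_divide_distrib Let_def)
  then show ?thesis using c d by (simp add: J)
qed

lemma degree_geg_le: "degree (geg d l) \<le> l"
proof (induction d l rule: geg.induct)
  case (3 d l)
  have "degree ([:0, 1:] * geg d (Suc l)) \<le> Suc (Suc l)"
    using 3(1) by (intro order_trans[OF degree_mult_le]) simp
  then show ?case using 3(2)
    by (auto intro!: order_trans[OF degree_smult_le] degree_diff_le)
qed auto

section \<open>Divided differences\<close>

fun divdiff :: "(nat \<Rightarrow> real) \<Rightarrow> (nat \<Rightarrow> real) \<Rightarrow> nat \<Rightarrow> nat \<Rightarrow> real" where
  "divdiff x a 0 l = a l"
| "divdiff x a (Suc s) l = (divdiff x a s (Suc l) - divdiff x a s l) / (x (l + Suc s) - x l)"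

text \<open>Neville's scheme for the interpolation polynomial at the nodes with indices
  \<open>l\<close> to \<open>l + s\<close>. Its coefficient of degree \<open>s\<close> is the
  divided difference, which links divided differences to derivatives.\<close>

fun neville :: "(nat \<Rightarrow> real) \<Rightarrow> (nat \<Rightarrow> real) \<Rightarrow> nat \<Rightarrow> nat \<Rightarrow> real poly" where
  "neville x a 0 l = [:a l:]"
| "neville x a (Suc s) l = smult (1 / (x (l + Suc s) - x l))
     ([:- x l, 1:] * neville x a s (Suc l) - [:- x (l + Suc s), 1:] * neville x a s l)"

lemma divdiff_cong:
  "(\<And>i. l \<le> i \<Longrightarrow> i \<le> l + s \<Longrightarrow> a i = b i) \<Longrightarrow> divdiff x a s l = divdiff x b s l"
proof (induction s arbitrary: l)
  case (Suc s)
  have "divdiff x a s (Suc l) = divdiff x b s (Suc l)" "divdiff x a s l = divdiff x b s l"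
    by (rule Suc.IH, rule Suc.prems; simp)+
  then show ?case by simp
qed simp

lemma divdiff_const: "divdiff x (\<lambda>_. c) (Suc s) l = 0"
proof (induction s arbitrary: l)
  case (Suc s)
  show ?case by (subst divdiff.simps(2)) (simp only: Suc, simp)
qed simp

lemma degree_neville: "degree (neville x a s l) \<le> s"
proof (induction s arbitrary: l)
  case (Suc s)
  have "degree ([:c, 1:] * neville x a s l) \<le> Suc s" for c l
    using Suc[of l] by (intro order_trans[OF degree_mult_le]) (simp add: Suc)
  then show ?case unfolding neville.simps
    by (intro order_trans[OF degree_smult_le] degree_diff_le)
qed simp

lemma coeff_neville: "coeff (neville x a s l) s = divdiff x a s l"
proof (induction s arbitrary: l)
  case (Suc s)
  have z: "coeff (neville x a s l) (Suc s) = 0" for l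
    using degree_neville[of x a s l] by (intro coeff_eq_0) simp
  show ?case by (simp add: Suc z)
qed simp

lemma poly_neville:
  assumes x: "strict_mono x" and i: "l \<le> i" "i \<le> l + s"
  shows "poly (neville x a s l) (x i) = a i"
  using i
proof (induction s arbitrary: l)
  case (Suc s)
  have pos: "x (l + Suc s) - x l > 0" using x by (simp add: strict_mono_less)
  have neq: "x (l + Suc s) - x l \<noteq> 0" using pos by simp
  consider "i = l" | "i = l + Suc s" | "Suc l \<le> i" "i \<le> l + s" using Suc.prems by linarith
  then show ?case
  proof cases
    case 1
    then show ?thesis using neq Suc.IH[of l] by (simp add: divide_simps) (simp add: algebra_simps)
  next
    case 2
    then show ?thesis using neq Suc.IH[of "Suc l"] by (simp add: field_simps)
  next
    case 3
    then show ?thesis using neq Suc.IH[of l] Suc.IH[of "Suc l"] by (simp add: field_simps)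
  qed
qed simp

text \<open>Rolle between consecutive zeros gives one zero less for \<open>G 1\<close>, and the
  induction continues with the shifted family. Derivatives are required on the interval only,
  because the functions in question are known to be smooth only there.\<close>

lemma iterated_Rolle:
  fixes G :: "nat \<Rightarrow> real \<Rightarrow> real"
  assumes "\<And>i. i < s \<Longrightarrow> x i < x (Suc i)" and "\<And>i. i \<le> s \<Longrightarrow> G 0 (x i) = 0"
    and "\<And>m t. m < s \<Longrightarrow> x 0 \<le> t \<Longrightarrow> t \<le> x s \<Longrightarrow> (G m has_real_derivative G (Suc m) t) (at t)"
  shows "\<exists>z. x 0 \<le> z \<and> z \<le> x s \<and> G s z = 0"
  using assms
proof (induction s arbitrary: G x)
  case 0
  then show ?case by (intro exI[of _ "x 0"]) simp
next
  case (Suc s)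
  have mono: "x i \<le> x j" if "i \<le> j" "j \<le> Suc s" for i j
    using that
  proof (induction j)
    case (Suc j)
    then show ?case using Suc.prems less_imp_le[OF \<open>\<And>i. i < Suc s \<Longrightarrow> x i < x (Suc i)\<close>, of j]
      by (cases "i = Suc j") (auto intro: order_trans)
  qed simp
  have "\<exists>y. x i < y \<and> y < x (Suc i) \<and> G 1 y = 0" if "i \<le> s" for i
  proof -
    have D: "(G 0 has_real_derivative G 1 t) (at t)" if "x i \<le> t" "t \<le> x (Suc i)" for t
      using Suc.prems(3)[of 0 t] mono[of 0 i] mono[of "Suc i" "Suc s"] \<open>i \<le> s\<close> that by simp
    have "\<exists>y. x i < y \<and> y < x (Suc i) \<and> (*) (G 1 y) = (\<lambda>v. 0)"
    proof (rule Rolle_deriv[of "x i" "x (Suc i)" "G 0" "\<lambda>t. (*) (G 1 t)"])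
      show "x i < x (Suc i)" using Suc.prems(1) that by simp
      show "G 0 (x i) = G 0 (x (Suc i))" using Suc.prems(2) that by simp
      show "continuous_on {x i..x (Suc i)} (G 0)"
        by (rule DERIV_continuous_on[where D = "G 1"], rule has_field_derivative_at_within, rule D) auto
      show "\<And>t. x i < t \<Longrightarrow> t < x (Suc i) \<Longrightarrow> (G 0 has_derivative (*) (G 1 t)) (at t)"
        using D by (simp add: has_field_derivative_def)
    qed
    then show ?thesis by (auto simp: fun_eq_iff dest!: spec[of _ 1])
  qed
  then obtain y where y: "\<And>i. i \<le> s \<Longrightarrow> x i < y i \<and> y i < x (Suc i) \<and> G 1 (y i) = 0" by metis
  have b: "x 0 \<le> y 0" "y s \<le> x (Suc s)" using y[of 0] y[of s] by auto
  have "\<exists>z. y 0 \<le> z \<and> z \<le> y s \<and> (\<lambda>m. G (Suc m)) s z = 0"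
  proof (rule Suc.IH)
    show "y i < y (Suc i)" if "i < s" for i
      using y[of i] y[of "Suc i"] that by force
    show "G (Suc 0) (y i) = 0" if "i \<le> s" for i using y[OF that] by simp
    show "(G (Suc m) has_real_derivative G (Suc (Suc m)) t) (at t)" if "m < s" "y 0 \<le> t" "t \<le> y s" for m t
      using Suc.prems(3)[of "Suc m" t] that b by auto
  qed
  then show ?case using b by (blast intro: order_trans)
qed

text \<open>The interpolation error vanishes at \<open>s + 1\<close> nodes, so its derivative of
  order \<open>s\<close> has a zero; there the derivative of the interpolation polynomial is the
  constant \<open>fact s\<close> times its leading coefficient.\<close>

lemma divdiff_mean_value:
  fixes F :: "nat \<Rightarrow> real \<Rightarrow> real"
  assumes x: "strict_mono x"
    and F0: "\<And>i. l \<le> i \<Longrightarrow> i \<le> l + s \<Longrightarrow> F 0 (x i) = a i"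
    and F: "\<And>m t. m < s \<Longrightarrow> x l \<le> t \<Longrightarrow> t \<le> x (l + s) \<Longrightarrow> (F m has_real_derivative F (Suc m) t) (at t)"
  obtains z where "x l \<le> z" "z \<le> x (l + s)" "divdiff x a s l = F s z / fact s"
proof -
  define p where "p = neville x a s l"
  have "\<exists>z. (\<lambda>i. x (l + i)) 0 \<le> z \<and> z \<le> (\<lambda>i. x (l + i)) s \<and> (\<lambda>m t. F m t - poly ((pderiv ^^ m) p) t) s z = 0"
  proof (rule iterated_Rolle)
    show "x (l + i) < x (l + Suc i)" for i using x by (simp add: strict_mono_less)
    show "F 0 (x (l + i)) - poly ((pderiv ^^ 0) p) (x (l + i)) = 0" if "i \<le> s" for i
      using that F0[of "l + i"] poly_neville[OF x, of l "l + i" s a] by (simp add: p_def)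
    show "((\<lambda>t. F m t - poly ((pderiv ^^ m) p) t) has_real_derivative F (Suc m) t - poly ((pderiv ^^ Suc m) p) t) (at t)"
      if "m < s" "x (l + 0) \<le> t" "t \<le> x (l + s)" for m t
      using F[of m t] that by (auto intro!: derivative_eq_intros poly_DERIV)
  qed
  then obtain z where z: "x l \<le> z" "z \<le> x (l + s)" "F s z = poly ((pderiv ^^ s) p) z" by auto
  have "degree ((pderiv ^^ s) p) = 0"
    using degree_neville[of x a s l] by (simp add: p_def degree_higher_pderiv)
  then obtain c where c: "(pderiv ^^ s) p = [:c:]" by (metis degree_0_id)
  have "c = coeff ((pderiv ^^ s) p) 0" by (simp add: c)
  also have "\<dots> = fact s * divdiff x a s l"
    by (simp add: coeff_higher_pderiv p_def coeff_neville pochhammer_fact)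
  finally have "F s z = fact s * divdiff x a s l" using z c by simp
  then show thesis using z that by (simp add: field_simps)
qed

section \<open>Iterated Christoffel kernels\<close>

text \<open>
  \<open>zonal d 0 l\<close> is \<open>Z\<^sub>l P\<^sub>l\<close>, and \<open>zonal d (Suc s) l\<close> is the Christoffel kernel at \<open>1\<close> of the \<open>zonal d s\<close>, scaled by the
  gap \<open>x (l + s + 1) - x l\<close> of the nodes \<open>x = zonal_node d\<close>. Its value at \<open>1\<close> is \<open>zonal_val d s l\<close>, and
  \<open>zonal_sum_val d s l\<close> is the value at \<open>1\<close> of the unscaled kernel. They are multiples of the Jacobi polynomials
  with parameters \<open>(d - 2) / 2 + s\<close> and \<open>(d - 2) / 2\<close>.
\<close>
definition zonal_u :: "nat \<Rightarrow> nat \<Rightarrow> nat \<Rightarrow> real" where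
  "zonal_u d s l = pochhammer (real l + real d / 2) s * pochhammer (real l + 1) (d - 2 + s)"

text \<open>The start makes level \<open>0\<close> of \<open>zonal_val\<close> the dimension
  \<open>Z\<^sub>l\<close>; the recursion is forced by \<open>zonal_val_Suc\<close>.\<close>

fun zonal_const :: "nat \<Rightarrow> nat \<Rightarrow> real" where
  "zonal_const d 0 = 1 / fact (d - 1)"
| "zonal_const d (Suc s) = (real s + 1) * zonal_const d s / (real d / 2 + real s)"

definition zonal_val :: "nat \<Rightarrow> nat \<Rightarrow> nat \<Rightarrow> real" where
  "zonal_val d s l = zonal_const d s * (2 * real l + real d - 1 + real s) * zonal_u d s l"

definition zonal_sum_val :: "nat \<Rightarrow> nat \<Rightarrow> nat \<Rightarrow> real" where
  "zonal_sum_val d s l = zonal_const d s / (real d / 2 + real s) * zonal_u d (Suc s) l"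

definition zonal_gap :: "nat \<Rightarrow> nat \<Rightarrow> nat \<Rightarrow> real" where
  "zonal_gap d s l = (real s + 1) * (2 * real l + real s + real d)"

fun zonal :: "nat \<Rightarrow> nat \<Rightarrow> nat \<Rightarrow> real poly" where
  "zonal d 0 l = smult (zonal_val d 0 l) (geg d l)"
| "zonal d (Suc s) l = smult (zonal_gap d s l) (\<Sum>i\<le>l. zonal d s i)"

text \<open>The factor in the Christoffel--Darboux formula \<open>zonal_cd\<close>.\<close>

definition cd_coeff :: "nat \<Rightarrow> nat \<Rightarrow> nat \<Rightarrow> real" where
  "cd_coeff d s l = 2 * (real s + 1) * (real d / 2 + real s) * zonal_sum_val d s l / zonal_gap d s l"

text \<open>For the weight \<open>(1 - t) ^ s\<close> the square norm of \<open>zonal d s l\<close>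
  is \<open>zonal_nu d s * zonal_val d s l\<close>.\<close>

fun zonal_nu :: "nat \<Rightarrow> nat \<Rightarrow> real" where
  "zonal_nu d 0 = 1"
| "zonal_nu d (Suc s) = 2 * (real s + 1) * (real d / 2 + real s) * zonal_nu d s"

definition zonal_node :: "nat \<Rightarrow> nat \<Rightarrow> real" where
  "zonal_node d l = (real l + (real d - 1) / 2)\<^sup>2"

context
  fixes d :: nat
  assumes d: "d \<ge> 2"
begin

section \<open>Closed forms of the values at 1 and of their partial sums\<close>

lemma zonal_const_pos: "zonal_const d s > 0"
  using d by (induction s) (auto intro!: divide_pos_pos mult_pos_pos add_pos_nonneg)

lemma zonal_u_pos: "zonal_u d s l > 0"
  using d by (auto simp: zonal_u_def intro!: mult_pos_pos pochhammer_pos add_nonneg_pos)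

lemma zonal_val_pos: "zonal_val d s l > 0"
  using d unfolding zonal_val_def
  by (intro mult_pos_pos zonal_const_pos zonal_u_pos) auto

lemma zonal_sum_val_pos: "zonal_sum_val d s l > 0"
  using d unfolding zonal_sum_val_def
  by (intro mult_pos_pos divide_pos_pos zonal_const_pos zonal_u_pos) auto

lemma zonal_gap_pos: "zonal_gap d s l > 0"
  using d unfolding zonal_gap_def by (intro mult_pos_pos) auto

lemma zonal_u_Suc_s:
  "zonal_u d (Suc s) l = (real l + real d / 2 + real s) * (real l + real d - 1 + real s) * zonal_u d s l"
proof -
  have "real (d - 2 + s) = real d - 2 + real s" using d by simp
  then have "zonal_u d (Suc s) l = (pochhammer (real l + real d / 2) s * (real l + real d / 2 + real s)) *
      (pochhammer (real l + 1) (d - 2 + s) * (real l + 1 + (real d - 2 + real s)))"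
    by (simp only: zonal_u_def add_Suc_right pochhammer_Suc)
  also have "\<dots> = (real l + real d / 2 + real s) * (real l + 1 + (real d - 2 + real s)) * zonal_u d s l"
    unfolding zonal_u_def by (simp only: mult_ac)
  finally show ?thesis by (simp add: add_ac)
qed

lemma pochhammer_shift: "z * pochhammer (z + 1) n = pochhammer z n * (z + of_nat n)"
  for z :: real by (metis pochhammer_Suc pochhammer_rec)

lemma zonal_u_shift:
  "(real l + real d / 2) * (real l + 1) * zonal_u d s (Suc l)
     = (real l + real d / 2 + real s) * (real l + real d - 1 + real s) * zonal_u d s l"
proof -
  have r: "real (d - 2 + s) = real d - 2 + real s" using d by simp
  have 1: "(real l + real d / 2) * pochhammer (real (Suc l) + real d / 2) s
     = pochhammer (real l + real d / 2) s * (real l + real d / 2 + real s)"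
    using pochhammer_shift[of "real l + real d / 2" s] by (simp add: add_ac)
  have 2: "(real l + 1) * pochhammer (real (Suc l) + 1) (d - 2 + s)
     = pochhammer (real l + 1) (d - 2 + s) * (real l + 1 + (real d - 2 + real s))"
    using pochhammer_shift[of "real l + 1" "d - 2 + s"] r by (simp add: add_ac)
  have "(real l + real d / 2) * (real l + 1) * zonal_u d s (Suc l)
     = ((real l + real d / 2) * pochhammer (real (Suc l) + real d / 2) s) *
       ((real l + 1) * pochhammer (real (Suc l) + 1) (d - 2 + s))"
    unfolding zonal_u_def by (simp only: mult_ac)
  also have "\<dots> = (pochhammer (real l + real d / 2) s * (real l + real d / 2 + real s)) *
     (pochhammer (real l + 1) (d - 2 + s) * (real l + 1 + (real d - 2 + real s)))"
    by (simp only: 1 2)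
  also have "\<dots> = (real l + real d / 2 + real s) * (real l + 1 + (real d - 2 + real s)) * zonal_u d s l"
    unfolding zonal_u_def by (simp only: mult_ac)
  finally show ?thesis by (simp add: add_ac)
qed

text \<open>A telescoping sum. \<open>zonal_u_shift\<close> expresses the closed form at
  \<open>l\<close> through \<open>zonal_u d s (Suc l)\<close>; the difference of the two quadratic
  factors is then \<open>h + S\<close> times the linear factor in \<open>zonal_val\<close>, and
  \<open>h + S\<close> cancels.\<close>

lemma sum_zonal_val: "(\<Sum>i\<le>l. zonal_val d s i) = zonal_sum_val d s l"
proof (induction l)
  case 0
  have "pochhammer (real d / 2) (Suc s) = pochhammer (real d / 2) s * (real d / 2 + real s)"
    by (simp add: pochhammer_Suc)
  moreover have "real (d - 2 + s) = real d - 2 + real s" using d by simp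
  moreover have "real d / 2 + real s \<noteq> 0" "real d + 2 * real s \<noteq> 0" using d by (auto intro!: add_pos_nonneg less_imp_neq[THEN not_sym])
  ultimately show ?case
    by (simp add: zonal_val_def zonal_sum_val_def zonal_u_def pochhammer_Suc field_simps)
next
  case (Suc l)
  define h L S where "h = real d / 2" and "L = real l" and "S = real s"
  define u0 u1 c where "u0 = zonal_u d s l" and "u1 = zonal_u d s (Suc l)" and "c = zonal_const d s"
  have hD: "real d = 2 * h" by (simp add: h_def)
  have nz: "h + S \<noteq> 0" using d by (auto simp: h_def S_def intro!: add_pos_nonneg less_imp_neq[THEN not_sym])
  have sh: "(L + h) * (L + 1) * u1 = (L + h + S) * (L + 2 * h - 1 + S) * u0"
    using zonal_u_shift[of l s] by (simp add: h_def L_def S_def u0_def u1_def)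
  have us: "zonal_u d (Suc s) l = (L + h + S) * (L + 2 * h - 1 + S) * u0"
      "zonal_u d (Suc s) (Suc l) = (L + 1 + h + S) * (L + 1 + 2 * h - 1 + S) * u1"
    unfolding zonal_u_Suc_s by (simp_all add: h_def L_def S_def u0_def u1_def)
  have "zonal_sum_val d s (Suc l) - zonal_sum_val d s l = c / (h + S) * ((L + 1 + h + S) * (L + 1 + 2 * h - 1 + S) * u1 - (L + h) * (L + 1) * u1)"
    unfolding zonal_sum_val_def us sh by (simp add: c_def h_def S_def right_diff_distrib)
  also have "(L + 1 + h + S) * (L + 1 + 2 * h - 1 + S) * u1 - (L + h) * (L + 1) * u1 = (h + S) * ((2 * (L + 1) + 2 * h - 1 + S) * u1)"
    by (simp add: algebra_simps)
  also have "c / (h + S) * ((h + S) * ((2 * (L + 1) + 2 * h - 1 + S) * u1)) = zonal_val d s (Suc l)"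
    using nz by (simp add: zonal_val_def hD c_def u1_def L_def S_def add_ac)
  finally show ?case using Suc by simp
qed

lemma zonal_val_Suc: "zonal_val d (Suc s) l = zonal_gap d s l * zonal_sum_val d s l"
  by (simp add: zonal_val_def zonal_gap_def zonal_sum_val_def add_ac mult_ac)

text \<open>The left-hand side is the coefficient that the induction step of \<open>zonal_cd\<close>
  produces for level \<open>s + 1\<close>.\<close>

lemma cd_coeff_Suc:
  "2 * (real s + 1) * (real d / 2 + real s) * zonal_sum_val d s l * zonal_sum_val d s (Suc l)
     / zonal_val d s (Suc l) = cd_coeff d (Suc s) l"
proof -
  define h L S where "h = real d / 2" and "L = real l" and "S = real s"
  define u1 w c where "u1 = zonal_u d s (Suc l)" and "w = zonal_u d (Suc s) l" and "c = zonal_const d s"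
  have h: "h > 0" and hD: "real d = 2 * h" and h1: "2 * h \<ge> 2" using d by (simp_all add: h_def)
  have pos: "u1 > 0" "w > 0" "c > 0" "L \<ge> 0" "S \<ge> 0"
    by (simp_all add: u1_def w_def c_def zonal_u_pos zonal_const_pos L_def S_def)
  have u: "zonal_u d (Suc s) (Suc l) = (L + 1 + h + S) * (L + 2 * h + S) * u1"
    "zonal_u d (Suc (Suc s)) l = (L + h + S + 1) * (L + 2 * h + S) * w"
    unfolding zonal_u_Suc_s[of s "Suc l"] zonal_u_Suc_s[of "Suc s" l]
    by (simp_all add: h_def L_def S_def u1_def w_def add_ac)
  have p: "h + S > 0" "h + (S + 1) > 0" "2 * L + 2 * h + 1 + S > 0" using pos h h1 by auto
  have "2 * (real s + 1) * (real d / 2 + real s) * zonal_sum_val d s l * zonal_sum_val d s (Suc l)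
     / zonal_val d s (Suc l) = 2 * (S + 1) * (h + S) * (c / (h + S) * w) * (c / (h + S) * ((L + 1 + h + S) * (L + 2 * h + S) * u1))
     / (c * (2 * L + 2 * h + 1 + S) * u1)"
    unfolding zonal_sum_val_def zonal_val_def u w_def[symmetric] c_def[symmetric] u1_def[symmetric]
    by (simp add: hD S_def L_def algebra_simps)
  also have "\<dots> = 2 * (S + 1) * c / (h + S) * w * ((L + 1 + h + S) * (L + 2 * h + S)) / (2 * L + 2 * h + 1 + S)"
    using pos p by (simp add: divide_simps)
  also have "\<dots> = 2 * (S + 2) * (h + (S + 1)) * (((S + 1) * c / (h + S)) / (h + (S + 1)) * ((L + h + S + 1) * (L + 2 * h + S) * w)) / ((S + 2) * (2 * L + 2 * h + 1 + S))"
    using pos p by (simp add: divide_simps) (simp add: algebra_simps)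
  also have "\<dots> = cd_coeff d (Suc s) l"
    unfolding cd_coeff_def zonal_sum_val_def u zonal_gap_def
    by (simp add: hD S_def L_def w_def c_def add_ac)
  finally show ?thesis .
qed

section \<open>The Christoffel--Darboux formula and repeated summation by parts\<close>

lemma geg_three_term:
  "(2 * real l + real d + 1) * t * poly (geg d (Suc l)) t =
     (real l + real d) * poly (geg d (Suc (Suc l))) t + (real l + 1) * poly (geg d l) t"
  using geg_rec[OF d, of l t] by simp

text \<open>The classical formula in two variables with the second one set to \<open>1\<close>,
  where the normalised polynomials are \<open>1\<close>. In the induction the three-term recurrence
  removes the factor \<open>t\<close> from the added term.\<close>

lemma zonal_cd_0:
  "(1 - t) * (\<Sum>i\<le>l. poly (zonal d 0 i) t) =
     cd_coeff d 0 l * (poly (zonal d 0 l) t / zonal_val d 0 l - poly (zonal d 0 (Suc l)) t / zonal_val d 0 (Suc l))"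
proof -
  define g where "g i = poly (geg d i) t" for i
  define v where "v i = zonal_u d 0 i" for i
  define c where "c = zonal_const d 0"
  have c: "c > 0" and v: "v i > 0" for i by (simp_all add: c_def v_def zonal_const_pos zonal_u_pos)
  have cd: "cd_coeff d 0 i = c * (real i + real d - 1) * v i" for i
  proof -
    have "2 * real i + real d > 0" using d by simp
    then show ?thesis using d
      by (simp add: cd_coeff_def zonal_sum_val_def zonal_gap_def zonal_u_Suc_s c_def v_def divide_simps)
  qed
  have val: "zonal_val d 0 i = c * (2 * real i + real d - 1) * v i" for i
    by (simp add: zonal_val_def c_def v_def)
  have vs: "(real i + 1) * v (Suc i) = (real i + real d - 1) * v i" for i
  proof -
    have "real i + real d / 2 \<noteq> 0" using d by (intro less_imp_neq[THEN not_sym] add_nonneg_pos) auto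
    then show ?thesis using zonal_u_shift[of i 0] by (simp add: v_def)
  qed
  have "(1 - t) * (\<Sum>i\<le>l. zonal_val d 0 i * g i) = cd_coeff d 0 l * (g l - g (Suc l))"
  proof (induction l)
    case 0
    show ?case by (simp add: g_def cd val algebra_simps)
  next
    case (Suc l)
    have r: "(2 * real l + real d + 1) * t * g (Suc l) = (real l + real d) * g (Suc (Suc l)) + (real l + 1) * g l"
      unfolding g_def by (rule geg_three_term)
    define L D x y V where "L = real l" and "D = real d" and "x = v l" and "y = v (Suc l)"
      and "V = c * (2 * (L + 1) + D - 1) * y"
    have r': "(2 * L + D + 1) * t * g (Suc l) = (L + D) * g (Suc (Suc l)) + (L + 1) * g l"
      using r by (simp add: L_def D_def)
    have s': "(L + 1) * y = (L + D - 1) * x" using vs[of l] by (simp add: L_def D_def x_def y_def)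
    have "(1 - t) * (V * g (Suc l)) + c * (L + D - 1) * x * (g l - g (Suc l)) =
       c * (L + 1 + D - 1) * y * (g (Suc l) - g (Suc (Suc l)))"
      unfolding V_def using r' s' by algebra
    then show ?case using Suc by (simp add: cd val distrib_left L_def D_def x_def y_def V_def add_ac)
  qed
  moreover have "poly (zonal d 0 i) t = zonal_val d 0 i * g i" for i by (simp add: g_def)
  ultimately show ?thesis using zonal_val_pos[of 0] by (simp add: less_imp_neq[THEN not_sym])
qed

lemma abel_telescope:
  fixes r e :: "nat \<Rightarrow> real"
  shows "(\<Sum>i\<le>l. (\<Sum>j\<le>i. e j) * (r i - r (Suc i))) = (\<Sum>i\<le>l. e i * r i) - (\<Sum>j\<le>l. e j) * r (Suc l)"
  by (induction l) (auto simp: algebra_simps)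

text \<open>
  The Christoffel--Darboux formula. The step in \<open>s\<close> is an Abel summation: multiplying the formula for \<open>s\<close> by
  \<open>zonal_gap\<close> turns its coefficients into a constant multiple of the partial sums of \<open>zonal_val\<close>.
\<close>
lemma zonal_cd:
  "(1 - t) * (\<Sum>i\<le>l. poly (zonal d s i) t) =
     cd_coeff d s l * (poly (zonal d s l) t / zonal_val d s l - poly (zonal d s (Suc l)) t / zonal_val d s (Suc l))"
proof (induction s arbitrary: l)
  case 0
  show ?case by (rule zonal_cd_0)
next
  case (Suc s)
  define k where "k i = (\<Sum>j\<le>i. poly (zonal d s j) t)" for i
  define e r q where "e i = zonal_val d s i" and "r i = poly (zonal d s i) t / zonal_val d s i"
    and "q i = zonal_sum_val d s i" for i
  define K where "K = 2 * (real s + 1) * (real d / 2 + real s)"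
  have e: "e i > 0" and q: "q i > 0" for i by (simp_all add: e_def q_def zonal_val_pos zonal_sum_val_pos)
  have qe: "q i = (\<Sum>j\<le>i. e j)" for i by (simp add: q_def e_def sum_zonal_val)
  have er: "e i * r i = poly (zonal d s i) t" for i using zonal_val_pos[of s i] by (simp add: e_def r_def)
  have ker: "k i = (\<Sum>j\<le>i. e j * r j)" for i by (simp add: k_def er)
  have z: "poly (zonal d (Suc s) i) t = zonal_gap d s i * k i" for i by (simp add: k_def poly_sum)
  have kq: "k i / q i = poly (zonal d (Suc s) i) t / zonal_val d (Suc s) i" for i
    using zonal_gap_pos[of s i] by (simp add: z zonal_val_Suc q_def del: zonal.simps)
  have gc: "zonal_gap d s i * cd_coeff d s i = K * q i" for i
    using zonal_gap_pos[of s i] by (simp add: cd_coeff_def K_def q_def)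
  have "(1 - t) * (\<Sum>i\<le>l. poly (zonal d (Suc s) i) t) = (\<Sum>i\<le>l. zonal_gap d s i * ((1 - t) * k i))"
    by (simp add: z sum_distrib_left mult_ac del: zonal.simps)
  also have "\<dots> = (\<Sum>i\<le>l. (zonal_gap d s i * cd_coeff d s i) * (r i - r (Suc i)))"
    by (simp add: k_def Suc r_def mult_ac)
  also have "\<dots> = K * (\<Sum>i\<le>l. (\<Sum>j\<le>i. e j) * (r i - r (Suc i)))"
    by (simp only: gc mult.assoc qe) (simp only: sum_distrib_left[symmetric])
  also have "\<dots> = K * (k l - q l * r (Suc l))"
    by (simp only: abel_telescope ker qe)
  \<comment> \<open>Solving \<open>k (Suc l) = k l + e (Suc l) * r (Suc l)\<close> for the last
    ratio turns the expression into a difference of normalised kernels \<open>k / q\<close>.\<close>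
  also have "\<dots> = K * q l * q (Suc l) / e (Suc l) * (k l / q l - k (Suc l) / q (Suc l))"
  proof -
    have r1: "r (Suc l) = (k (Suc l) - k l) / e (Suc l)" using e[of "Suc l"] by (simp add: ker)
    have q1: "q (Suc l) = q l + e (Suc l)" by (simp add: qe)
    show ?thesis unfolding r1 using e[of "Suc l"] q[of l] q[of "Suc l"]
      by (simp add: field_simps) (simp add: q1 algebra_simps)
  qed
  also have "K * q l * q (Suc l) / e (Suc l) = cd_coeff d (Suc s) l"
    unfolding K_def q_def e_def by (rule cd_coeff_Suc)
  finally show ?case by (simp only: kq)
qed

lemma zonal_nu_pos: "zonal_nu d s > 0"
  using d by (induction s) (auto intro!: mult_pos_pos add_pos_nonneg)

lemma zonal_node_gap: "zonal_node d (l + Suc s) - zonal_node d l = zonal_gap d s l"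
  by (simp add: zonal_node_def zonal_gap_def power2_eq_square field_simps)

text \<open>Each level is one summation by parts. The gap of the nodes is both the denominator of
  the next divided difference and the scaling of the next kernel, so it passes from one to the
  other; the boundary term vanishes since all coefficients from \<open>L\<close> on are
  \<open>0\<close>.\<close>

lemma zonal_expansion:
  assumes a: "\<And>l. l \<ge> L \<Longrightarrow> a l = 0"
  shows "(\<Sum>l<L. smult (a l) (zonal d 0 l)) =
     smult ((-1) ^ s) (\<Sum>l<L. smult (divdiff (zonal_node d) a s l) (zonal d s l))"
proof (induction s)
  case (Suc s)
  have z: "divdiff (zonal_node d) a s L = 0" for s
    using divdiff_cong[of L s a "\<lambda>_. 0" "zonal_node d"] a divdiff_const[of "zonal_node d" 0 "s - 1" L]
    by (cases s) auto
  have ab: "(\<Sum>l<m. smult (f l) (z l)) = smult (f m) (\<Sum>l<m. z l) - (\<Sum>l<m. smult (f (Suc l) - f l) (\<Sum>i\<le>l. z i))"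
    for f :: "nat \<Rightarrow> real" and z :: "nat \<Rightarrow> real poly" and m
    by (induction m) (auto simp: smult_add_right lessThan_Suc_atMost[symmetric] smult_diff_left algebra_simps)
  have "divdiff (zonal_node d) a s (Suc l) - divdiff (zonal_node d) a s l = divdiff (zonal_node d) a (Suc s) l * zonal_gap d s l" for l
    using zonal_gap_pos[of s l] zonal_node_gap[of l s] by simp
  then have "(\<Sum>l<L. smult (divdiff (zonal_node d) a s l) (zonal d s l)) =
      - (\<Sum>l<L. smult (divdiff (zonal_node d) a (Suc s) l) (zonal d (Suc s) l))"
    by (subst ab) (simp add: z del: divdiff.simps)
  then show ?case using Suc by (simp del: divdiff.simps)
qed simp

section \<open>Weighted orthogonality for a linear functional on polynomials\<close>

context
  fixes E :: "real poly \<Rightarrow> real"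
  assumes E_add: "\<And>p q. E (p + q) = E p + E q"
    and E_smult: "\<And>c p. E (smult c p) = c * E p"
    and E_zonal: "\<And>l m. E (zonal d 0 l * zonal d 0 m) = (if l = m then zonal_val d 0 l else 0)"
begin

lemma functional_sum: "E (\<Sum>i\<in>A. f i) = (\<Sum>i\<in>A. E (f i))"
proof (induction A rule: infinite_finite_induct)
  case empty
  then show ?case using E_smult[of 0 0] by simp
next
  case (infinite A)
  then show ?case using E_smult[of 0 0] by simp
qed (simp add: E_add)

lemma functional_diff: "E (p - q) = E p - E q"
  using E_add[of p "smult (-1) q"] E_smult[of "-1" q] by simp

text \<open>The kernel \<open>k l\<close>, paired with the normalised \<open>R i\<close>, gives
  \<open>zonal_nu d s\<close> for \<open>i \<le> l\<close> and \<open>0\<close> beyond. One factor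
  \<open>1 - t\<close> of the new weight turns \<open>k m\<close> into a multiple of
  \<open>R m - R (Suc m)\<close>, and for \<open>m \<le> l\<close> the two pairings cancel unless
  \<open>m = l\<close>.\<close>

lemma zonal_orthogonal:
  "E ([:1, -1:] ^ s * (zonal d s l * zonal d s m)) = (if l = m then zonal_nu d s * zonal_val d s l else 0)"
proof (induction s arbitrary: l m)
  case 0
  show ?case using E_zonal by simp
next
  case (Suc s)
  have main: "E ([:1, -1:] ^ Suc s * (zonal d (Suc s) l * zonal d (Suc s) m)) =
     (if l = m then zonal_nu d (Suc s) * zonal_val d (Suc s) l else 0)" if lm: "m \<le> l" for l m
  proof -
    define k where "k i = (\<Sum>j\<le>i. zonal d s j)" for i
    define R where "R i = smult (1 / zonal_val d s i) (zonal d s i)" for i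
    have cd: "[:1, -1:] * k m = smult (cd_coeff d s m) (R m - R (Suc m))"
      by (intro poly_ext) (use zonal_cd[where s = s and l = m] in \<open>simp add: k_def R_def poly_sum algebra_simps\<close>)
    have kR: "E ([:1, -1:] ^ s * (k l * R i)) = (if i \<le> l then zonal_nu d s else 0)" for i
    proof -
      have "E ([:1, -1:] ^ s * (k l * R i)) = (\<Sum>j\<le>l. E ([:1, -1:] ^ s * (zonal d s j * zonal d s i)) / zonal_val d s i)"
        unfolding k_def R_def sum_distrib_left sum_distrib_right functional_sum
        by (simp add: E_smult sum_divide_distrib)
      also have "\<dots> = (if i \<le> l then zonal_nu d s else 0)"
        using zonal_val_pos[of s i] by (simp add: Suc if_distrib[of "\<lambda>x. x / _"] cong: if_cong)
      finally show ?thesis .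
    qed
    have "E ([:1, -1:] ^ Suc s * (zonal d (Suc s) l * zonal d (Suc s) m)) =
      E (smult (zonal_gap d s l * zonal_gap d s m) ([:1, -1:] ^ s * (k l * ([:1, -1:] * k m))))"
      by (simp only: zonal.simps k_def[symmetric] mult_smult_left mult_smult_right smult_smult power_Suc mult_ac)
    also have "\<dots> = zonal_gap d s l * zonal_gap d s m * cd_coeff d s m *
       (E ([:1, -1:] ^ s * (k l * R m)) - E ([:1, -1:] ^ s * (k l * R (Suc m))))"
      unfolding cd by (simp only: mult_smult_right right_diff_distrib smult_diff_right E_smult functional_diff mult.assoc)
    also have "\<dots> = (if l = m then zonal_nu d (Suc s) * zonal_val d (Suc s) l else 0)"
    proof (cases "l = m")
      case True
      have "zonal_gap d s m * cd_coeff d s m = 2 * (real s + 1) * (real d / 2 + real s) * zonal_sum_val d s m"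
        using zonal_gap_pos[of s m] by (simp add: cd_coeff_def)
      then have "zonal_gap d s m * zonal_gap d s m * cd_coeff d s m * zonal_nu d s = zonal_nu d (Suc s) * zonal_val d (Suc s) m"
        unfolding zonal_val_Suc zonal_nu.simps by algebra
      then show ?thesis unfolding True[symmetric] by (simp add: kR del: zonal_nu.simps)
    next
      case False
      then show ?thesis using lm by (simp add: kR)
    qed
    finally show ?thesis .
  qed
  show ?case
  proof (cases "m \<le> l")
    case True
    then show ?thesis by (rule main)
  next
    case False
    then show ?thesis using main[of l m] by (simp add: mult_ac del: zonal.simps zonal_nu.simps)
  qed
qed

text \<open>Parseval for the expansion after \<open>s\<close> summations by parts; its sign
  disappears in the square.\<close>

lemma zonal_weighted_norm:
  assumes a: "\<And>l. l \<ge> L \<Longrightarrow> a l = 0"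
  defines "K \<equiv> \<Sum>l<L. smult (a l) (zonal d 0 l)"
  shows "E ([:1, -1:] ^ s * (K * K)) = (\<Sum>l<L. (divdiff (zonal_node d) a s l)\<^sup>2 * (zonal_nu d s * zonal_val d s l))"
proof -
  define b where "b = divdiff (zonal_node d) a s"
  define G where "G = (\<Sum>l<L. smult (b l) (zonal d s l))"
  have K: "K = smult ((-1) ^ s) G" unfolding K_def G_def b_def by (rule zonal_expansion[OF a])
  have "K * K = smult ((-1) ^ s * (-1) ^ s) (G * G)" by (simp add: K)
  also have "(-1 :: real) ^ s * (-1) ^ s = 1" by (simp add: power_mult_distrib[symmetric])
  finally have "K * K = G * G" by simp
  then have "[:1, -1:] ^ s * (K * K) = (\<Sum>l<L. \<Sum>m<L. smult (b l * b m) ([:1, -1:] ^ s * (zonal d s l * zonal d s m)))"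
    by (simp add: G_def sum_product sum_distrib_left mult_ac)
  then have "E ([:1, -1:] ^ s * (K * K)) = (\<Sum>l<L. \<Sum>m<L. if l = m then b l * b m * (zonal_nu d s * zonal_val d s l) else 0)"
    by (simp add: functional_sum E_smult zonal_orthogonal if_distrib cong: if_cong)
  also have "\<dots> = (\<Sum>l<L. (b l)\<^sup>2 * (zonal_nu d s * zonal_val d s l))"
    by (simp add: power2_eq_square)
  finally show ?thesis by (simp add: b_def)
qed

end

end

section \<open>Rotation invariance and zonal functions\<close>

text \<open>
  The library has this only for vectors over well-ordered index types. The proof is the uniqueness argument for
  translation invariant measures, where the unit ball serves to compare the constants.
\<close>
lemma emeasure_lborel_orthogonal_vimage:
  fixes f :: "'a::euclidean_space \<Rightarrow> 'a"
  assumes f: "orthogonal_transformation f" and A: "A \<in> sets borel"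
  shows "emeasure lborel (f -` A) = emeasure lborel A"
proof -
  define g where "g = inv f"
  have lf: "linear f" using f by (rule orthogonal_transformation_linear)
  have bij: "bij f" using f by (rule orthogonal_transformation_bij)
  have fg: "f (g x) = x" for x using bij by (simp add: g_def bij_is_surj surj_f_inv_f)
  have nf: "norm (f x) = norm x" for x using f by (rule orthogonal_transformation_norm)
  have fadd: "f (x + y) = f x + f y" "f (x - y) = f x - f y" for x y
    using lf by (simp_all add: linear_add linear_diff)
  have [measurable]: "f \<in> borel_measurable borel"
    using lf by (intro borel_measurable_continuous_onI linear_continuous_on linear_conv_bounded_linear[THEN iffD1])
  note A [measurable]
  define B where "B = ball (0::'a) 1"
  have [measurable]: "B \<in> sets borel" by (simp add: B_def)
  have trans: "(\<integral>\<^sup>+x. h (c + x) \<partial>lborel) = (\<integral>\<^sup>+x. h x \<partial>lborel)" if [measurable]: "h \<in> borel_measurable borel" for h and c :: 'a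
    by (subst (2) lborel_distr_plus[symmetric, of c], subst nn_integral_distr) auto
  have "emeasure lborel B * emeasure lborel (f -` A) = (\<integral>\<^sup>+y. indicator B y * (\<integral>\<^sup>+x. indicator A (f x) \<partial>lborel) \<partial>lborel)"
  proof -
    have "(\<integral>\<^sup>+x. indicator A (f x) \<partial>lborel) = (\<integral>\<^sup>+x. indicator (f -` A) x \<partial>lborel)"
      by (intro nn_integral_cong) (simp add: indicator_def)
    also have "\<dots> = emeasure lborel (f -` A)"
      using measurable_sets[of f borel borel A] by simp
    finally show ?thesis by (simp add: nn_integral_multc)
  qed
  also have "\<dots> = (\<integral>\<^sup>+y. \<integral>\<^sup>+x. indicator B y * indicator A (f x + y) \<partial>lborel \<partial>lborel)"
  proof (rule nn_integral_cong)
    fix y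
    have "(\<integral>\<^sup>+x. indicator A (f x) \<partial>lborel) = (\<integral>\<^sup>+x. indicator A (f (g y + x)) \<partial>(lborel :: 'a measure))"
      by (rule trans[symmetric]) simp
    then show "indicator B y * (\<integral>\<^sup>+x. indicator A (f x) \<partial>lborel) = (\<integral>\<^sup>+x. indicator B y * indicator A (f x + y) \<partial>lborel)"
      by (simp add: fadd fg nn_integral_cmult add.commute)
  qed
  also have "\<dots> = (\<integral>\<^sup>+x. \<integral>\<^sup>+y. indicator B y * indicator A (f x + y) \<partial>lborel \<partial>lborel)"
    by (rule lborel_pair.Fubini') measurable
  also have "\<dots> = (\<integral>\<^sup>+x. \<integral>\<^sup>+y. indicator B (y - f x) * indicator A y \<partial>lborel \<partial>lborel)"
  proof (rule nn_integral_cong)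
    fix x
    show "(\<integral>\<^sup>+y. indicator B y * indicator A (f x + y) \<partial>lborel) = (\<integral>\<^sup>+y. indicator B (y - f x) * indicator A y \<partial>(lborel :: 'a measure))"
      using trans[of "\<lambda>y. indicator B (y - f x) * indicator A y" "f x"] by simp
  qed
  also have "\<dots> = (\<integral>\<^sup>+y. \<integral>\<^sup>+x. indicator B (y - f x) * indicator A y \<partial>lborel \<partial>lborel)"
    by (rule lborel_pair.Fubini') measurable
  \<comment> \<open>For fixed \<open>y\<close> the points \<open>x\<close> with
    \<open>y - f x\<close> in the unit ball form the unit ball around the preimage of
    \<open>y\<close>, because \<open>f\<close> preserves norms; its volume is independent of the
    centre.\<close>
  also have "\<dots> = (\<integral>\<^sup>+y. emeasure lborel B * indicator A y \<partial>lborel)"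
  proof (rule nn_integral_cong)
    fix y
    have "y - f x = f (g y - x)" for x by (simp add: fadd fg)
    then have "(indicator B (y - f x) :: ennreal) = indicator (ball (g y) 1) x" for x
      by (auto simp: indicator_def B_def nf dist_norm)
    then have "(\<integral>\<^sup>+x. indicator B (y - f x) \<partial>lborel) = emeasure lborel (ball (g y) 1)" by simp
    also have "\<dots> = emeasure lborel B" by (simp add: B_def emeasure_ball)
    finally show "(\<integral>\<^sup>+x. indicator B (y - f x) * indicator A y \<partial>lborel) = emeasure lborel B * indicator A y"
      by (simp add: nn_integral_multc)
  qed
  also have "\<dots> = emeasure lborel B * emeasure lborel A" by (simp add: nn_integral_cmult)
  finally have eq: "emeasure lborel B * emeasure lborel (f -` A) = emeasure lborel B * emeasure lborel A" .
  have "emeasure lborel B \<noteq> 0" "emeasure lborel B \<noteq> \<top>"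
    by (simp_all add: B_def emeasure_ball less_imp_neq[OF unit_ball_vol_pos, THEN not_sym])
  then show ?thesis using eq by (simp add: ennreal_mult_cancel_left)
qed

text \<open>The measure before it is restricted to the sphere. Its sets are all Borel sets of the
  space, so transformations and regularity can be handled without traces on the sphere.\<close>

abbreviation cone_measure :: "(real ^ 'n) measure" where
  "cone_measure \<equiv> distr (uniform_measure lborel (ball 0 1)) borel sgn"

lemma sgn_orthogonal:
  fixes f :: "real ^ 'n \<Rightarrow> real ^ 'n"
  assumes "orthogonal_transformation f"
  shows "sgn (f x) = f (sgn x)"
  using orthogonal_transformation_norm[OF assms] orthogonal_transformation_linear[OF assms]
  by (simp add: sgn_div_norm linear_scale)

lemma emeasure_ball_pos:
  "emeasure lborel (ball (0::real^'n) 1) \<noteq> 0" "emeasure lborel (ball (0::real^'n) 1) \<noteq> \<top>"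
  by (simp_all add: emeasure_ball less_imp_neq[OF unit_ball_vol_pos, THEN not_sym])

lemma prob_space_cone_measure: "prob_space (cone_measure :: (real ^ 'n) measure)"
proof -
  interpret prob_space "uniform_measure lborel (ball (0::real^'n) 1)"
    using emeasure_ball_pos by (intro prob_space_uniform_measure) (auto simp: infinity_ennreal_def)
  show ?thesis by (rule prob_space_distr) simp
qed

text \<open>The only point whose radial projection misses the sphere is the origin, where
  \<open>sgn\<close> is \<open>0\<close>; it is a null set.\<close>

lemma AE_cone_measure: "AE x in (cone_measure :: (real ^ 'n) measure). x \<in> sphere 0 1"
proof (subst AE_distr_iff)
  have "AE x in lborel. x \<noteq> (0::real^'n)" by (rule AE_lborel_singleton)
  then have "AE x in uniform_measure lborel (ball (0::real^'n) 1). x \<noteq> 0"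
    using emeasure_ball_pos
    by (subst AE_uniform_measure) (auto simp: top.not_eq_extremum)
  then show "AE x in uniform_measure lborel (ball (0::real^'n) 1). sgn x \<in> sphere 0 1"
    by eventually_elim (simp add: norm_sgn)
qed (auto simp: closed_sphere)

lemma space_sphere_measure [simp]: "space sphere_measure = sphere 0 1"
  by (simp add: sphere_measure_def space_restrict_space)

lemma sets_sphere_measure: "sets sphere_measure = sets (restrict_space borel (sphere 0 1))"
  unfolding sphere_measure_def by (intro sets_restrict_space_cong) simp

lemma measurable_sphere_measureI [measurable (raw)]:
  "f \<in> borel_measurable borel \<Longrightarrow> f \<in> borel_measurable sphere_measure"
  unfolding sphere_measure_def by (intro measurable_restrict_space1) simp

lemma prob_space_sphere_measure: "prob_space (sphere_measure :: (real ^ 'n) measure)"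
proof
  interpret C: prob_space "cone_measure :: (real ^ 'n) measure" by (rule prob_space_cone_measure)
  have "emeasure (sphere_measure :: (real ^ 'n) measure) (sphere 0 1) = emeasure (cone_measure :: (real ^ 'n) measure) (sphere 0 1)"
    unfolding sphere_measure_def by (subst emeasure_restrict_space) (auto simp: closed_sphere)
  also have "\<dots> = 1"
    using AE_cone_measure by (subst C.emeasure_eq_1_AE) (auto simp: closed_sphere)
  finally show "emeasure (sphere_measure :: (real ^ 'n) measure) (space sphere_measure) = 1" by simp
qed

interpretation sph: prob_space "sphere_measure :: (real ^ 'n) measure"
  by (rule prob_space_sphere_measure)

lemma nn_integral_sphere_measure:
  assumes [measurable]: "f \<in> borel_measurable borel"
  shows "(\<integral>\<^sup>+x. f x \<partial>sphere_measure) = (\<integral>\<^sup>+x. f x \<partial>cone_measure)"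
proof -
  have "(\<integral>\<^sup>+x. f x \<partial>sphere_measure) = (\<integral>\<^sup>+x. f x * indicator (sphere 0 1) x \<partial>cone_measure)"
    unfolding sphere_measure_def by (subst nn_integral_restrict_space) (auto simp: closed_sphere)
  also have "\<dots> = (\<integral>\<^sup>+x. f x \<partial>cone_measure)"
    using AE_cone_measure by (intro nn_integral_cong_AE) (auto elim!: eventually_mono)
  finally show ?thesis .
qed

lemma integral_sphere_measure:
  fixes f :: "real ^ 'n \<Rightarrow> real"
  assumes [measurable]: "f \<in> borel_measurable borel"
  shows "(\<integral>x. f x \<partial>sphere_measure) = (\<integral>x. f x \<partial>cone_measure)"
proof -
  have "(\<integral>x. f x \<partial>sphere_measure) = (\<integral>x. indicator (sphere 0 1) x *\<^sub>R f x \<partial>cone_measure)"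
    unfolding sphere_measure_def by (subst integral_restrict_space) (auto simp: closed_sphere)
  also have "\<dots> = (\<integral>x. f x \<partial>cone_measure)"
  proof (rule integral_cong_AE)
    have [measurable]: "sphere 0 1 \<in> sets (borel :: (real ^ 'n) measure)" by (simp add: closed_sphere)
    show "(\<lambda>x. indicator (sphere 0 1) x *\<^sub>R f x) \<in> borel_measurable cone_measure" by measurable
    show "AE x in cone_measure. indicator (sphere 0 1) x *\<^sub>R f x = f x"
      using AE_cone_measure by eventually_elim simp
  qed simp
  finally show ?thesis .
qed

lemma orthogonal_transformation_borel:
  "orthogonal_transformation f \<Longrightarrow> f \<in> borel_measurable (borel :: 'a::euclidean_space measure)"
  using orthogonal_transformation_linear
  by (intro borel_measurable_continuous_onI linear_continuous_on linear_conv_bounded_linear[THEN iffD1])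

text \<open>Radial projection commutes with \<open>f\<close> and the unit ball is invariant, so
  everything reduces to the invariance of Lebesgue measure.\<close>

lemma distr_cone_measure:
  fixes f :: "real ^ 'n \<Rightarrow> real ^ 'n"
  assumes f: "orthogonal_transformation f"
  shows "distr cone_measure borel f = cone_measure"
proof (rule measure_eqI)
  have [measurable]: "f \<in> borel_measurable borel" by (rule orthogonal_transformation_borel[OF f])
  fix A assume "A \<in> sets (distr (cone_measure :: (real ^ 'n) measure) borel f)"
  then have [measurable]: "A \<in> sets borel" by simp
  define C where "C = ball (0::real^'n) 1 \<inter> (sgn -` A)"
  have [measurable]: "C \<in> sets borel" unfolding C_def using measurable_sets[OF borel_measurable_sgn, of A] by simp
  have m: "sgn -` (f -` A) \<in> sets borel" "sgn -` A \<in> sets borel" "f -` A \<in> sets borel"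
    using measurable_sets[OF measurable_compose[OF borel_measurable_sgn \<open>f \<in> borel_measurable borel\<close>], of A]
      measurable_sets[OF borel_measurable_sgn, of A] measurable_sets[of f borel borel A]
    by (simp_all add: vimage_def)
  have "ball 0 1 \<inter> sgn -` (f -` A) = f -` C"
    using orthogonal_transformation_norm[OF f] by (auto simp: C_def sgn_orthogonal[OF f])
  then have "emeasure lborel (ball 0 1 \<inter> sgn -` (f -` A)) = emeasure lborel (ball 0 1 \<inter> sgn -` A)"
    using emeasure_lborel_orthogonal_vimage[OF f, of C] by (simp only: C_def[symmetric] \<open>C \<in> sets borel\<close> simp_thms)
  then show "emeasure (distr (cone_measure :: (real ^ 'n) measure) borel f) A = emeasure cone_measure A"
    using m by (simp add: emeasure_distr)
qed simp

lemma nn_integral_sphere_orthogonal: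
  fixes f :: "real ^ 'n \<Rightarrow> real ^ 'n"
  assumes f: "orthogonal_transformation f" and g[measurable]: "g \<in> borel_measurable borel"
  shows "(\<integral>\<^sup>+x. g (f x) \<partial>sphere_measure) = (\<integral>\<^sup>+x. g x \<partial>sphere_measure)"
proof -
  have [measurable]: "f \<in> borel_measurable borel" by (rule orthogonal_transformation_borel[OF f])
  show ?thesis
    by (simp add: nn_integral_sphere_measure)
      (subst (2) distr_cone_measure[OF f, symmetric], subst nn_integral_distr, auto)
qed

lemma integral_sphere_orthogonal:
  fixes f :: "real ^ 'n \<Rightarrow> real ^ 'n" and g :: "real ^ 'n \<Rightarrow> real"
  assumes f: "orthogonal_transformation f" and g[measurable]: "g \<in> borel_measurable borel"
  shows "(\<integral>x. g (f x) \<partial>sphere_measure) = (\<integral>x. g x \<partial>sphere_measure)"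
proof -
  have [measurable]: "f \<in> borel_measurable borel" by (rule orthogonal_transformation_borel[OF f])
  show ?thesis
    by (simp add: integral_sphere_measure)
      (subst (2) distr_cone_measure[OF f, symmetric], subst integral_distr, auto)
qed

lemma integrable_sphere_continuous:
  fixes f :: "real ^ 'n \<Rightarrow> real"
  assumes "continuous_on UNIV f"
  shows "integrable sphere_measure f"
proof -
  have "compact (f ` sphere 0 1)"
    using assms by (intro compact_continuous_image continuous_on_subset[OF assms]) auto
  then obtain B where "\<And>x. x \<in> sphere 0 1 \<Longrightarrow> norm (f x) \<le> B"
    by (meson bounded_iff compact_imp_bounded imageI)
  then show ?thesis
    using assms by (intro sph.integrable_const_bound[where B = B] AE_I2 measurable_sphere_measureI
      borel_measurable_continuous_onI) auto
qed

section \<open>Green's formula from rotations in coordinate planes\<close>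

definition plane_rot :: "'n \<Rightarrow> 'n \<Rightarrow> real \<Rightarrow> real ^ 'n \<Rightarrow> real ^ 'n" where
  "plane_rot i j \<theta> z = (\<chi> k. if k = i then cos \<theta> * z $ i - sin \<theta> * z $ j
      else if k = j then sin \<theta> * z $ i + cos \<theta> * z $ j else z $ k)"

lemma sum_two_split:
  fixes f :: "'n::finite \<Rightarrow> real"
  assumes "i \<noteq> j"
  shows "(\<Sum>k\<in>UNIV. f k) = f i + f j + (\<Sum>k\<in>UNIV - {i, j}. f k)"
proof -
  have "(\<Sum>k\<in>UNIV. f k) = sum f {i, j} + sum f (UNIV - {i, j})"
    by (metis add.commute finite sum.subset_diff top_greatest)
  then show ?thesis using assms by simp
qed

lemma inner_plane_rot:
  assumes "i \<noteq> j"
  shows "a \<bullet> plane_rot i j \<theta> z =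
    a $ i * (cos \<theta> * z $ i - sin \<theta> * z $ j) + a $ j * (sin \<theta> * z $ i + cos \<theta> * z $ j)
      + (\<Sum>k\<in>UNIV - {i, j}. a $ k * z $ k)"
  using assms by (auto simp: inner_vec_def sum_two_split[OF assms] plane_rot_def intro!: sum.cong)

lemma orthogonal_plane_rot:
  assumes ij: "i \<noteq> j"
  shows "orthogonal_transformation (plane_rot i j \<theta>)"
proof (subst orthogonal_transformation, intro conjI allI)
  show "linear (plane_rot i j \<theta>)"
    by (rule linearI) (auto simp: plane_rot_def vec_eq_iff algebra_simps)
  fix z
  have "(cos \<theta> * z $ i - sin \<theta> * z $ j)\<^sup>2 + (sin \<theta> * z $ i + cos \<theta> * z $ j)\<^sup>2 = (z $ i)\<^sup>2 + (z $ j)\<^sup>2"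
    using sin_cos_squared_add[of \<theta>] by algebra
  then have "plane_rot i j \<theta> z \<bullet> plane_rot i j \<theta> z = z \<bullet> z"
    using ij by (auto simp: inner_vec_def sum_two_split[OF ij] plane_rot_def power2_eq_square intro!: sum.cong)
  then show "norm (plane_rot i j \<theta> z) = norm z" by (simp add: norm_eq_sqrt_inner)
qed

lemma DERIV_inner_plane_rot:
  assumes ij: "i \<noteq> j"
  shows "((\<lambda>\<theta>. a \<bullet> plane_rot i j \<theta> z) has_real_derivative
     (a $ j * plane_rot i j \<theta> z $ i - a $ i * plane_rot i j \<theta> z $ j)) (at \<theta>)"
  unfolding inner_plane_rot[OF ij] using ij
  by (auto intro!: derivative_eq_intros simp: plane_rot_def algebra_simps)

text \<open>By invariance the integral of the rotated \<open>F\<close> is independent of the angle,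
  so its derivative is \<open>0\<close>. Differentiation under the integral is allowed because the
  mean value theorem bounds all difference quotients by the maximum of \<open>\<bar>F'\<bar>\<close>
  on the sphere.\<close>

lemma integral_rotation_derivative:
  fixes F F' :: "real ^ 'n \<Rightarrow> real"
  assumes ij: "i \<noteq> j" and cF: "continuous_on UNIV F" and cF': "continuous_on UNIV F'"
    and D: "\<And>z \<theta>. ((\<lambda>\<theta>. F (plane_rot i j \<theta> z)) has_real_derivative F' (plane_rot i j \<theta> z)) (at \<theta>)"
  shows "(\<integral>z. F' z \<partial>sphere_measure) = 0"
proof -
  let ?R = "plane_rot i j"
  have R0: "?R 0 z = z" for z by (simp add: plane_rot_def vec_eq_iff)
  have cR: "continuous_on UNIV (?R \<theta>)" for \<theta>
    using orthogonal_plane_rot[OF ij] by (auto intro!: linear_continuous_on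
      linear_conv_bounded_linear[THEN iffD1] orthogonal_transformation_linear)
  have cFR: "continuous_on UNIV (\<lambda>z. F (?R \<theta> z))" for \<theta>
    using continuous_on_compose2[OF cF cR] by auto
  have "compact (F' ` sphere 0 1)"
    by (intro compact_continuous_image continuous_on_subset[OF cF']) auto
  then obtain B where B: "\<And>x. x \<in> sphere 0 1 \<Longrightarrow> \<bar>F' x\<bar> \<le> B"
    by (metis bounded_iff compact_imp_bounded imageI real_norm_def)
  define q where "q n z = (F (?R (1 / real (Suc n)) z) - F z) / (1 / real (Suc n))" for n z
  have "(\<lambda>n. \<integral>z. q n z \<partial>sphere_measure) \<longlonglongrightarrow> (\<integral>z. F' z \<partial>sphere_measure)"
  proof (rule integral_dominated_convergence[where w = "\<lambda>_. B"])
    show "F' \<in> borel_measurable sphere_measure"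
      by (intro measurable_sphere_measureI borel_measurable_continuous_onI cF')
    show "q n \<in> borel_measurable sphere_measure" for n
      unfolding q_def by (intro measurable_sphere_measureI borel_measurable_continuous_onI
        continuous_intros cFR cF) auto
    show "AE z in sphere_measure. (\<lambda>n. q n z) \<longlonglongrightarrow> F' z"
    proof (rule AE_I2)
      fix z
      have "((\<lambda>\<theta>. (F (?R \<theta> z) - F (?R 0 z)) / (\<theta> - 0)) \<longlongrightarrow> F' (?R 0 z)) (at 0)"
        using D[of z 0] unfolding has_field_derivative_iff .
      moreover have "filterlim (\<lambda>n. 1 / real (Suc n)) (at 0) sequentially"
        by (rule filterlim_atI[OF lim_1_over_n[THEN LIMSEQ_Suc]]) simp
      ultimately have "(\<lambda>n. (F (?R (1 / real (Suc n)) z) - F (?R 0 z)) / (1 / real (Suc n) - 0)) \<longlonglongrightarrow> F' (?R 0 z)"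
        by (rule filterlim_compose)
      then show "(\<lambda>n. q n z) \<longlonglongrightarrow> F' z" by (simp add: q_def R0)
    qed
    show "AE z in sphere_measure. norm (q n z) \<le> B" for n
    proof (rule AE_I2)
      fix z :: "real ^ 'n" assume z: "z \<in> space sphere_measure"
      define e where "e = 1 / real (Suc n)"
      have e: "e > 0" by (simp add: e_def)
      obtain t where t: "F (?R e z) - F (?R 0 z) = (e - 0) * F' (?R t z)"
        using MVT2[OF e, of "\<lambda>t. F (?R t z)" "\<lambda>t. F' (?R t z)"] D by blast
      have "?R t z \<in> sphere 0 1"
        using z orthogonal_transformation_norm[OF orthogonal_plane_rot[OF ij]] by simp
      then show "norm (q n z) \<le> B" using t e B[of "?R t z"] unfolding q_def e_def[symmetric] by (simp add: R0)
    qed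
  qed simp
  moreover have "(\<integral>z. q n z \<partial>sphere_measure) = 0" for n
  proof -
    have "(\<integral>z. F (?R e z) \<partial>sphere_measure) = (\<integral>z. F z \<partial>sphere_measure)" for e
      by (rule integral_sphere_orthogonal[OF orthogonal_plane_rot[OF ij]]) (rule borel_measurable_continuous_onI[OF cF])
    then show ?thesis unfolding q_def
      by (simp add: integrable_sphere_continuous cFR cF)
  qed
  ultimately show ?thesis by (simp add: LIMSEQ_const_iff)
qed

lemma continuous_poly_inner: "continuous_on UNIV (\<lambda>z. poly p (a \<bullet> z))" for a :: "real ^ 'n"
  by (intro continuous_intros)

text \<open>
  The infinitesimal rotation \<open>z\<^sub>i \<partial>\<^sub>j - z\<^sub>j \<partial>\<^sub>i\<close>, applied to \<open>g (y \<bullet> z)\<close> times its value on \<open>f (x \<bullet> z)\<close>. Summing over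
  all coordinate planes gives Green's formula for the Laplace--Beltrami operator.
\<close>
lemma zonal_green_ij:
  fixes x y :: "real ^ 'n"
  assumes ij: "i \<noteq> j"
  shows "(\<integral>z. (z$i * y$j - z$j * y$i) * (z$i * x$j - z$j * x$i) * poly (pderiv f) (x \<bullet> z) * poly (pderiv g) (y \<bullet> z)
      + poly g (y \<bullet> z) * ((z$i * x$j - z$j * x$i)\<^sup>2 * poly (pderiv (pderiv f)) (x \<bullet> z)
          - (x$i * z$i + x$j * z$j) * poly (pderiv f) (x \<bullet> z)) \<partial>sphere_measure) = 0"
proof (rule integral_rotation_derivative[OF ij])
  define v where "v = (x$j) *\<^sub>R axis i 1 - (x$i) *\<^sub>R axis j (1::real)"
  have v: "v \<bullet> z = z$i * x$j - z$j * x$i" for z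
    by (simp add: v_def inner_diff_left inner_axis' algebra_simps)
  have vc: "v $ i = x $ j" "v $ j = - x $ i" using ij by (simp_all add: v_def axis_def)
  let ?F = "\<lambda>z. poly g (y \<bullet> z) * (v \<bullet> z) * poly (pderiv f) (x \<bullet> z)"
  show "continuous_on UNIV ?F" by (intro continuous_intros)
  show "continuous_on UNIV (\<lambda>z. (z$i * y$j - z$j * y$i) * (z$i * x$j - z$j * x$i) * poly (pderiv f) (x \<bullet> z) * poly (pderiv g) (y \<bullet> z)
      + poly g (y \<bullet> z) * ((z$i * x$j - z$j * x$i)\<^sup>2 * poly (pderiv (pderiv f)) (x \<bullet> z)
          - (x$i * z$i + x$j * z$j) * poly (pderiv f) (x \<bullet> z)))"
    by (intro continuous_intros)
  fix z \<theta>
  let ?r = "\<lambda>\<theta>. plane_rot i j \<theta> z"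
  note D = DERIV_inner_plane_rot[OF ij]
  have P: "((\<lambda>\<theta>. poly p (a \<bullet> ?r \<theta>)) has_real_derivative
     poly (pderiv p) (a \<bullet> ?r \<theta>) * (a $ j * ?r \<theta> $ i - a $ i * ?r \<theta> $ j)) (at \<theta>)" for p a
    using DERIV_chain2[OF poly_DERIV D, of p] .
  show "((\<lambda>\<theta>. ?F (?r \<theta>)) has_real_derivative (?r \<theta>$i * y$j - ?r \<theta>$j * y$i) * (?r \<theta>$i * x$j - ?r \<theta>$j * x$i) * poly (pderiv f) (x \<bullet> ?r \<theta>) * poly (pderiv g) (y \<bullet> ?r \<theta>)
      + poly g (y \<bullet> ?r \<theta>) * ((?r \<theta>$i * x$j - ?r \<theta>$j * x$i)\<^sup>2 * poly (pderiv (pderiv f)) (x \<bullet> ?r \<theta>)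
          - (x$i * ?r \<theta>$i + x$j * ?r \<theta>$j) * poly (pderiv f) (x \<bullet> ?r \<theta>))) (at \<theta>)"
    by (rule DERIV_cong[OF DERIV_mult[OF DERIV_mult[OF P D] P]])
      (simp add: v vc algebra_simps power2_eq_square)
qed

lemma lagrange_sum:
  fixes x y z :: "real ^ 'n"
  shows "(\<Sum>i\<in>UNIV. \<Sum>j\<in>UNIV. (z$i * y$j - z$j * y$i) * (z$i * x$j - z$j * x$i)) =
    2 * ((z \<bullet> z) * (x \<bullet> y) - (x \<bullet> z) * (y \<bullet> z))"
proof -
  have "(\<Sum>i\<in>UNIV. \<Sum>j\<in>UNIV. (z$i * y$j - z$j * y$i) * (z$i * x$j - z$j * x$i)) =
     (\<Sum>i\<in>UNIV. \<Sum>j\<in>UNIV. (z$i * z$i) * (x$j * y$j)) + (\<Sum>i\<in>UNIV. \<Sum>j\<in>UNIV. (x$i * y$i) * (z$j * z$j))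
     - (\<Sum>i\<in>UNIV. \<Sum>j\<in>UNIV. (x$i * z$i) * (y$j * z$j)) - (\<Sum>i\<in>UNIV. \<Sum>j\<in>UNIV. (y$i * z$i) * (x$j * z$j))"
    unfolding sum.distrib[symmetric] sum_subtractf[symmetric]
    by (intro sum.cong refl) (simp add: algebra_simps)
  also have "\<dots> = 2 * ((z \<bullet> z) * (x \<bullet> y) - (x \<bullet> z) * (y \<bullet> z))"
    unfolding sum_product[symmetric] inner_vec_def by (simp add: algebra_simps)
  finally show ?thesis .
qed

text \<open>The origin of the factor \<open>d\<close> in \<open>geg_op\<close>: each index is paired
  with the \<open>CARD('n) - 1\<close> other ones.\<close>

lemma sum_off_diagonal:
  fixes x z :: "real ^ 'n"
  shows "(\<Sum>i\<in>UNIV. \<Sum>j\<in>UNIV. if i = j then 0 else x$i * z$i + x$j * z$j) = 2 * (real CARD('n) - 1) * (x \<bullet> z)"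
proof -
  have "(\<Sum>i\<in>UNIV. \<Sum>j\<in>UNIV. if i = j then 0 else x$i * z$i + x$j * z$j) =
     (\<Sum>i\<in>UNIV. \<Sum>j\<in>UNIV. (x$i * z$i + x$j * z$j) - (if i = j then 2 * (x$i * z$i) else 0))"
    by (intro sum.cong refl) auto
  also have "\<dots> = 2 * real CARD('n) * (x \<bullet> z) - 2 * (x \<bullet> z)"
    by (simp add: sum_subtractf sum.distrib inner_vec_def sum_distrib_left mult.assoc)
  finally show ?thesis by (simp add: algebra_simps)
qed

text \<open>The identities for the single planes are summed over ordered pairs, so every term
  carries a factor \<open>2\<close>. The right-hand side is symmetric under exchange of
  \<open>(x, f)\<close> and \<open>(y, g)\<close>, which is the self-adjointness that orthogonality
  rests on.\<close>

lemma zonal_green: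
  fixes x y :: "real ^ 'n"
  assumes card: "CARD('n) = d + 1" and x: "x \<in> sphere 0 1"
  shows "(\<integral>z. poly g (y \<bullet> z) * poly (geg_op d f) (x \<bullet> z) \<partial>sphere_measure)
     = - (\<integral>z. (x \<bullet> y - (x \<bullet> z) * (y \<bullet> z)) * poly (pderiv f) (x \<bullet> z) * poly (pderiv g) (y \<bullet> z) \<partial>sphere_measure)"
proof -
  \<comment> \<open>For \<open>i = j\<close> the antisymmetric factors vanish by themselves; the
    first-order term does not and is set to \<open>0\<close>.\<close>
  define H where "H i j z = (z$i * y$j - z$j * y$i) * (z$i * x$j - z$j * x$i) * poly (pderiv f) (x \<bullet> z) * poly (pderiv g) (y \<bullet> z)
      + poly g (y \<bullet> z) * ((z$i * x$j - z$j * x$i)\<^sup>2 * poly (pderiv (pderiv f)) (x \<bullet> z)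
          - (if i = j then 0 else x$i * z$i + x$j * z$j) * poly (pderiv f) (x \<bullet> z))" for i j and z :: "real ^ 'n"
  have cH: "continuous_on UNIV (H i j)" for i j
    unfolding H_def by (cases "i = j") (auto intro!: continuous_intros)
  have H0: "(\<integral>z. H i j z \<partial>sphere_measure) = 0" for i j
    using zonal_green_ij[of i j y x f g] by (cases "i = j") (simp_all add: H_def)
  have "0 = (\<Sum>i\<in>UNIV. \<Sum>j\<in>UNIV. \<integral>z. H i j z \<partial>sphere_measure)" by (simp add: H0)
  also have "\<dots> = (\<integral>z. (\<Sum>i\<in>UNIV. \<Sum>j\<in>UNIV. H i j z) \<partial>sphere_measure)"
    by (simp add: integrable_sphere_continuous cH)
  also have "\<dots> = (\<integral>z. 2 * ((x \<bullet> y - (x \<bullet> z) * (y \<bullet> z)) * poly (pderiv f) (x \<bullet> z) * poly (pderiv g) (y \<bullet> z)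
       + poly g (y \<bullet> z) * poly (geg_op d f) (x \<bullet> z)) \<partial>sphere_measure)"
  proof (rule Bochner_Integration.integral_cong[OF refl])
    fix z :: "real ^ 'n" assume "z \<in> space sphere_measure"
    then have zz: "z \<bullet> z = 1" by (simp add: dot_square_norm)
    have xx: "x \<bullet> x = 1" using x by (simp add: dot_square_norm)
    define A where "A = poly (pderiv f) (x \<bullet> z) * poly (pderiv g) (y \<bullet> z)"
    define B where "B = poly g (y \<bullet> z) * poly (pderiv (pderiv f)) (x \<bullet> z)"
    define C where "C = poly g (y \<bullet> z) * poly (pderiv f) (x \<bullet> z)"
    have "(\<Sum>i\<in>UNIV. \<Sum>j\<in>UNIV. H i j z) =
       (\<Sum>i\<in>UNIV. \<Sum>j\<in>UNIV. (z$i * y$j - z$j * y$i) * (z$i * x$j - z$j * x$i)) * A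
       + (\<Sum>i\<in>UNIV. \<Sum>j\<in>UNIV. (z$i * x$j - z$j * x$i) * (z$i * x$j - z$j * x$i)) * B
       - (\<Sum>i\<in>UNIV. \<Sum>j\<in>UNIV. (if i = j then 0 else x$i * z$i + x$j * z$j)) * C"
      unfolding sum_distrib_right sum.distrib[symmetric] sum_subtractf[symmetric]
      by (intro sum.cong refl) (simp add: H_def A_def B_def C_def power2_eq_square algebra_simps)
    also have "\<dots> = 2 * ((x \<bullet> y) - (x \<bullet> z) * (y \<bullet> z)) * A + 2 * (1 - (x \<bullet> z)\<^sup>2) * B - 2 * real d * (x \<bullet> z) * C"
      unfolding lagrange_sum sum_off_diagonal card by (simp add: zz xx power2_eq_square)
    also have "\<dots> = 2 * ((x \<bullet> y - (x \<bullet> z) * (y \<bullet> z)) * poly (pderiv f) (x \<bullet> z) * poly (pderiv g) (y \<bullet> z)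
       + poly g (y \<bullet> z) * poly (geg_op d f) (x \<bullet> z))"
      by (simp add: A_def B_def C_def poly_geg_op algebra_simps)
    finally show "(\<Sum>i\<in>UNIV. \<Sum>j\<in>UNIV. H i j z) = 2 * ((x \<bullet> y - (x \<bullet> z) * (y \<bullet> z)) * poly (pderiv f) (x \<bullet> z) * poly (pderiv g) (y \<bullet> z)
       + poly g (y \<bullet> z) * poly (geg_op d f) (x \<bullet> z))" .
  qed
  also have "\<dots> = 2 * ((\<integral>z. (x \<bullet> y - (x \<bullet> z) * (y \<bullet> z)) * poly (pderiv f) (x \<bullet> z) * poly (pderiv g) (y \<bullet> z) \<partial>sphere_measure)
       + (\<integral>z. poly g (y \<bullet> z) * poly (geg_op d f) (x \<bullet> z) \<partial>sphere_measure))"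
    by (subst integral_mult_right_zero, subst Bochner_Integration.integral_add)
      (auto intro!: integrable_sphere_continuous continuous_intros)
  finally show ?thesis by (simp add: eq_neg_iff_add_eq_0 add.commute)
qed

text \<open>Self-adjointness attaches two eigenvalues to one integral. Their difference is
  \<open>(l - m) (l + m + d - 1)\<close>, which is nonzero.\<close>

lemma geg_orthogonal:
  fixes x y :: "real ^ 'n"
  assumes card: "CARD('n) = d + 1" and d: "d \<ge> 2" and x: "x \<in> sphere 0 1" and y: "y \<in> sphere 0 1" and lm: "l \<noteq> m"
  shows "(\<integral>z. poly (geg d l) (x \<bullet> z) * poly (geg d m) (y \<bullet> z) \<partial>sphere_measure) = 0"
proof -
  let ?I = "\<integral>z. poly (geg d l) (x \<bullet> z) * poly (geg d m) (y \<bullet> z) \<partial>sphere_measure"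
  have "real l * (real l + real d - 1) * ?I = real m * (real m + real d - 1) * ?I"
    using zonal_green[OF card x, of "geg d m" y "geg d l"] zonal_green[OF card y, of "geg d l" x "geg d m"]
    by (simp add: geg_ode[OF d] mult_ac inner_commute[of x y])
  then have "(real l - real m) * (real l + real m + real d - 1) * ?I = 0" by (simp add: algebra_simps)
  moreover have "real l + real m + real d - 1 > 0" using d by linarith
  ultimately show ?thesis using lm by auto
qed

section \<open>Orthogonality relations with a common centre\<close>

definition zonal_integral :: "real ^ 'n \<Rightarrow> real poly \<Rightarrow> real" where
  "zonal_integral x p = (\<integral>z. poly p (x \<bullet> z) \<partial>sphere_measure)"

lemma zonal_integral_add: "zonal_integral x (p + q) = zonal_integral x p + zonal_integral x q"
  unfolding zonal_integral_def
  by (simp add: Bochner_Integration.integral_add integrable_sphere_continuous continuous_poly_inner)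

lemma zonal_integral_smult: "zonal_integral x (smult c p) = c * zonal_integral x p"
  unfolding zonal_integral_def by simp

lemma harmonic_dim_eq:
  assumes d: "d \<ge> 2"
  shows "harmonic_dim d l = zonal_val d 0 l"
proof -
  have nn: "real l + 1 \<notin> \<int>\<^sub>\<le>\<^sub>0" by (auto simp: nonpos_Ints_def)
  have r: "real (d - 2) = real d - 2" using d by simp
  have "pochhammer (real l + 1) (d - 2) = Gamma (real l + real d - 1) / Gamma (real l + 1)"
    using pochhammer_Gamma[OF nn, of "d - 2"] by (simp add: r add_ac)
  moreover have "Gamma (real d) = fact (d - 1)"
    using d Gamma_fact[of "d - 1", where 'a = real] by (simp add: of_nat_diff)
  ultimately show ?thesis
    by (simp add: harmonic_dim_def zonal_val_def zonal_u_def)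
qed

lemma zonal_val_0_0: "d \<ge> 2 \<Longrightarrow> zonal_val d 0 0 = 1"
proof -
  assume d: "d \<ge> 2"
  then obtain e where e: "d = Suc (Suc e)" by (metis Suc_le_D numeral_2_eq_2 Suc_le_mono)
  show ?thesis by (simp add: zonal_val_def zonal_u_def e pochhammer_fact[symmetric])
qed

text \<open>Off the diagonal this is \<open>geg_orthogonal\<close>. The square norms obey a
  recursion, found by evaluating the integral of
  \<open>t P\<^sub>i P\<^sub>i\<^sub>+\<^sub>1\<close> with the three-term recurrence applied to
  either factor; the start is \<open>1\<close> because the measure is normalised.\<close>

lemma zonal_integral_zonal:
  fixes x :: "real ^ 'n"
  assumes card: "CARD('n) = d + 1" and d: "d \<ge> 2" and x: "x \<in> sphere 0 1"
  shows "zonal_integral x (zonal d 0 l * zonal d 0 m) = (if l = m then zonal_val d 0 l else 0)"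
proof -
  define E where "E = zonal_integral x"
  have E: "E (p + q) = E p + E q" "E (smult c p) = c * E p" for p q c
    by (simp_all add: E_def zonal_integral_add zonal_integral_smult)
  have orth: "E (geg d i * geg d j) = 0" if "i \<noteq> j" for i j
    using geg_orthogonal[OF card d x x that] by (simp add: E_def zonal_integral_def)
  define n where "n i = E (geg d i * geg d i)" for i
  have t3: "smult (2 * real i + real d + 1) ([:0, 1:] * geg d (Suc i)) =
     smult (real i + real d) (geg d (Suc (Suc i))) + smult (real i + 1) (geg d i)" for i
    by (intro poly_ext) (use geg_three_term[OF d] in \<open>simp add: mult_ac del: geg.simps\<close>)
  have s1: "(2 * real i + real d + 1) * E ([:0, 1:] * geg d (Suc i) * q) =
      (real i + real d) * E (geg d (Suc (Suc i)) * q) + (real i + 1) * E (geg d i * q)" for i q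
  proof -
    have "E (smult (2 * real i + real d + 1) ([:0, 1:] * geg d (Suc i)) * q) =
       E ((smult (real i + real d) (geg d (Suc (Suc i))) + smult (real i + 1) (geg d i)) * q)"
      by (simp only: t3)
    then show ?thesis
      by (simp only: mult_smult_left ring_distribs E)
  qed
  have rec: "(real i + real d - 1) * (2 * real i + real d + 1) * n (Suc i) = (real i + 1) * (2 * real i + real d - 1) * n i" for i
  proof -
    define e where "e = E ([:0, 1:] * geg d (Suc i) * geg d i)"
    have e1: "(2 * real i + real d + 1) * e = (real i + 1) * n i"
      using s1[of i "geg d i"] orth[of "Suc (Suc i)" i] by (simp add: e_def n_def del: geg.simps)
    have e2: "(2 * real i + real d - 1) * e = (real i + real d - 1) * n (Suc i)"
    proof (cases i)
      case 0
      then show ?thesis by (simp add: e_def n_def)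
    next
      case (Suc k)
      have "e = E ([:0, 1:] * geg d (Suc k) * geg d (Suc (Suc k)))"
        unfolding e_def Suc by (simp only: mult_ac)
      then show ?thesis using s1[of k "geg d (Suc (Suc k))"] orth[of k "Suc (Suc k)"]
        by (simp add: Suc n_def del: geg.simps) (simp add: algebra_simps)
    qed
    show ?thesis using e1 e2 by algebra
  qed
  have norm: "zonal_val d 0 i * n i = 1" for i
  proof (induction i)
    case 0
    have "n 0 = 1" by (simp add: n_def E_def zonal_integral_def sph.prob_space[simplified])
    then show ?case by (simp add: zonal_val_0_0[OF d])
  next
    case (Suc i)
    define L D where "L = real i" and "D = real d"
    have pos: "L + D / 2 > 0" "L + 1 > 0" using d by (simp_all add: L_def D_def)
    define c u v where "c = zonal_const d 0" and "u = zonal_u d 0 i" and "v = zonal_u d 0 (Suc i)"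
    have "(L + D / 2) * (L + 1) * v = (L + D / 2) * (L + D - 1) * u"
      using zonal_u_shift[OF d, of i 0] by (simp add: L_def D_def u_def v_def)
    then have uv: "(L + 1) * v = (L + D - 1) * u" using pos by simp
    have "(L + D - 1) * (2 * L + D + 1) * n (Suc i) = (L + 1) * (2 * L + D - 1) * n i"
      using rec[of i] by (simp add: L_def D_def)
    then have "(L + 1) * (c * (2 * (L + 1) + D - 1) * v * n (Suc i)) = (L + 1) * (c * (2 * L + D - 1) * u * n i)"
      using uv by algebra
    then have "c * (2 * (L + 1) + D - 1) * v * n (Suc i) = c * (2 * L + D - 1) * u * n i"
      using pos by simp
    moreover have "zonal_val d 0 (Suc i) = c * (2 * (L + 1) + D - 1) * v" "zonal_val d 0 i = c * (2 * L + D - 1) * u"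
      by (simp_all add: zonal_val_def L_def D_def c_def u_def v_def)
    ultimately show ?case using Suc by (simp only:)
  qed
  have "E (zonal d 0 l * zonal d 0 m) = zonal_val d 0 l * (zonal_val d 0 m * E (geg d l * geg d m))"
    by (simp add: E)
  then show ?thesis using norm[of l] orth[of l m] by (auto simp: n_def E_def)
qed

section \<open>Smoothness of the filter\<close>

lemma Ck_on_mono:
  assumes "Ck_on (Suc k) S f"
  shows "Ck_on k S f"
proof -
  obtain D where D: "\<forall>t\<in>S. D 0 t = f t"
    "\<forall>m<Suc k. \<forall>t\<in>S. (D m has_real_derivative D (Suc m) t) (at t within S)"
    using assms unfolding Ck_on_def by blast
  moreover have "continuous_on S (D k)"
    by (rule DERIV_continuous_on[where D = "D (Suc k)"]) (use D in auto)
  ultimately show ?thesis unfolding Ck_on_def by (intro exI[of _ D]) auto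
qed

text \<open>The recursive form of smoothness. It spares the Leibniz formula for higher derivatives
  when products are treated by induction.\<close>

lemma Ck_on_Suc_iff:
  "Ck_on (Suc k) S f \<longleftrightarrow> (\<exists>f'. (\<forall>t\<in>S. (f has_real_derivative f' t) (at t within S)) \<and> Ck_on k S f')"
proof
  assume "Ck_on (Suc k) S f"
  then obtain D where D: "\<forall>t\<in>S. D 0 t = f t"
    "\<forall>m<Suc k. \<forall>t\<in>S. (D m has_real_derivative D (Suc m) t) (at t within S)" "continuous_on S (D (Suc k))"
    unfolding Ck_on_def by blast
  have "(f has_real_derivative D (Suc 0) t) (at t within S)" if "t \<in> S" for t
    by (rule has_field_derivative_transform_within[of "D 0" _ t S 1]) (use D that in auto)
  moreover have "Ck_on k S (D (Suc 0))"
    unfolding Ck_on_def using D by (intro exI[of _ "\<lambda>m. D (Suc m)"]) auto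
  ultimately show "\<exists>f'. (\<forall>t\<in>S. (f has_real_derivative f' t) (at t within S)) \<and> Ck_on k S f'" by blast
next
  assume "\<exists>f'. (\<forall>t\<in>S. (f has_real_derivative f' t) (at t within S)) \<and> Ck_on k S f'"
  then obtain f' D where f': "\<forall>t\<in>S. (f has_real_derivative f' t) (at t within S)"
    and D: "\<forall>t\<in>S. D 0 t = f' t"
    "\<forall>m<k. \<forall>t\<in>S. (D m has_real_derivative D (Suc m) t) (at t within S)" "continuous_on S (D k)"
    unfolding Ck_on_def by blast
  show "Ck_on (Suc k) S f"
    unfolding Ck_on_def using f' D
    by (intro exI[of _ "case_nat f D"]) (auto split: nat.split)
qed

lemma Ck_on_add:
  assumes "Ck_on k S f" "Ck_on k S g"
  shows "Ck_on k S (\<lambda>t. f t + g t)"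
proof -
  obtain D D' where "\<forall>t\<in>S. D 0 t = f t"
    "\<forall>m<k. \<forall>t\<in>S. (D m has_real_derivative D (Suc m) t) (at t within S)" "continuous_on S (D k)"
    "\<forall>t\<in>S. D' 0 t = g t"
    "\<forall>m<k. \<forall>t\<in>S. (D' m has_real_derivative D' (Suc m) t) (at t within S)" "continuous_on S (D' k)"
    using assms unfolding Ck_on_def by blast
  then show ?thesis unfolding Ck_on_def
    by (intro exI[of _ "\<lambda>m t. D m t + D' m t"]) (auto intro!: derivative_eq_intros continuous_intros)
qed

lemma Ck_on_mult:
  assumes "Ck_on k S f" "Ck_on k S g"
  shows "Ck_on k S (\<lambda>t. f t * g t)"
  using assms
proof (induction k arbitrary: f g)
  case 0
  obtain D where D: "\<forall>t\<in>S. D 0 t = f t" "continuous_on S (D (0::nat))"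
    using 0(1) unfolding Ck_on_def by auto
  obtain D' where D': "\<forall>t\<in>S. D' 0 t = g t" "continuous_on S (D' (0::nat))"
    using 0(2) unfolding Ck_on_def by auto
  show ?case unfolding Ck_on_def using D D'
    by (intro exI[of _ "\<lambda>m t. D 0 t * D' 0 t"]) (auto intro!: continuous_intros)
next
  case (Suc k)
  obtain f' g' where f: "\<forall>t\<in>S. (f has_real_derivative f' t) (at t within S)" "Ck_on k S f'"
    and g: "\<forall>t\<in>S. (g has_real_derivative g' t) (at t within S)" "Ck_on k S g'"
    using Suc.prems unfolding Ck_on_Suc_iff by blast
  have "Ck_on k S (\<lambda>t. f' t * g t + g' t * f t)"
    by (intro Ck_on_add Suc.IH f g Suc.prems[THEN Ck_on_mono])
  moreover have "\<forall>t\<in>S. ((\<lambda>t. f t * g t) has_real_derivative f' t * g t + g' t * f t) (at t within S)"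
    using f g by (auto intro!: DERIV_mult)
  ultimately show ?case unfolding Ck_on_Suc_iff by (intro exI conjI)
qed

text \<open>Derivatives at \<open>0\<close> are one-sided, so the chain rule is used within the
  image of the half-line.\<close>

lemma Ck_on_scale:
  assumes "Ck_on k {0..} f" and c: "c \<ge> 0"
  shows "Ck_on k {0..} (\<lambda>t. f (c * t))"
proof -
  obtain D where D: "\<forall>t\<in>{0..}. D 0 t = f t"
    "\<forall>m<k. \<forall>t\<in>{0..}. (D m has_real_derivative D (Suc m) t) (at t within {0..})" "continuous_on {0..} (D k)"
    using assms unfolding Ck_on_def by blast
  show ?thesis unfolding Ck_on_def
  proof (intro exI[of _ "\<lambda>m t. c ^ m * D m (c * t)"] conjI ballI allI impI)
    fix t :: real assume t: "t \<in> {0..}"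
    show "c ^ 0 * D 0 (c * t) = f (c * t)" using D(1) t c by simp
    fix m assume m: "m < k"
    have "(D m has_real_derivative D (Suc m) (c * t)) (at (c * t) within (\<lambda>t. c * t) ` {0..})"
      using D(2) m t c by (intro DERIV_subset[OF D(2)[rule_format, OF m]]) auto
    moreover have "((\<lambda>t. c * t) has_real_derivative c) (at t within {0..})"
      by (auto intro!: derivative_eq_intros)
    ultimately have "((\<lambda>t. D m (c * t)) has_real_derivative D (Suc m) (c * t) * c) (at t within {0..})"
      using DERIV_image_chain[of "D m" _ "\<lambda>t. c * t" t "{0..}" c] by (simp add: o_def)
    then show "((\<lambda>t. c ^ m * D m (c * t)) has_real_derivative c ^ Suc m * D (Suc m) (c * t)) (at t within {0..})"
      by (auto intro!: derivative_eq_intros)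
  next
    show "continuous_on {0..} (\<lambda>t. c ^ k * D k (c * t))"
      using c by (intro continuous_intros continuous_on_compose2[OF D(3)]) auto
  qed
qed

text \<open>Differentiating \<open>D i (e (sqrt x - c)) e ^ i sqrt x ^ i / x ^ s\<close> gives half
  of the term for \<open>i + 1\<close> plus \<open>(i - 2 s) / 2\<close> times the term for
  \<open>i\<close>, both with \<open>s\<close> raised by one. The recursion collects these
  coefficients.\<close>

fun sqrt_chain :: "nat \<Rightarrow> nat \<Rightarrow> real" where
  "sqrt_chain 0 i = (if i = 0 then 1 else 0)"
| "sqrt_chain (Suc s) i =
     ((if i = 0 then 0 else sqrt_chain s (i - 1)) + (real i - 2 * real s) * sqrt_chain s i) / 2"

lemma sqrt_chain_0: "i > s \<Longrightarrow> sqrt_chain s i = 0"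
  by (induction s arbitrary: i) auto

text \<open>
  If \<open>D i\<close> is the derivative of order \<open>i\<close> of \<open>D 0\<close>, then \<open>sqrt_deriv D c e s\<close> is the one of order \<open>s\<close> of
  \<open>\<lambda>x. D 0 (e * (sqrt x - c))\<close>.
\<close>
definition sqrt_deriv :: "(nat \<Rightarrow> real \<Rightarrow> real) \<Rightarrow> real \<Rightarrow> real \<Rightarrow> nat \<Rightarrow> real \<Rightarrow> real" where
  "sqrt_deriv D c e s x = (\<Sum>i\<le>s. sqrt_chain s i * (D i (e * (sqrt x - c)) * e ^ i * sqrt x ^ i / x ^ s))"

lemma DERIV_sqrt_deriv:
  assumes x: "x > 0" and D: "\<And>i. i \<le> s \<Longrightarrow> (D i has_real_derivative D (Suc i) (e * (sqrt x - c))) (at (e * (sqrt x - c)))"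
  shows "(sqrt_deriv D c e s has_real_derivative sqrt_deriv D c e (Suc s) x) (at x)"
proof -
  define r where "r = sqrt x"
  have r: "r > 0" "r * r = x" "sqrt x = r" using x by (simp_all add: r_def)
  define T where "T i = D i (e * (r - c)) * e ^ i * r ^ i / x ^ Suc s" for i
  have trm: "((\<lambda>x. D i (e * (sqrt x - c)) * e ^ i * sqrt x ^ i / x ^ s) has_real_derivative
      (T (Suc i) + (real i - 2 * real s) * T i) / 2) (at x)" if i: "i \<le> s" for i
  proof -
    have sq: "(sqrt has_real_derivative 1 / (2 * r)) (at x)"
      using DERIV_real_sqrt[OF x] by (simp add: r field_simps)
    have D1: "((\<lambda>x. D i (e * (sqrt x - c))) has_real_derivative D (Suc i) (e * (r - c)) * (e * (1 / (2 * r)))) (at x)"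
    proof (rule DERIV_chain2[of "D i"])
      show "(D i has_real_derivative D (Suc i) (e * (r - c))) (at (e * (sqrt x - c)))"
        using D[OF i] by (simp add: r)
      show "((\<lambda>x. e * (sqrt x - c)) has_real_derivative e * (1 / (2 * r))) (at x)"
        by (rule DERIV_cong[OF DERIV_cmult[OF DERIV_diff[OF sq DERIV_const]]]) simp
    qed
    have D2: "((\<lambda>x. sqrt x ^ i) has_real_derivative real i * r ^ i / (2 * x)) (at x)"
    proof (rule DERIV_cong[OF DERIV_power[OF sq]])
      show "of_nat i * (1 / (2 * r) * sqrt x ^ (i - Suc 0)) = real i * r ^ i / (2 * x)"
        using r(1) by (cases i) (simp_all add: r(2)[symmetric] r_def[symmetric])
    qed
    have D3: "((\<lambda>x. 1 / x ^ s) has_real_derivative - real s / x ^ Suc s) (at x)"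
    proof -
      have "((\<lambda>x. inverse (x ^ s)) has_real_derivative - (inverse (x ^ s) * (of_nat s * (1 * x ^ (s - Suc 0))) * inverse (x ^ s))) (at x)"
        using x by (intro DERIV_inverse' DERIV_power DERIV_ident) simp
      moreover have "- (inverse (x ^ s) * (of_nat s * (1 * x ^ (s - Suc 0))) * inverse (x ^ s)) = - real s / x ^ Suc s"
        using x by (cases s) (simp_all add: field_simps)
      ultimately show ?thesis by (simp add: inverse_eq_divide)
    qed
    have "((\<lambda>x. (D i (e * (sqrt x - c)) * e ^ i) * (sqrt x ^ i * (1 / x ^ s))) has_real_derivative
      (D (Suc i) (e * (r - c)) * (e * (1 / (2 * r))) * e ^ i) * (sqrt x ^ i * (1 / x ^ s)) +
      (real i * r ^ i / (2 * x) * (1 / x ^ s) + - real s / x ^ Suc s * sqrt x ^ i) * (D i (e * (sqrt x - c)) * e ^ i)) (at x)"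
      by (intro DERIV_mult DERIV_cmult_right D1 D2 D3)
    then have "((\<lambda>x. D i (e * (sqrt x - c)) * e ^ i * sqrt x ^ i / x ^ s) has_real_derivative
      (D (Suc i) (e * (r - c)) * (e * (1 / (2 * r))) * e ^ i) * (sqrt x ^ i * (1 / x ^ s)) +
      (real i * r ^ i / (2 * x) * (1 / x ^ s) + - real s / x ^ Suc s * sqrt x ^ i) * (D i (e * (sqrt x - c)) * e ^ i)) (at x)"
      by (simp only: mult_1_right times_divide_eq_right mult.assoc[symmetric])
    then show ?thesis
    proof (rule DERIV_cong)
      have q: "1 / (2 * r) = r / (2 * x)" using r(1) by (simp add: r(2)[symmetric])
      show "(D (Suc i) (e * (r - c)) * (e * (1 / (2 * r))) * e ^ i) * (sqrt x ^ i * (1 / x ^ s)) +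
      (real i * r ^ i / (2 * x) * (1 / x ^ s) + - real s / x ^ Suc s * sqrt x ^ i) * (D i (e * (sqrt x - c)) * e ^ i)
        = (T (Suc i) + (real i - 2 * real s) * T i) / 2"
        unfolding q r(3) T_def using x by (simp add: field_simps)
    qed
  qed
  have "(sqrt_deriv D c e s has_real_derivative (\<Sum>i\<le>s. sqrt_chain s i * ((T (Suc i) + (real i - 2 * real s) * T i) / 2))) (at x)"
    unfolding sqrt_deriv_def[abs_def] by (intro DERIV_sum DERIV_cmult trm) simp
  moreover have "(\<Sum>i\<le>s. sqrt_chain s i * ((T (Suc i) + (real i - 2 * real s) * T i) / 2)) = sqrt_deriv D c e (Suc s) x"
  proof -
    have "sqrt_deriv D c e (Suc s) x = (\<Sum>i\<le>Suc s. sqrt_chain (Suc s) i * T i)"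
      by (simp add: sqrt_deriv_def T_def r del: sqrt_chain.simps)
    also have "\<dots> = (\<Sum>i\<le>Suc s. (if i = 0 then 0 else sqrt_chain s (i - 1)) * T i / 2) + (\<Sum>i\<le>Suc s. (real i - 2 * real s) * sqrt_chain s i * T i / 2)"
      unfolding sum.distrib[symmetric] by (intro sum.cong refl) (simp add: field_simps)
    also have "(\<Sum>i\<le>Suc s. (if i = 0 then 0 else sqrt_chain s (i - 1)) * T i / 2) = (\<Sum>i\<le>s. sqrt_chain s i * T (Suc i) / 2)"
      by (subst sum.atMost_Suc_shift) simp
    also have "(\<Sum>i\<le>Suc s. (real i - 2 * real s) * sqrt_chain s i * T i / 2) = (\<Sum>i\<le>s. (real i - 2 * real s) * sqrt_chain s i * T i / 2)"
      by (simp add: sqrt_chain_0)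
    finally show ?thesis by (simp add: sum.distrib[symmetric] field_simps)
  qed
  ultimately show ?thesis by simp
qed

text \<open>\<open>sqrt x ^ i / x ^ s\<close> is the power \<open>- (2 s - i)\<close> of
  \<open>sqrt x\<close>, hence at most \<open>(2 e) ^ (2 s - i)\<close>. Together with the
  \<open>e ^ i\<close> of the chain rule every term is of order \<open>e ^ (2 s)\<close>; the lemma
  is used with \<open>e = 1 / N\<close>.\<close>

lemma sqrt_deriv_bound:
  assumes B: "\<And>i. i \<le> s \<Longrightarrow> \<bar>D i (e * (sqrt x - c))\<bar> \<le> B" and e: "e > 0" and x: "sqrt x \<ge> 1 / (2 * e)"
  shows "\<bar>sqrt_deriv D c e s x\<bar> \<le> (\<Sum>i\<le>s. \<bar>sqrt_chain s i\<bar> * B * 4 ^ s) * e ^ (2 * s)"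
proof -
  define r where "r = sqrt x"
  have "0 < 1 / (2 * e)" using e by simp
  then have r: "r \<ge> 1 / (2 * e)" "r > 0" using x unfolding r_def by linarith+
  then have xr: "x = r ^ 2" by (simp add: r_def)
  have B0: "B \<ge> 0" using B[of 0] by linarith
  have "\<bar>D i (e * (sqrt x - c)) * e ^ i * sqrt x ^ i / x ^ s\<bar> \<le> B * 4 ^ s * e ^ (2 * s)" if i: "i \<le> s" for i
  proof -
    have "r ^ i / x ^ s = 1 / r ^ (2 * s - i)"
      using r i by (simp add: xr power_mult[symmetric] power_diff field_simps)
    also have "\<dots> \<le> 1 / (1 / (2 * e)) ^ (2 * s - i)"
      using r e by (intro divide_left_mono power_mono mult_pos_pos zero_less_power) auto
    also have "\<dots> = 2 ^ (2 * s - i) * e ^ (2 * s - i)" by (simp add: power_mult_distrib power_divide)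
    also have "\<dots> \<le> 2 ^ (2 * s) * e ^ (2 * s - i)"
      using e by (intro mult_right_mono power_increasing) auto
    finally have 1: "r ^ i / x ^ s \<le> 4 ^ s * e ^ (2 * s - i)" by (simp add: power_mult)
    have "\<bar>D i (e * (sqrt x - c)) * e ^ i * sqrt x ^ i / x ^ s\<bar> = \<bar>D i (e * (sqrt x - c))\<bar> * (e ^ i * (r ^ i / x ^ s))"
      using r e by (simp add: abs_mult xr r_def[symmetric])
    also have "\<dots> \<le> B * (e ^ i * (4 ^ s * e ^ (2 * s - i)))"
      using B[OF i] B0 e r 1 by (intro mult_mono) (auto simp: xr)
    also have "\<dots> = B * 4 ^ s * (e ^ i * e ^ (2 * s - i))" by (simp only: mult_ac)
    also have "e ^ i * e ^ (2 * s - i) = e ^ (2 * s)" using i by (simp add: power_add[symmetric])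
    finally show ?thesis .
  qed
  then have "\<bar>sqrt_deriv D c e s x\<bar> \<le> (\<Sum>i\<le>s. \<bar>sqrt_chain s i\<bar> * (B * 4 ^ s * e ^ (2 * s)))"
    unfolding sqrt_deriv_def by (intro order_trans[OF sum_abs] sum_mono) (subst abs_mult, intro mult_left_mono, auto)
  then show ?thesis by (simp only: sum_distrib_right mult.assoc)
qed

lemma pochhammer_le_power: "x \<ge> 0 \<Longrightarrow> pochhammer x n \<le> (x + real n) ^ n" for x :: real
proof (induction n)
  case (Suc n)
  have "pochhammer x (Suc n) \<le> (x + real n) ^ n * (x + real n)"
    using Suc by (auto simp: pochhammer_Suc intro!: mult_right_mono)
  also have "\<dots> \<le> (x + real (Suc n)) ^ Suc n"
    unfolding power_Suc2 using Suc.prems by (intro mult_mono power_mono) auto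
  finally show ?case .
qed simp

text \<open>A product of \<open>1 + s + (d - 2 + s)\<close> linear factors, each at most
  \<open>q * N\<close>.\<close>

lemma zonal_val_bound:
  assumes d: "d \<ge> 2"
  obtains C where "C > 0" "\<And>l N. l < 2 * N \<Longrightarrow> zonal_val d s l \<le> C * real N ^ (d - 1 + 2 * s)"
proof -
  define q where "q = 4 + real d + real s"
  define C where "C = zonal_const d s * q ^ (d - 1 + 2 * s)"
  have q: "q > 0" by (simp add: q_def)
  have c: "zonal_const d s > 0" by (rule zonal_const_pos[OF d])
  have "zonal_val d s l \<le> C * real N ^ (d - 1 + 2 * s)" if l: "l < 2 * N" for l N
  proof -
    have N: "real N \<ge> 1" and lN: "real l \<le> 2 * real N" using l by auto
    have dN: "(real d + real s) * 1 \<le> (real d + real s) * real N" using N by (intro mult_left_mono) auto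
    have r: "real (d - 2 + s) = real d - 2 + real s" using d by simp
    have a: "2 * real l + real d - 1 + real s \<le> q * real N"
      and b: "real l + real d / 2 + real s \<le> q * real N" and e: "real l + 1 + real (d - 2 + s) \<le> q * real N"
      using dN N lN d unfolding q_def r by (auto simp: algebra_simps)
    have "zonal_val d s l \<le> zonal_const d s * (q * real N) * ((q * real N) ^ s * (q * real N) ^ (d - 2 + s))"
      unfolding zonal_val_def zonal_u_def
    proof (intro mult_mono)
      show "pochhammer (real l + real d / 2) s \<le> (q * real N) ^ s"
        using b by (intro order_trans[OF pochhammer_le_power] power_mono) auto
      show "pochhammer (real l + 1) (d - 2 + s) \<le> (q * real N) ^ (d - 2 + s)"
        using e by (intro order_trans[OF pochhammer_le_power] power_mono) auto
    qed (use a c q d in \<open>auto intro!: pochhammer_nonneg mult_nonneg_nonneg\<close>)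
    also have "\<dots> = zonal_const d s * (q * real N) ^ (1 + s + (d - 2 + s))"
      by (simp only: power_add power_one_right mult_ac)
    also have "1 + s + (d - 2 + s) = d - 1 + 2 * s" using d by simp
    finally show ?thesis by (simp add: C_def power_mult_distrib mult_ac)
  qed
  then show thesis using that[of C] c q by (simp add: C_def)
qed

section \<open>Localisation of the filtered kernel\<close>

lemma sphere_inner_bound:
  fixes x z :: "real ^ 'n"
  assumes "x \<in> sphere 0 1" "z \<in> sphere 0 1"
  shows "\<bar>x \<bullet> z\<bar> \<le> 1"
  using Cauchy_Schwarz_ineq2[of x z] assms by simp

text \<open>With \<open>x\<close> rotated to a coordinate axis, the cone over the cap fits into a
  box of length \<open>2\<close> along the axis and \<open>2 sqrt (2 \<rho>)\<close> in each of the
  other \<open>d\<close> directions: on the unit sphere an off-axis coordinate has square at most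
  \<open>(1 - y $ k) (1 + y $ k) \<le> 2 \<rho>\<close>.\<close>

lemma sphere_cap_measure:
  assumes card: "CARD('n) = d + 1" and d: "d \<ge> 2"
  obtains C where "C > 0"
    "\<And>\<rho> x. \<rho> \<ge> 0 \<Longrightarrow> (x :: real ^ 'n) \<in> sphere 0 1 \<Longrightarrow>
       (\<integral>z. indicator {z. 1 - x \<bullet> z \<le> \<rho>} z \<partial>sphere_measure) \<le> C * sqrt \<rho> ^ d"
proof -
  define V where "V = measure lborel (ball (0::real^'n) 1)"
  have V: "V > 0" by (simp add: V_def content_ball_pos)
  have eV: "emeasure lborel (ball (0::real^'n) 1) = ennreal V"
    unfolding V_def using emeasure_ball_pos(2) by (rule emeasure_eq_ennreal_measure)
  define C where "C = 2 * (2 * sqrt 2) ^ d / V"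
  have "(\<integral>z. indicator {z. 1 - x \<bullet> z \<le> \<rho>} z \<partial>sphere_measure) \<le> C * sqrt \<rho> ^ d"
    if rho: "\<rho> \<ge> 0" and x: "x \<in> sphere 0 1" for \<rho> and x :: "real ^ 'n"
  proof -
    obtain k :: 'n where True by simp
    define e where "e = axis k (1::real)"
    obtain f where f: "orthogonal_transformation f" "f e = x"
      using rotation_exists_1[of e x] x card d by (auto simp: e_def)
    define S where "S y = {z::real^'n. 1 - y \<bullet> z \<le> \<rho>}" for y
    have Sm [measurable]: "S y \<in> sets borel" for y
      unfolding S_def by (intro borel_closed closed_Collect_le continuous_intros)
    have fe: "x \<bullet> f z = e \<bullet> z" for z
      using f by (metis orthogonal_transformation_def)
    have "(\<integral>\<^sup>+z. indicator (S x) z \<partial>sphere_measure) = (\<integral>\<^sup>+z. indicator (S x) (f z) \<partial>sphere_measure)"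
      by (rule nn_integral_sphere_orthogonal[OF f(1), symmetric]) measurable
    also have "\<dots> = (\<integral>\<^sup>+z. indicator (S e) z \<partial>sphere_measure)"
      by (intro nn_integral_cong) (simp add: S_def indicator_def fe)
    also have "\<dots> = (\<integral>\<^sup>+z. indicator (S e) z \<partial>cone_measure)"
      by (rule nn_integral_sphere_measure) measurable
    also have "\<dots> = emeasure cone_measure (S e)" by simp
    also have "\<dots> = emeasure lborel (ball 0 1 \<inter> sgn -` S e) / ennreal V"
      using measurable_sets[OF borel_measurable_sgn, of "S e"] by (simp add: emeasure_distr eV)
    also have "\<dots> \<le> ennreal (2 * (2 * sqrt (2 * \<rho>)) ^ d) / ennreal V"
    proof (rule divide_right_mono_ennreal)
      define q where "q = sqrt (2 * \<rho>)"
      have q: "q \<ge> 0" using rho by (simp add: q_def)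
      define a b :: "real ^ 'n" where "a = (\<chi> i. if i = k then -1 else - q)" and "b = (\<chi> i. if i = k then 1 else q)"
      have sub: "ball 0 1 \<inter> sgn -` S e \<subseteq> cbox a b"
      proof (intro subsetI)
        fix z :: "real ^ 'n" assume z: "z \<in> ball 0 1 \<inter> sgn -` S e"
        then have nz: "norm z \<le> 1" by simp
        have zk: "\<bar>z $ i\<bar> \<le> 1" for i using component_le_norm_cart[of z i] nz by linarith
        have "\<bar>z $ i\<bar> \<le> q" if i: "i \<noteq> k" for i
        proof (cases "z = 0")
          case True
          then show ?thesis using q by simp
        next
          case False
          define y where "y = sgn z"
          have ny: "norm y = 1" using False by (simp add: y_def norm_sgn)
          have yk: "1 - y $ k \<le> \<rho>" using z by (simp add: S_def y_def e_def inner_axis' )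
          have "\<bar>y $ k\<bar> \<le> 1" using component_le_norm_cart[of y k] ny by simp
          have "(y $ i)\<^sup>2 + (y $ k)\<^sup>2 = (\<Sum>j\<in>{i, k}. (y $ j)\<^sup>2)" using i by simp
          also have "\<dots> \<le> (\<Sum>j\<in>UNIV. (y $ j)\<^sup>2)" by (rule sum_mono2) auto
          also have "\<dots> = y \<bullet> y" by (simp add: inner_vec_def power2_eq_square)
          also have "\<dots> = 1" using ny by (simp add: dot_square_norm)
          finally have "(y $ i)\<^sup>2 \<le> (1 - y $ k) * (1 + y $ k)" by (simp add: power2_eq_square algebra_simps)
          also have "\<dots> \<le> \<rho> * 2" using yk \<open>\<bar>y $ k\<bar> \<le> 1\<close> rho by (intro mult_mono) auto
          finally have "\<bar>y $ i\<bar> \<le> q" unfolding q_def by (intro real_le_rsqrt) (simp add: mult.commute)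
          moreover have "z $ i = norm z * y $ i" using False by (simp add: y_def sgn_div_norm)
          then have "\<bar>z $ i\<bar> \<le> 1 * \<bar>y $ i\<bar>" using nz by (simp add: abs_mult mult_left_le_one_le)
          ultimately show ?thesis by simp
        qed
        then show "z \<in> cbox a b"
          using zk by (auto simp: mem_box_cart a_def b_def abs_le_iff minus_le_iff)
      qed
      have ne: "cbox a b \<noteq> {}"
        using q by (auto simp: interval_ne_empty_cart a_def b_def)
      have "measure lborel (cbox a b) = (\<Prod>i\<in>UNIV. b $ i - a $ i)"
        by (rule content_cbox_cart[OF ne])
      also have "\<dots> = (b $ k - a $ k) * (\<Prod>i\<in>UNIV - {k}. b $ i - a $ i)"
        by (rule prod.remove) auto
      also have "(\<Prod>i\<in>UNIV - {k}. b $ i - a $ i) = (\<Prod>i\<in>UNIV - {k}. 2 * q)"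
        by (rule prod.cong) (auto simp: a_def b_def)
      finally have "measure lborel (cbox a b) = 2 * (2 * q) ^ d"
        using card by (simp add: a_def b_def)
      then have "emeasure lborel (cbox a b) = ennreal (2 * (2 * q) ^ d)"
        using emeasure_lborel_cbox_finite[of a b] by (simp add: emeasure_eq_ennreal_measure)
      then show "emeasure lborel (ball 0 1 \<inter> sgn -` S e) \<le> ennreal (2 * (2 * sqrt (2 * \<rho>)) ^ d)"
        using emeasure_mono[OF sub, of lborel] by (simp add: q_def)
    qed
    also have "\<dots> = ennreal (C * sqrt \<rho> ^ d)"
      using V rho by (subst divide_ennreal) (auto simp: C_def real_sqrt_mult power_mult_distrib)
    finally have "(\<integral>\<^sup>+z. indicator (S x) z \<partial>sphere_measure) \<le> ennreal (C * sqrt \<rho> ^ d)" .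
    moreover have "0 \<le> C * sqrt \<rho> ^ d" using V rho by (simp add: C_def)
    moreover have "(\<integral>\<^sup>+z. indicator (S x) z \<partial>sphere_measure) = (\<integral>\<^sup>+z. ennreal (indicator (S x) z) \<partial>sphere_measure)"
      by (intro nn_integral_cong) (simp add: indicator_def)
    ultimately show ?thesis
      unfolding S_def[symmetric] by (subst integral_eq_nn_integral) (auto intro: enn2real_leI)
  qed
  moreover have "C > 0" using V by (simp add: C_def)
  ultimately show thesis using that by blast
qed

lemma sum_half_powers_le: "(\<Sum>m\<le>M. (1/2) ^ m) \<le> (2::real)"
proof -
  have "(\<Sum>m\<le>M. (1/2) ^ m) = 2 - (1/2::real) ^ M" by (induction M) auto
  then show ?thesis by simp
qed

text \<open>
  The weight is bounded on each dyadic shell \<open>4 ^ (m - 1) < N\<^sup>2 (1 - x \<bullet> z) \<le> 4 ^ m\<close>, which lies in a cap.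
\<close>
lemma inverse_weight_integral:
  assumes card: "CARD('n) = d + 1" and d: "d \<ge> 2" and s: "2 * s \<ge> d + 1"
  obtains C where "C > 0"
    "\<And>N x. N \<ge> 1 \<Longrightarrow> (x :: real ^ 'n) \<in> sphere 0 1 \<Longrightarrow>
       (\<integral>z. 1 / (1 + ((real N)\<^sup>2 * (1 - x \<bullet> z)) ^ s) \<partial>sphere_measure) \<le> C / real N ^ d"
proof -
  obtain C where C: "C > 0" "\<And>\<rho> x. \<rho> \<ge> 0 \<Longrightarrow> (x :: real ^ 'n) \<in> sphere 0 1 \<Longrightarrow>
       (\<integral>z. indicator {z. 1 - x \<bullet> z \<le> \<rho>} z \<partial>sphere_measure) \<le> C * sqrt \<rho> ^ d"
    using sphere_cap_measure[OF card d] by blast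
  have "(\<integral>z. 1 / (1 + ((real N)\<^sup>2 * (1 - x \<bullet> z)) ^ s) \<partial>sphere_measure) \<le> (4 ^ s * C * 2) / real N ^ d"
    if N: "N \<ge> 1" and x: "x \<in> sphere 0 1" for N and x :: "real ^ 'n"
  proof -
    \<comment> \<open>As \<open>1 - x \<bullet> z \<le> 2\<close>, the shells up to this index cover
      the sphere.\<close>
    obtain M where M: "2 * (real N)\<^sup>2 < 4 ^ M" using real_arch_pow[of 4 "2 * (real N)\<^sup>2"] by auto
    define A where "A m = {z. 1 - x \<bullet> z \<le> 4 ^ m / (real N)\<^sup>2}" for m :: nat
    have [measurable]: "A m \<in> sets borel" for m
      unfolding A_def by (intro borel_closed closed_Collect_le continuous_intros)
    have intA: "integrable sphere_measure (indicator (A m) :: _ \<Rightarrow> real)" for m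
      by (intro sph.integrable_const_bound[where B = 1] AE_I2 measurable_sphere_measureI) (auto simp: indicator_def)
    have pw: "1 / (1 + ((real N)\<^sup>2 * (1 - x \<bullet> z)) ^ s) \<le> (\<Sum>m\<le>M. 4 ^ s / 4 ^ (m * s) * indicator (A m) z)"
      if z: "z \<in> sphere 0 1" for z
    proof -
      define u where "u = (real N)\<^sup>2 * (1 - x \<bullet> z)"
      have xz: "\<bar>x \<bullet> z\<bar> \<le> 1" by (rule sphere_inner_bound[OF x z])
      have u0: "u \<ge> 0" using xz by (simp add: u_def)
      have "u \<le> (real N)\<^sup>2 * 2" unfolding u_def using xz by (intro mult_left_mono) auto
      then have uM: "u \<le> 4 ^ M" using M by simp
      have Am: "z \<in> A m \<longleftrightarrow> u \<le> 4 ^ m" for m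
        using N by (simp add: A_def u_def field_simps)
      define m where "m = (LEAST m. u \<le> 4 ^ m)"
      have m1: "u \<le> 4 ^ m" unfolding m_def using uM by (rule LeastI)
      have mM: "m \<le> M" unfolding m_def using uM by (rule Least_le)
      have "1 / (1 + u ^ s) \<le> 4 ^ s / 4 ^ (m * s)"
      proof (cases m)
        case 0
        have "1 / (1 + u ^ s) \<le> 1" using zero_le_power[OF u0, of s] by (subst pos_divide_le_eq) (auto intro: add_pos_nonneg)
        also have "1 \<le> (4::real) ^ s" by simp
        finally show ?thesis by (simp add: 0)
      next
        case (Suc k)
        then have "\<not> u \<le> 4 ^ k" unfolding m_def using not_less_Least[of k "\<lambda>m. u \<le> 4 ^ m"] by (metis lessI)
        then have "(4 ^ k) ^ s \<le> u ^ s" by (intro power_mono) auto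
        then have "(4 ^ k) ^ s \<le> 1 + u ^ s" by simp
        then have "1 / (1 + u ^ s) \<le> 1 / (4 ^ k) ^ s" by (intro divide_left_mono mult_pos_pos) (auto intro: add_pos_nonneg simp: u0)
        also have "1 / ((4::real) ^ k) ^ s = 4 ^ s / 4 ^ (m * s)"
          by (simp add: Suc power_add power_mult)
        finally show ?thesis .
      qed
      also have "\<dots> = 4 ^ s / 4 ^ (m * s) * indicator (A m) z" using m1 by (simp add: Am)
      also have "\<dots> \<le> (\<Sum>m\<le>M. 4 ^ s / 4 ^ (m * s) * indicator (A m) z)"
        by (rule member_le_sum[of m "{..M}" "\<lambda>m. 4 ^ s / 4 ^ (m * s) * indicator (A m) z"])
          (use mM in \<open>auto intro!: mult_nonneg_nonneg\<close>)
      finally show ?thesis by (simp add: u_def)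
    qed
    have "(\<integral>z. 1 / (1 + ((real N)\<^sup>2 * (1 - x \<bullet> z)) ^ s) \<partial>sphere_measure)
       \<le> (\<integral>z. (\<Sum>m\<le>M. 4 ^ s / 4 ^ (m * s) * indicator (A m) z) \<partial>sphere_measure)"
    proof (rule integral_mono_AE')
      show "integrable sphere_measure (\<lambda>z. \<Sum>m\<le>M. 4 ^ s / 4 ^ (m * s) * indicator (A m) z :: real)"
        by (intro Bochner_Integration.integrable_sum integrable_mult_right intA)
      show "AE z in sphere_measure. 1 / (1 + ((real N)\<^sup>2 * (1 - x \<bullet> z)) ^ s) \<le> (\<Sum>m\<le>M. 4 ^ s / 4 ^ (m * s) * indicator (A m) z)"
        using pw by (intro AE_I2) simp
      show "AE z in sphere_measure. 0 \<le> (\<Sum>m\<le>M. 4 ^ s / 4 ^ (m * s) * indicator (A m) z :: real)"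
        by (intro AE_I2 sum_nonneg) auto
    qed
    also have "\<dots> = (\<Sum>m\<le>M. 4 ^ s / 4 ^ (m * s) * (\<integral>z. indicator (A m) z \<partial>sphere_measure))"
      by (subst Bochner_Integration.integral_sum) (auto intro!: integrable_mult_right intA)
    also have "\<dots> \<le> (\<Sum>m\<le>M. (4 ^ s * C / real N ^ d) * (1/2) ^ m)"
    proof (rule sum_mono)
      fix m
      have sq: "sqrt (4 ^ m / (real N)\<^sup>2) = 2 ^ m / real N"
      proof (rule real_sqrt_unique)
        show "(2 ^ m / real N)\<^sup>2 = 4 ^ m / (real N)\<^sup>2"
          by (simp add: power_divide power_mult[symmetric] mult.commute[of m]) (simp add: power_mult)
      qed simp
      have "(\<integral>z. indicator (A m) z \<partial>sphere_measure) \<le> C * (2 ^ m / real N) ^ d"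
        using C(2)[OF _ x, of "4 ^ m / (real N)\<^sup>2"] by (simp add: A_def sq)
      then have "4 ^ s / 4 ^ (m * s) * (\<integral>z. indicator (A m) z \<partial>sphere_measure) \<le> 4 ^ s / 4 ^ (m * s) * (C * (2 ^ m / real N) ^ d)"
        by (intro mult_left_mono) auto
      also have "\<dots> = (4 ^ s * C / real N ^ d) * (2 ^ (m * d) / 4 ^ (m * s))"
        by (simp add: power_divide power_mult[symmetric] mult_ac)
      also have "\<dots> \<le> (4 ^ s * C / real N ^ d) * (1/2) ^ m"
      proof (intro mult_left_mono)
        \<comment> \<open>Here \<open>2 s \<ge> d + 1\<close> enters: the contributions of the
          shells decay like \<open>(1/2) ^ m\<close>.\<close>
        have "m * d + m \<le> m * (2 * s)" using s by (metis add_mult_distrib2 mult_le_mono2 mult.right_neutral)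
        then have "(2::real) ^ (m * d + m) \<le> 2 ^ (m * (2 * s))" by (intro power_increasing) auto
        also have "(2::real) ^ (m * (2 * s)) = (2 ^ 2) ^ (m * s)" unfolding power_mult[symmetric] by (simp add: mult_ac)
        finally have "(2::real) ^ (m * d) * 2 ^ m \<le> 4 ^ (m * s)" by (simp add: power_add)
        then show "2 ^ (m * d) / 4 ^ (m * s) \<le> (1/2::real) ^ m"
          by (simp add: field_simps power_divide)
      qed (use C in simp)
      finally show "4 ^ s / 4 ^ (m * s) * (\<integral>z. indicator (A m) z \<partial>sphere_measure) \<le> (4 ^ s * C / real N ^ d) * (1/2) ^ m" .
    qed
    also have "\<dots> = (4 ^ s * C / real N ^ d) * (\<Sum>m\<le>M. (1/2) ^ m)" by (rule sum_distrib_left[symmetric])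
    also have "\<dots> \<le> (4 ^ s * C / real N ^ d) * 2" using C by (intro mult_left_mono sum_half_powers_le) auto
    finally show ?thesis by simp
  qed
  then show thesis using that[of "4 ^ s * C * 2"] C(1) by simp
qed

text \<open>The bound on \<open>\<kappa>\<close> is the order \<open>s\<close> of the weight in the
  kernel estimates, since divided differences of order \<open>s\<close> are controlled by
  \<open>s\<close> derivatives.\<close>

locale zonal_filter =
  fixes d \<kappa> :: nat and h :: "real \<Rightarrow> real"
  assumes d: "d \<ge> 2" and needlet_h: "needlet_filter \<kappa> h" and kappa: "\<kappa> \<ge> d div 2 + 1"
begin

lemma h_Ck: "Ck_on \<kappa> {0..} h" and h_rel: "\<And>t. t \<in> {1/2..1} \<Longrightarrow> (h t)\<^sup>2 + (h (2 * t))\<^sup>2 = 1"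
  and h_supp: "closure {t. t \<ge> 0 \<and> h t \<noteq> 0} = {1/2..2}"
  using needlet_h by (auto simp: needlet_filter_def)

lemma h_cont: "continuous_on {0..} h"
proof -
  obtain k where k: "\<kappa> = Suc k" using kappa by (cases \<kappa>) auto
  obtain f' where "\<forall>t\<in>{0..}. (h has_real_derivative f' t) (at t within {0..})"
    using h_Ck unfolding k Ck_on_Suc_iff by blast
  then show ?thesis by (intro DERIV_continuous_on) auto
qed

text \<open>The support only yields zeros outside \<open>[1/2, 2]\<close>; at the two endpoints they
  follow by continuity.\<close>

lemma h_zero:
  assumes "t \<ge> 0" "t \<le> 1/2 \<or> t \<ge> 2"
  shows "h t = 0"
proof -
  have out: "h t = 0" if "t \<ge> 0" "t < 1/2 \<or> t > 2" for t
  proof (rule ccontr)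
    assume "h t \<noteq> 0"
    then have "t \<in> closure {t. t \<ge> 0 \<and> h t \<noteq> 0}" using that by (intro closure_subset[THEN subsetD]) simp
    then show False using that by (simp add: h_supp)
  qed
  have 1: "h t = 0" if t: "t \<in> closure S" "S \<subseteq> {0..}" "\<And>u. u \<in> S \<Longrightarrow> h u = 0" for t S
  proof (rule continuous_constant_on_closure[of S h 0 t])
    show "continuous_on (closure S) h"
      by (rule continuous_on_subset[OF h_cont]) (simp add: closure_minimal t(2))
  qed (use t in auto)
  have "h (1/2) = 0" by (rule 1[of _ "{0<..<1/2}"]) (auto intro!: out)
  moreover have "h 2 = 0" by (rule 1[of _ "{2<..}"]) (auto intro!: out)
  moreover have "t = 1/2 \<or> t = 2 \<or> t < 1/2 \<or> t > 2" using assms by linarith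
  ultimately show ?thesis using assms(1) out[of t] by metis
qed

definition filt :: "nat \<Rightarrow> nat \<Rightarrow> real" where
  "filt N l = (if l \<le> N then 1 else (h (real l / real N))\<^sup>2)"

lemma filt_zero: "N \<ge> 1 \<Longrightarrow> l \<ge> 2 * N \<Longrightarrow> filt N l = 0"
  by (auto simp: filt_def h_zero pos_le_divide_eq)

text \<open>
  Smooth on all of \<open>[0, \<infinity>)\<close> and equal to the filter profile from \<open>1 / 2\<close> on, which avoids gluing at \<open>1\<close>.
\<close>
definition filt_fun :: "real \<Rightarrow> real" where
  "filt_fun t = (h t)\<^sup>2 + (h (2 * t))\<^sup>2"

text \<open>Up to index \<open>N\<close> the filter relation makes the sum of squares
  \<open>1\<close>; beyond it the second square lies outside the support.\<close>

lemma filt_eq_filt_fun: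
  assumes "N \<ge> 1" "N \<le> 2 * l"
  shows "filt N l = filt_fun (real l / real N)"
proof (cases "l \<le> N")
  case True
  then have t: "real l / real N \<in> {1/2..1}" using assms by (auto simp: field_simps)
  show ?thesis using True h_rel[OF t] by (simp add: filt_def filt_fun_def)
next
  case False
  then have "h (2 * (real l / real N)) = 0" using assms by (intro h_zero) (auto simp: field_simps)
  then show ?thesis using False by (simp add: filt_def filt_fun_def)
qed

lemma filt_fun_Ck: "Ck_on \<kappa> {0..} filt_fun"
  unfolding filt_fun_def[abs_def] power2_eq_square
  by (intro Ck_on_add Ck_on_mult h_Ck Ck_on_scale[of \<kappa> h 2]) auto

lemma zonal_node_mono: "strict_mono (zonal_node d)"
  unfolding zonal_node_def
  using d by (intro strict_monoI power_strict_mono) auto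

text \<open>
  If all nodes involved have index at most \<open>N\<close>, the coefficients are constant. Otherwise \<open>N \<ge> 2 * s\<close> puts all of
  them into the range where \<open>filt_fun\<close> applies.
\<close>
lemma divdiff_filt_bound:
  assumes s: "s \<le> \<kappa>"
  obtains C where "C > 0"
    "\<And>N l. N \<ge> 1 \<Longrightarrow> N \<ge> 2 * s \<Longrightarrow> \<bar>divdiff (zonal_node d) (filt N) s l\<bar> \<le> C / real N ^ (2 * s)"
proof -
  obtain D where D0: "\<forall>t\<in>{0..}. D 0 t = filt_fun t"
    and D: "\<forall>m<\<kappa>. \<forall>t\<in>{0..}. (D m has_real_derivative D (Suc m) t) (at t within {0..})"
    and Dc: "continuous_on {0..} (D \<kappa>)"
    using filt_fun_Ck unfolding Ck_on_def by blast
  \<comment> \<open>Node indices stay below \<open>2 N + s\<close>, so after division by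
    \<open>N \<ge> 1\<close> the arguments of the profile stay below \<open>2 + s\<close>.\<close>
  define R where "R = 2 + real s"
  have cont: "continuous_on {0..R} (D m)" if "m \<le> \<kappa>" for m
  proof (cases "m = \<kappa>")
    case True
    then show ?thesis using Dc by (auto intro: continuous_on_subset)
  next
    case False
    then have "continuous_on {0..} (D m)" using that D by (intro DERIV_continuous_on[where D = "D (Suc m)"]) auto
    then show ?thesis by (rule continuous_on_subset) auto
  qed
  have "\<exists>B. \<forall>t\<in>{0..R}. \<bar>D m t\<bar> \<le> B" if "m \<le> \<kappa>" for m
    using compact_imp_bounded[OF compact_continuous_image[OF cont[OF that]]]
    by (auto simp: bounded_iff)
  then obtain b where b: "\<And>m t. m \<le> \<kappa> \<Longrightarrow> t \<in> {0..R} \<Longrightarrow> \<bar>D m t\<bar> \<le> b m" by metis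
  define B where "B = (\<Sum>m\<le>\<kappa>. \<bar>b m\<bar>)"
  have B: "\<bar>D m t\<bar> \<le> B" if "m \<le> \<kappa>" "t \<in> {0..R}" for m t
  proof -
    have "\<bar>D m t\<bar> \<le> \<bar>b m\<bar>" using b[OF that] by linarith
    also have "\<dots> \<le> B" unfolding B_def using that by (intro member_le_sum) auto
    finally show ?thesis .
  qed
  define c where "c = (real d - 1) / 2"
  have c: "c > 0" using d by (simp add: c_def)
  have node: "zonal_node d i = (real i + c)\<^sup>2" for i by (simp add: zonal_node_def c_def)
  define C1 where "C1 = (\<Sum>i\<le>s. \<bar>sqrt_chain s i\<bar> * B * 4 ^ s)"
  have "B \<ge> 0" by (simp add: B_def sum_nonneg)
  then have C1: "C1 \<ge> 0" unfolding C1_def by (intro sum_nonneg mult_nonneg_nonneg) auto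
  have "\<bar>divdiff (zonal_node d) (filt N) s l\<bar> \<le> (C1 + 1) / real N ^ (2 * s)" if N: "N \<ge> 1" "N \<ge> 2 * s" for N l
  proof -
    consider "l + s \<le> N" | "l \<ge> 2 * N" | "l + s > N" "l < 2 * N" by linarith
    then show ?thesis
    proof cases
      case 1
      then have eq: "divdiff (zonal_node d) (filt N) s l = divdiff (zonal_node d) (\<lambda>_. 1) s l"
        by (intro divdiff_cong) (auto simp: filt_def)
      show ?thesis
      proof (cases s)
        case 0
        then show ?thesis using eq C1 by simp
      next
        case (Suc s')
        then show ?thesis using eq C1 by (simp only: divdiff_const Suc) simp
      qed
    next
      case 2
      then have eq: "divdiff (zonal_node d) (filt N) s l = divdiff (zonal_node d) (\<lambda>_. 0) s l"
        using N by (intro divdiff_cong) (auto simp: filt_zero)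
      show ?thesis
      proof (cases s)
        case 0
        then show ?thesis using eq C1 by simp
      next
        case (Suc s')
        then show ?thesis using eq C1 by (simp only: divdiff_const Suc) simp
      qed
    next
      case 3
      define e where "e = 1 / real N"
      have e: "e > 0" using N by (simp add: e_def)
      have lN: "2 * l \<ge> N" using 3 N by linarith
      then have lN': "l > 0" using N by linarith
      have rng: "e * (sqrt t - c) \<in> {1/2..R}" "sqrt t \<ge> 1 / (2 * e)" "t > 0"
        if t: "zonal_node d l \<le> t" "t \<le> zonal_node d (l + s)" for t
      proof -
        have a: "real l + c \<le> sqrt t" using t(1) c unfolding node by (intro real_le_rsqrt)
        have b: "sqrt t \<le> real (l + s) + c" using t(2) c unfolding node by (intro real_le_lsqrt) auto
        have "real l \<ge> real N / 2" using lN by simp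
        moreover have "real (l + s) \<le> 2 * real N + real s * real N"
          using 3 N mult_left_mono[of 1 "real N" "real s"] by simp
        ultimately have ab: "real N / 2 \<le> sqrt t - c" "sqrt t - c \<le> R * real N"
          using a b by (auto simp: R_def algebra_simps)
        then show "e * (sqrt t - c) \<in> {1/2..R}" using N by (simp add: e_def field_simps)
        show "sqrt t \<ge> 1 / (2 * e)" using ab(1) c by (simp add: e_def)
        have "sqrt t > 0" using a c by (smt (verit) of_nat_0_le_iff)
        then show "t > 0" by simp
      qed
      \<comment> \<open>The function \<open>\<lambda>t. filt_fun ((sqrt t - c) / N)\<close> takes
        the filter values at the nodes, since \<open>sqrt\<close> of a node is its index plus
        \<open>c\<close>.\<close>
      obtain z where z: "zonal_node d l \<le> z" "z \<le> zonal_node d (l + s)"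
        "divdiff (zonal_node d) (filt N) s l = sqrt_deriv D c e s z / fact s"
      proof (rule divdiff_mean_value[OF zonal_node_mono, of l s "sqrt_deriv D c e" "filt N"])
        fix i assume i: "l \<le> i" "i \<le> l + s"
        have "sqrt (zonal_node d i) = real i + c" using c by (simp add: node)
        then have "sqrt_deriv D c e 0 (zonal_node d i) = D 0 (real i / real N)"
          by (simp add: sqrt_deriv_def e_def)
        also have "\<dots> = filt N i"
          using D0 filt_eq_filt_fun[of N i] N lN i by simp
        finally show "sqrt_deriv D c e 0 (zonal_node d i) = filt N i" .
      next
        fix m t assume m: "m < s" and t: "zonal_node d l \<le> t" "t \<le> zonal_node d (l + s)"
        note r = rng[OF t]
        show "(sqrt_deriv D c e m has_real_derivative sqrt_deriv D c e (Suc m) t) (at t)"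
        proof (rule DERIV_sqrt_deriv[OF r(3)])
          fix i assume "i \<le> m"
          then have "(D i has_real_derivative D (Suc i) (e * (sqrt t - c))) (at (e * (sqrt t - c)) within {0..})"
            using D m s r(1) by auto
          moreover have "at (e * (sqrt t - c)) within {0..} = at (e * (sqrt t - c))"
            using r(1) by (intro at_within_interior) auto
          ultimately show "(D i has_real_derivative D (Suc i) (e * (sqrt t - c))) (at (e * (sqrt t - c)))" by simp
        qed
      qed blast
      note r = rng[OF z(1,2)]
      have "\<bar>sqrt_deriv D c e s z\<bar> \<le> C1 * e ^ (2 * s)"
        unfolding C1_def using r s by (intro sqrt_deriv_bound B e) auto
      also have "\<dots> \<le> (C1 + 1) / real N ^ (2 * s)"
        using N by (simp add: e_def power_divide divide_right_mono)
      finally have "\<bar>sqrt_deriv D c e s z\<bar> \<le> (C1 + 1) / real N ^ (2 * s)" .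
      moreover have "\<bar>sqrt_deriv D c e s z / fact s\<bar> \<le> \<bar>sqrt_deriv D c e s z\<bar>"
        using divide_left_mono[of 1 "fact s" "\<bar>sqrt_deriv D c e s z\<bar>"] by (simp add: abs_divide fact_ge_1)
      ultimately show ?thesis using z(3) by simp
    qed
  qed
  then show thesis using that[of "C1 + 1"] C1 by simp
qed

section \<open>Estimates of the filtered kernel\<close>

definition kernel :: "nat \<Rightarrow> real poly" where
  "kernel N = (\<Sum>l<2 * N. smult (filt N l) (zonal d 0 l))"

text \<open>Up to constants there are \<open>2 N\<close> terms, each the product of
  \<open>N ^ (- 4 s)\<close> from the squared divided difference and
  \<open>N ^ (d - 1 + 2 s)\<close> from \<open>zonal_val\<close>.\<close>

lemma weighted_kernel_norm:
  assumes card: "CARD('n) = d + 1" and s: "s \<le> \<kappa>"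
  obtains C where "C > 0"
    "\<And>N x. N \<ge> 1 \<Longrightarrow> N \<ge> 2 * s \<Longrightarrow> (x :: real ^ 'n) \<in> sphere 0 1 \<Longrightarrow>
       (\<integral>z. (1 - x \<bullet> z) ^ s * (poly (kernel N) (x \<bullet> z))\<^sup>2 \<partial>sphere_measure) \<le> C * real N ^ d / real N ^ (2 * s)"
proof -
  obtain C1 where C1: "C1 > 0"
    "\<And>N l. N \<ge> 1 \<Longrightarrow> N \<ge> 2 * s \<Longrightarrow> \<bar>divdiff (zonal_node d) (filt N) s l\<bar> \<le> C1 / real N ^ (2 * s)"
    using divdiff_filt_bound[OF s] by blast
  obtain C2 where C2: "C2 > 0" "\<And>l N. l < 2 * N \<Longrightarrow> zonal_val d s l \<le> C2 * real N ^ (d - 1 + 2 * s)"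
    using zonal_val_bound[OF d] by blast
  define C where "C = 2 * C1\<^sup>2 * zonal_nu d s * C2"
  have nu: "zonal_nu d s > 0" by (rule zonal_nu_pos[OF d])
  have "(\<integral>z. (1 - x \<bullet> z) ^ s * (poly (kernel N) (x \<bullet> z))\<^sup>2 \<partial>sphere_measure) \<le> C * real N ^ d / real N ^ (2 * s)"
    if N: "N \<ge> 1" "N \<ge> 2 * s" and x: "x \<in> sphere 0 1" for N and x :: "real ^ 'n"
  proof -
    have "(\<integral>z. (1 - x \<bullet> z) ^ s * (poly (kernel N) (x \<bullet> z))\<^sup>2 \<partial>sphere_measure)
      = zonal_integral x ([:1, -1:] ^ s * (kernel N * kernel N))"
      by (simp add: zonal_integral_def poly_power power2_eq_square)
    also have "\<dots> = (\<Sum>l<2 * N. (divdiff (zonal_node d) (filt N) s l)\<^sup>2 * (zonal_nu d s * zonal_val d s l))"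
      unfolding kernel_def
      by (rule zonal_weighted_norm[OF d]) (auto simp: zonal_integral_add zonal_integral_smult
         zonal_integral_zonal[OF card d x] filt_zero[OF N(1)] simp del: zonal.simps)
    also have "\<dots> \<le> (\<Sum>l<2 * N. (C1 / real N ^ (2 * s))\<^sup>2 * (zonal_nu d s * (C2 * real N ^ (d - 1 + 2 * s))))"
    proof (rule sum_mono)
      fix l assume l: "l \<in> {..<2 * N}"
      have "(divdiff (zonal_node d) (filt N) s l)\<^sup>2 \<le> (C1 / real N ^ (2 * s))\<^sup>2"
        using C1(2)[OF N, of l] by (intro power2_le_iff_abs_le[THEN iffD2]) (use C1 in auto)
      then show "(divdiff (zonal_node d) (filt N) s l)\<^sup>2 * (zonal_nu d s * zonal_val d s l)
        \<le> (C1 / real N ^ (2 * s))\<^sup>2 * (zonal_nu d s * (C2 * real N ^ (d - 1 + 2 * s)))"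
        using C2(2)[of l N] l nu zonal_val_pos[OF d, of s l] by (intro mult_mono) auto
    qed
    also have "\<dots> = 2 * real N * ((C1 / real N ^ (2 * s))\<^sup>2 * (zonal_nu d s * (C2 * real N ^ (d - 1 + 2 * s))))" by simp
    also have "\<dots> = C * real N ^ d / real N ^ (2 * s)"
    proof -
      have "real N ^ d = real N ^ (d - 1) * real N" using d by (cases d) auto
      then show ?thesis using N unfolding C_def
        by (simp add: power_add power2_eq_square field_simps)
    qed
    finally show ?thesis .
  qed
  moreover have "C > 0" unfolding C_def using C1 C2 nu by simp
  ultimately show thesis using that by blast
qed

text \<open>Integration is pairing with the constant \<open>zonal d 0 0\<close>, so only degree
  \<open>0\<close> survives, where the filter is \<open>1\<close>.\<close>

lemma kernel_integral:
  assumes card: "CARD('n) = d + 1" and N: "N \<ge> 1" and x: "(x :: real ^ 'n) \<in> sphere 0 1"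
  shows "(\<integral>z. poly (kernel N) (x \<bullet> z) \<partial>sphere_measure) = 1"
proof -
  have one: "zonal d 0 0 = 1" using zonal_val_0_0[OF d] by simp
  have "zonal_integral x (kernel N) = (\<Sum>l<2 * N. filt N l * zonal_integral x (zonal d 0 l * zonal d 0 0))"
    unfolding one kernel_def by (simp add: zonal_integral_def poly_sum Bochner_Integration.integral_sum
      integrable_sphere_continuous continuous_poly_inner integrable_mult_right mult.assoc)
  also have "\<dots> = (\<Sum>l<2 * N. if l = 0 then 1 else 0)"
    by (intro sum.cong refl) (simp add: zonal_integral_zonal[OF card d x] zonal_val_0_0[OF d] filt_def del: zonal.simps)
  also have "\<dots> = 1" using N by simp
  finally show ?thesis by (simp add: zonal_integral_def)
qed

lemma kernel_L1_bound:
  assumes card: "CARD('n) = d + 1"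
  obtains C where "C > 0"
    "\<And>N x. N \<ge> 2 * (d div 2 + 1) \<Longrightarrow> (x :: real ^ 'n) \<in> sphere 0 1 \<Longrightarrow>
       (\<integral>z. \<bar>poly (kernel N) (x \<bullet> z)\<bar> \<partial>sphere_measure) \<le> C"
proof -
  define s where "s = d div 2 + 1"
  have s: "s \<le> \<kappa>" "2 * s \<ge> d + 1" using kappa by (auto simp: s_def)
  obtain C0 where C0: "C0 > 0" "\<And>N x. N \<ge> 1 \<Longrightarrow> N \<ge> 2 * 0 \<Longrightarrow> (x :: real ^ 'n) \<in> sphere 0 1 \<Longrightarrow>
       (\<integral>z. (1 - x \<bullet> z) ^ 0 * (poly (kernel N) (x \<bullet> z))\<^sup>2 \<partial>sphere_measure) \<le> C0 * real N ^ d / real N ^ (2 * 0)"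
    using weighted_kernel_norm[OF card, of 0] by blast
  obtain C1 where C1: "C1 > 0" "\<And>N x. N \<ge> 1 \<Longrightarrow> N \<ge> 2 * s \<Longrightarrow> (x :: real ^ 'n) \<in> sphere 0 1 \<Longrightarrow>
       (\<integral>z. (1 - x \<bullet> z) ^ s * (poly (kernel N) (x \<bullet> z))\<^sup>2 \<partial>sphere_measure) \<le> C1 * real N ^ d / real N ^ (2 * s)"
    using weighted_kernel_norm[OF card s(1)] by blast
  obtain C2 where C2: "C2 > 0" "\<And>N x. N \<ge> 1 \<Longrightarrow> (x :: real ^ 'n) \<in> sphere 0 1 \<Longrightarrow>
       (\<integral>z. 1 / (1 + ((real N)\<^sup>2 * (1 - x \<bullet> z)) ^ s) \<partial>sphere_measure) \<le> C2 / real N ^ d"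
    using inverse_weight_integral[OF card d s(2)] by blast
  have "(\<integral>z. \<bar>poly (kernel N) (x \<bullet> z)\<bar> \<partial>sphere_measure) \<le> C0 + C1 + C2"
    if N: "N \<ge> 2 * (d div 2 + 1)" and x: "x \<in> sphere 0 1" for N and x :: "real ^ 'n"
  proof -
    have N1: "N \<ge> 1" "N \<ge> 2 * s" using N by (auto simp: s_def)
    define K where "K z = poly (kernel N) (x \<bullet> z)" for z
    define w where "w z = 1 + ((real N)\<^sup>2 * (1 - x \<bullet> z)) ^ s" for z
    have w1: "w z \<ge> 1" if "z \<in> sphere 0 1" for z
      using sphere_inner_bound[OF x that] by (auto simp: w_def intro!: mult_nonneg_nonneg)
    have cK: "continuous_on UNIV K" unfolding K_def by (rule continuous_poly_inner)
    have cw: "continuous_on UNIV w" unfolding w_def by (intro continuous_intros)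
    have i1: "integrable sphere_measure (\<lambda>z. (K z)\<^sup>2 * w z)"
      by (intro integrable_sphere_continuous continuous_intros cK cw)
    have i2: "integrable sphere_measure (\<lambda>z. 1 / w z)"
    proof (rule sph.integrable_const_bound[where B = 1])
      show "AE z in sphere_measure. norm (1 / w z) \<le> 1"
      proof (rule AE_I2)
        fix z :: "real ^ 'n" assume "z \<in> space sphere_measure"
        then have "w z \<ge> 1" using w1 by simp
        then show "norm (1 / w z) \<le> 1" by simp
      qed
      have [measurable]: "w \<in> borel_measurable borel" by (rule borel_measurable_continuous_onI[OF cw])
      show "(\<lambda>z. 1 / w z) \<in> borel_measurable sphere_measure" by (rule measurable_sphere_measureI) measurable
    qed
    have pw: "\<bar>K z\<bar> \<le> (K z)\<^sup>2 * w z / real N ^ d + real N ^ d * (1 / w z)" if "z \<in> sphere 0 1" for z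
    proof -
      \<comment> \<open>The balance point of
        \<open>2 \<bar>K\<bar> a \<le> K\<^sup>2 + a\<^sup>2\<close>: the integral of
        \<open>K\<^sup>2 w\<close> is of order \<open>N ^ d\<close> and that of \<open>1 / w\<close>
        of order \<open>N ^ (- d)\<close>.\<close>
      define a where "a = real N ^ d / w z"
      have a: "a > 0" using w1[OF that] N1 by (simp add: a_def)
      have "0 \<le> (\<bar>K z\<bar> - a)\<^sup>2" by simp
      then have "2 * \<bar>K z\<bar> * a \<le> (K z)\<^sup>2 + a\<^sup>2" by (simp add: power2_diff algebra_simps)
      then have "2 * \<bar>K z\<bar> \<le> ((K z)\<^sup>2 + a\<^sup>2) / a" using a by (simp add: pos_le_divide_eq)
      also have "\<dots> = (K z)\<^sup>2 / a + a" using a by (simp add: add_divide_distrib power2_eq_square)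
      finally have "\<bar>K z\<bar> \<le> (K z)\<^sup>2 / a + a" using abs_ge_zero[of "K z"] by linarith
      then show ?thesis by (simp add: a_def)
    qed
    have "(\<integral>z. \<bar>K z\<bar> \<partial>sphere_measure) \<le> (\<integral>z. (K z)\<^sup>2 * w z / real N ^ d + real N ^ d * (1 / w z) \<partial>sphere_measure)"
      using pw by (intro integral_mono integrable_sphere_continuous continuous_intros cK
        Bochner_Integration.integrable_add integrable_divide integrable_mult_right i1 i2) auto
    also have "\<dots> = (\<integral>z. (K z)\<^sup>2 * w z \<partial>sphere_measure) / real N ^ d + real N ^ d * (\<integral>z. 1 / w z \<partial>sphere_measure)"
      by (subst Bochner_Integration.integral_add) (auto intro!: integrable_divide integrable_mult_right i1 i2 simp del: mult_1_right times_divide_eq_right)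
    also have "(\<integral>z. (K z)\<^sup>2 * w z \<partial>sphere_measure) = (\<integral>z. (1 - x \<bullet> z) ^ 0 * (K z)\<^sup>2 + (real N ^ (2 * s)) * ((1 - x \<bullet> z) ^ s * (K z)\<^sup>2) \<partial>sphere_measure)"
      by (intro Bochner_Integration.integral_cong refl) (simp only: w_def power_mult_distrib power_mult power_0, simp add: distrib_left mult_ac)
    also have "\<dots> = (\<integral>z. (1 - x \<bullet> z) ^ 0 * (K z)\<^sup>2 \<partial>sphere_measure) + (real N ^ (2 * s)) * (\<integral>z. (1 - x \<bullet> z) ^ s * (K z)\<^sup>2 \<partial>sphere_measure)"
      by (subst Bochner_Integration.integral_add) (auto intro!: integrable_mult_right integrable_sphere_continuous continuous_intros cK)
    also have "\<dots> \<le> C0 * real N ^ d + real N ^ (2 * s) * (C1 * real N ^ d / real N ^ (2 * s))"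
      using C0(2)[OF N1(1) _ x] C1(2)[OF N1 x] by (intro add_mono mult_left_mono) (auto simp: K_def)
    also have "\<dots> = (C0 + C1) * real N ^ d" using N1 by (simp add: algebra_simps)
    also have "(\<integral>z. 1 / w z \<partial>sphere_measure) \<le> C2 / real N ^ d"
      using C2(2)[OF N1(1) x] by (simp add: w_def)
    finally have "(\<integral>z. \<bar>K z\<bar> \<partial>sphere_measure) \<le> (C0 + C1) * real N ^ d / real N ^ d + real N ^ d * (C2 / real N ^ d)"
      by (simp add: divide_right_mono mult_left_mono)
    then show ?thesis using N1 by (simp add: K_def)
  qed
  then show thesis using that[of "C0 + C1 + C2"] C0 C1 C2 by simp
qed

text \<open>Away from the diagonal the weight is at least \<open>\<delta> ^ s\<close>, so the square
  norm there is of order \<open>N ^ d / N ^ (2 * s)\<close>, hence at most of order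
  \<open>1 / N\<close>. In \<open>\<bar>K\<bar> \<le> \<alpha> K\<^sup>2 + 1 / \<alpha>\<close> the
  choice \<open>\<alpha> = 2 / \<epsilon>\<close> leaves half of \<open>\<epsilon>\<close> to each
  term.\<close>

lemma kernel_tail:
  assumes card: "CARD('n) = d + 1" and delta: "\<delta> > 0" and eps: "\<epsilon> > 0"
  obtains N0 where
    "\<And>N x. N \<ge> N0 \<Longrightarrow> (x :: real ^ 'n) \<in> sphere 0 1 \<Longrightarrow>
       (\<integral>z. \<bar>poly (kernel N) (x \<bullet> z)\<bar> * indicator {z. 1 - x \<bullet> z \<ge> \<delta>} z \<partial>sphere_measure) \<le> \<epsilon>"
proof -
  define s where "s = d div 2 + 1"
  have s: "s \<le> \<kappa>" "2 * s \<ge> d + 1" using kappa by (auto simp: s_def)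
  obtain C1 where C1: "C1 > 0" "\<And>N x. N \<ge> 1 \<Longrightarrow> N \<ge> 2 * s \<Longrightarrow> (x :: real ^ 'n) \<in> sphere 0 1 \<Longrightarrow>
       (\<integral>z. (1 - x \<bullet> z) ^ s * (poly (kernel N) (x \<bullet> z))\<^sup>2 \<partial>sphere_measure) \<le> C1 * real N ^ d / real N ^ (2 * s)"
    using weighted_kernel_norm[OF card s(1)] by blast
  define \<alpha> where "\<alpha> = 2 / \<epsilon>"
  have alpha: "\<alpha> > 0" using eps by (simp add: \<alpha>_def)
  obtain N1 where N1: "2 * \<alpha> * C1 / (\<epsilon> * \<delta> ^ s) \<le> real N1" using real_arch_simple by blast
  define N0 where "N0 = max (max 1 (2 * s)) N1"
  have "(\<integral>z. \<bar>poly (kernel N) (x \<bullet> z)\<bar> * indicator {z. 1 - x \<bullet> z \<ge> \<delta>} z \<partial>sphere_measure) \<le> \<epsilon>"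
    if N: "N \<ge> N0" and x: "x \<in> sphere 0 1" for N and x :: "real ^ 'n"
  proof -
    define K where "K z = poly (kernel N) (x \<bullet> z)" for z
    have cK: "continuous_on UNIV K" unfolding K_def by (rule continuous_poly_inner)
    define A where "A = {z. 1 - x \<bullet> z \<ge> \<delta>}"
    have NN: "N \<ge> 1" "N \<ge> 2 * s" "real N \<ge> real N1" using N by (auto simp: N0_def)
    have pw: "\<bar>K z\<bar> * indicator A z \<le> \<alpha> / \<delta> ^ s * ((1 - x \<bullet> z) ^ s * (K z)\<^sup>2) + 1 / \<alpha>" if z: "z \<in> sphere 0 1" for z
    proof (cases "z \<in> A")
      case False
      then show ?thesis using sphere_inner_bound[OF x z] alpha delta by (auto intro!: add_nonneg_nonneg mult_nonneg_nonneg)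
    next
      case True
      then have "\<delta> ^ s \<le> (1 - x \<bullet> z) ^ s" using delta by (intro power_mono) (auto simp: A_def)
      then have "(K z)\<^sup>2 * \<delta> ^ s \<le> (1 - x \<bullet> z) ^ s * (K z)\<^sup>2" using mult_right_mono[of "\<delta> ^ s" "(1 - x \<bullet> z) ^ s" "(K z)\<^sup>2"] by (simp add: mult.commute)
      then have 1: "(K z)\<^sup>2 \<le> (1 - x \<bullet> z) ^ s * (K z)\<^sup>2 / \<delta> ^ s" using delta by (simp add: pos_le_divide_eq)
      have "0 \<le> (\<alpha> * \<bar>K z\<bar> - 1)\<^sup>2" by simp
      then have "2 * \<bar>K z\<bar> * \<alpha> \<le> \<alpha>\<^sup>2 * (K z)\<^sup>2 + 1" by (simp add: power2_diff power_mult_distrib algebra_simps)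
      then have "2 * \<bar>K z\<bar> \<le> (\<alpha>\<^sup>2 * (K z)\<^sup>2 + 1) / \<alpha>" using alpha by (simp add: pos_le_divide_eq)
      also have "\<dots> = \<alpha> * (K z)\<^sup>2 + 1 / \<alpha>" using alpha by (simp add: add_divide_distrib power2_eq_square)
      finally have "\<bar>K z\<bar> \<le> \<alpha> * (K z)\<^sup>2 + 1 / \<alpha>" using abs_ge_zero[of "K z"] by linarith
      also have "\<dots> \<le> \<alpha> * ((1 - x \<bullet> z) ^ s * (K z)\<^sup>2 / \<delta> ^ s) + 1 / \<alpha>"
        using 1 alpha by (intro add_right_mono mult_left_mono) auto
      finally show ?thesis using True by (simp add: mult_ac)
    qed
    have "(\<integral>z. \<bar>K z\<bar> * indicator A z \<partial>sphere_measure) \<le> (\<integral>z. \<alpha> / \<delta> ^ s * ((1 - x \<bullet> z) ^ s * (K z)\<^sup>2) + 1 / \<alpha> \<partial>sphere_measure)"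
    proof (rule integral_mono_AE')
      show "integrable sphere_measure (\<lambda>z. \<alpha> / \<delta> ^ s * ((1 - x \<bullet> z) ^ s * (K z)\<^sup>2) + 1 / \<alpha>)"
        by (intro integrable_sphere_continuous continuous_intros cK)
      show "AE z in sphere_measure. \<bar>K z\<bar> * indicator A z \<le> \<alpha> / \<delta> ^ s * ((1 - x \<bullet> z) ^ s * (K z)\<^sup>2) + 1 / \<alpha>"
        by (intro AE_I2 pw) simp
      then show "AE z in sphere_measure. 0 \<le> \<alpha> / \<delta> ^ s * ((1 - x \<bullet> z) ^ s * (K z)\<^sup>2) + 1 / \<alpha>"
        by eventually_elim (erule order_trans[rotated], simp)
    qed
    also have "\<dots> = \<alpha> / \<delta> ^ s * (\<integral>z. (1 - x \<bullet> z) ^ s * (K z)\<^sup>2 \<partial>sphere_measure) + 1 / \<alpha>"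
    proof -
      have i: "integrable sphere_measure (\<lambda>z. (1 - x \<bullet> z) ^ s * (K z)\<^sup>2)"
        by (intro integrable_sphere_continuous continuous_intros cK)
      have "(\<integral>z. 1 / \<alpha> \<partial>(sphere_measure :: (real^'n) measure)) = 1 / \<alpha>"
        by (simp add: lebesgue_integral_const prob_space.prob_space[OF prob_space_sphere_measure, simplified])
      then show ?thesis
        using Bochner_Integration.integral_add[OF integrable_mult_right[OF i, of "\<alpha> / \<delta> ^ s"] sph.integrable_const[of "1 / \<alpha>"]] by simp
    qed
    also have "\<dots> \<le> \<alpha> / \<delta> ^ s * (C1 / real N) + 1 / \<alpha>"
    proof (intro add_right_mono mult_left_mono)
      have "(\<integral>z. (1 - x \<bullet> z) ^ s * (K z)\<^sup>2 \<partial>sphere_measure) \<le> C1 * real N ^ d / real N ^ (2 * s)"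
        using C1(2)[OF NN(1,2) x] by (simp add: K_def)
      also have "\<dots> \<le> C1 / real N"
      proof -
        have "real N ^ d * real N \<le> real N ^ (2 * s)"
          using s NN power_increasing[of "Suc d" "2 * s" "real N"] by (simp add: mult.commute)
        then show ?thesis using NN C1 by (simp add: field_simps)
      qed
      finally show "(\<integral>z. (1 - x \<bullet> z) ^ s * (K z)\<^sup>2 \<partial>sphere_measure) \<le> C1 / real N" .
    qed (use alpha delta in auto)
    also have "\<alpha> / \<delta> ^ s * (C1 / real N) \<le> \<epsilon> / 2"
    proof -
      have "2 * \<alpha> * C1 / (\<epsilon> * \<delta> ^ s) \<le> real N" using N1 NN by linarith
      then show ?thesis using NN eps delta by (simp add: field_simps)
    qed
    also have "\<epsilon> / 2 + 1 / \<alpha> = \<epsilon>" using eps by (simp add: \<alpha>_def)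
    finally show ?thesis by (simp add: K_def A_def)
  qed
  then show thesis using that by blast
qed

end

section \<open>Approximate identity and reproducing property\<close>

lemma measurable_sphere_measure_iff:
  "f \<in> borel_measurable sphere_measure \<longleftrightarrow> f \<in> borel_measurable (restrict_space borel (sphere 0 1))"
  by (rule measurable_cong_sets[THEN eqset_imp_iff]) (simp_all add: sets_sphere_measure)

lemma measurable_sphere_continuous:
  "continuous_on (sphere 0 1) f \<Longrightarrow> f \<in> borel_measurable sphere_measure"
  unfolding measurable_sphere_measure_iff by (rule borel_measurable_continuous_on_restrict)

lemma integrable_mult_zonal:
  fixes f :: "real ^ 'n \<Rightarrow> real"
  assumes f: "integrable sphere_measure f"
  shows "integrable sphere_measure (\<lambda>z. poly p (x \<bullet> z) * f z)"
proof -
  have "continuous_on (sphere 0 1) (\<lambda>z. poly p (x \<bullet> z))" by (intro continuous_intros)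
  then obtain B where B: "\<And>z. z \<in> sphere 0 1 \<Longrightarrow> \<bar>poly p (x \<bullet> z)\<bar> \<le> B"
    using compact_continuous_image[of "sphere 0 1" "\<lambda>z. poly p (x \<bullet> z)"]
    by (metis bounded_iff compact_imp_bounded compact_sphere imageI real_norm_def)
  show ?thesis
  proof (rule Bochner_Integration.integrable_bound[where f = "\<lambda>z. B * f z"])
    show "integrable sphere_measure (\<lambda>z. B * f z)" using f by simp
    show "(\<lambda>z. poly p (x \<bullet> z) * f z) \<in> borel_measurable sphere_measure"
      using f by (intro borel_measurable_times[OF measurable_sphere_measureI[OF
        borel_measurable_continuous_onI[OF continuous_poly_inner]]]) auto
    show "AE z in sphere_measure. norm (poly p (x \<bullet> z) * f z) \<le> norm (B * f z)"
    proof (rule AE_I2)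
      fix z :: "real ^ 'n" assume "z \<in> space sphere_measure"
      then have "\<bar>poly p (x \<bullet> z)\<bar> \<le> \<bar>B\<bar>" using B[of z] by simp
      then show "norm (poly p (x \<bullet> z) * f z) \<le> norm (B * f z)" by (simp add: abs_mult mult_right_mono)
    qed
  qed
qed

lemma dist_sphere: "x \<in> sphere 0 1 \<Longrightarrow> z \<in> sphere 0 1 \<Longrightarrow> (dist z x)\<^sup>2 = 2 * (1 - x \<bullet> z)"
  for x z :: "real ^ 'n"
  using power2_norm_eq_inner[of x] power2_norm_eq_inner[of z]
  by (simp add: dist_norm power2_norm_eq_inner[of "z - x"] inner_diff_left inner_diff_right inner_commute[of z x])

context zonal_filter
begin

text \<open>The kernel need not be positive: near the diagonal its \<open>L\<^sub>1\<close> bound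
  multiplies the oscillation of \<open>f\<close>, and elsewhere the tail multiplies the bound
  \<open>2 * B'\<close> for the difference of two values.\<close>

lemma kernel_approx_identity:
  fixes f :: "real ^ 'n \<Rightarrow> real"
  assumes card: "CARD('n) = d + 1" and f: "continuous_on (sphere 0 1) f" and eps: "\<epsilon> > 0"
  obtains N0 where "\<And>N x. N \<ge> N0 \<Longrightarrow> x \<in> sphere 0 1 \<Longrightarrow>
       \<bar>(\<integral>z. poly (kernel N) (x \<bullet> z) * f z \<partial>sphere_measure) - f x\<bar> \<le> \<epsilon>"
proof -
  obtain C where C: "C > 0" "\<And>N x. N \<ge> 2 * (d div 2 + 1) \<Longrightarrow> (x :: real ^ 'n) \<in> sphere 0 1 \<Longrightarrow>
       (\<integral>z. \<bar>poly (kernel N) (x \<bullet> z)\<bar> \<partial>sphere_measure) \<le> C"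
    using kernel_L1_bound[OF card] by blast
  obtain B where B: "\<And>z. z \<in> sphere 0 1 \<Longrightarrow> \<bar>f z\<bar> \<le> B"
    using compact_continuous_image[OF f compact_sphere]
    by (metis bounded_iff compact_imp_bounded imageI real_norm_def)
  define B' where "B' = \<bar>B\<bar> + 1"
  have B': "\<bar>f z\<bar> \<le> B'" if "z \<in> sphere 0 1" for z
    using B[OF that] by (auto simp: B'_def)
  have B'0: "B' > 0" by (simp add: B'_def)
  have e2: "\<epsilon> / (2 * C) > 0" using eps C(1) by simp
  have "uniformly_continuous_on (sphere 0 1) f"
    by (rule compact_uniformly_continuous[OF f compact_sphere])
  then obtain \<eta> where eta: "\<eta> > 0" "\<And>x z. x \<in> sphere 0 1 \<Longrightarrow> z \<in> sphere 0 1 \<Longrightarrow> dist z x < \<eta> \<Longrightarrow> dist (f z) (f x) < \<epsilon> / (2 * C)"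
    using e2 unfolding uniformly_continuous_on_def by blast
  \<comment> \<open>By \<open>dist_sphere\<close> the condition
    \<open>1 - x \<bullet> z < \<delta>\<close> says that the distance is below
    \<open>\<eta>\<close>.\<close>
  define \<delta> where "\<delta> = \<eta>\<^sup>2 / 2"
  have delta: "\<delta> > 0" using eta by (simp add: \<delta>_def)
  have e4: "\<epsilon> / (4 * B') > 0" using eps B'0 by simp
  obtain N1 where N1: "\<And>N x. N \<ge> N1 \<Longrightarrow> (x :: real ^ 'n) \<in> sphere 0 1 \<Longrightarrow>
       (\<integral>z. \<bar>poly (kernel N) (x \<bullet> z)\<bar> * indicator {z. 1 - x \<bullet> z \<ge> \<delta>} z \<partial>sphere_measure) \<le> \<epsilon> / (4 * B')"
    using kernel_tail[OF card delta e4] by blast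
  have "\<bar>(\<integral>z. poly (kernel N) (x \<bullet> z) * f z \<partial>sphere_measure) - f x\<bar> \<le> \<epsilon>"
    if N: "N \<ge> max N1 (2 * (d div 2 + 1))" and x: "x \<in> sphere 0 1" for N x
  proof -
    have N1': "N \<ge> 1" using N by auto
    define K where "K z = poly (kernel N) (x \<bullet> z)" for z
    have cK: "continuous_on UNIV K" unfolding K_def by (rule continuous_poly_inner)
    have fi: "integrable sphere_measure f"
      using B by (intro sph.integrable_const_bound[where B = B] AE_I2 measurable_sphere_continuous f) auto
    have Kf: "integrable sphere_measure (\<lambda>z. K z * f z)" unfolding K_def by (rule integrable_mult_zonal[OF fi])
    have Kfx: "integrable sphere_measure (\<lambda>z. K z * f x)" by (intro integrable_mult_left integrable_sphere_continuous cK)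
    define A where "A = {z. 1 - x \<bullet> z \<ge> \<delta>}"
    have [measurable]: "A \<in> sets borel" unfolding A_def by (intro borel_closed closed_Collect_le continuous_intros)
    have Ki: "integrable sphere_measure (\<lambda>z. \<bar>K z\<bar>)" by (intro integrable_sphere_continuous continuous_intros cK)
    have KAi: "integrable sphere_measure (\<lambda>z. \<bar>K z\<bar> * indicator A z)"
    proof (rule Bochner_Integration.integrable_bound[OF Ki])
      have [measurable]: "K \<in> borel_measurable borel" by (rule borel_measurable_continuous_onI[OF cK])
      show "(\<lambda>z. \<bar>K z\<bar> * indicator A z) \<in> borel_measurable sphere_measure" by (rule measurable_sphere_measureI) measurable
    qed (auto simp: indicator_def)
    have "(\<integral>z. K z * f z \<partial>sphere_measure) - f x = (\<integral>z. K z * f z \<partial>sphere_measure) - (\<integral>z. K z * f x \<partial>sphere_measure)"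
      using kernel_integral[OF card N1' x] by (simp add: K_def)
    also have "\<dots> = (\<integral>z. K z * f z - K z * f x \<partial>sphere_measure)"
      by (rule Bochner_Integration.integral_diff[OF Kf Kfx, symmetric])
    finally have "\<bar>(\<integral>z. K z * f z \<partial>sphere_measure) - f x\<bar> \<le> (\<integral>z. \<bar>K z * f z - K z * f x\<bar> \<partial>sphere_measure)"
      using integral_abs_bound by metis
    also have "\<dots> \<le> (\<integral>z. \<epsilon> / (2 * C) * \<bar>K z\<bar> + 2 * B' * (\<bar>K z\<bar> * indicator A z) \<partial>sphere_measure)"
    proof (rule integral_mono)
      show "integrable sphere_measure (\<lambda>z. \<bar>K z * f z - K z * f x\<bar>)" using Kf Kfx by auto
      show "integrable sphere_measure (\<lambda>z. \<epsilon> / (2 * C) * \<bar>K z\<bar> + 2 * B' * (\<bar>K z\<bar> * indicator A z))"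
        by (intro Bochner_Integration.integrable_add integrable_mult_right Ki KAi)
      fix z :: "real ^ 'n" assume "z \<in> space sphere_measure"
      then have z: "z \<in> sphere 0 1" by simp
      have "\<bar>f z - f x\<bar> \<le> \<epsilon> / (2 * C) + 2 * B' * indicator A z"
      proof (cases "z \<in> A")
        case True
        then show ?thesis using B'[OF z] B'[OF x] eps C(1) by (simp add: add_increasing)
      next
        case False
        then have "(dist z x)\<^sup>2 < \<eta>\<^sup>2" by (simp add: A_def dist_sphere[OF x z] \<delta>_def)
        then have "dist z x < \<eta>" using eta(1) by (simp add: power2_less_imp_less)
        then show ?thesis using eta(2)[OF x z] False by (simp add: dist_real_def)
      qed
      then have "\<bar>K z\<bar> * \<bar>f z - f x\<bar> \<le> \<bar>K z\<bar> * (\<epsilon> / (2 * C) + 2 * B' * indicator A z)"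
        by (rule mult_left_mono) simp
      then show "\<bar>K z * f z - K z * f x\<bar> \<le> \<epsilon> / (2 * C) * \<bar>K z\<bar> + 2 * B' * (\<bar>K z\<bar> * indicator A z)"
        by (simp add: right_diff_distrib[symmetric] abs_mult) (simp add: algebra_simps)
    qed
    also have "\<dots> = \<epsilon> / (2 * C) * (\<integral>z. \<bar>K z\<bar> \<partial>sphere_measure) + 2 * B' * (\<integral>z. \<bar>K z\<bar> * indicator A z \<partial>sphere_measure)"
      by (subst Bochner_Integration.integral_add, intro integrable_mult_right Ki, intro integrable_mult_right KAi)
        (simp only: integral_mult_right_zero)
    also have "\<dots> \<le> \<epsilon> / (2 * C) * C + 2 * B' * (\<epsilon> / (4 * B'))"
      using C(2)[of N x] N1[of N x] N x eps C(1) B'0 by (intro add_mono mult_left_mono) (auto simp: K_def A_def)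
    also have "\<dots> = \<epsilon>" using C(1) B'0 by simp
    finally show ?thesis by (simp add: K_def)
  qed
  then show thesis using that by blast
qed

text \<open>
  The approximate identity \<open>kernel N\<close> is applied to \<open>P\<^sub>m (y \<bullet> _)\<close>; by orthogonality only its component of degree \<open>m\<close>
  contributes.
\<close>
lemma geg_reproducing:
  fixes x y :: "real ^ 'n"
  assumes card: "CARD('n) = d + 1" and x: "x \<in> sphere 0 1" and y: "y \<in> sphere 0 1"
  shows "zonal_val d 0 m * (\<integral>z. poly (geg d m) (x \<bullet> z) * poly (geg d m) (y \<bullet> z) \<partial>sphere_measure) = poly (geg d m) (x \<bullet> y)"
proof -
  define I where "I l = (\<integral>z. poly (geg d l) (x \<bullet> z) * poly (geg d m) (y \<bullet> z) \<partial>sphere_measure)" for l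
  have I0: "I l = 0" if "l \<noteq> m" for l unfolding I_def by (rule geg_orthogonal[OF card d x y that])
  have K: "(\<integral>z. poly (kernel N) (x \<bullet> z) * poly (geg d m) (y \<bullet> z) \<partial>sphere_measure) = zonal_val d 0 m * I m"
    if N: "N \<ge> Suc m" for N
  proof -
    have "(\<integral>z. poly (kernel N) (x \<bullet> z) * poly (geg d m) (y \<bullet> z) \<partial>sphere_measure) =
      (\<integral>z. (\<Sum>l<2 * N. (filt N l * zonal_val d 0 l) * (poly (geg d l) (x \<bullet> z) * poly (geg d m) (y \<bullet> z))) \<partial>sphere_measure)"
      by (intro Bochner_Integration.integral_cong refl) (simp add: kernel_def poly_sum sum_distrib_right sum_distrib_left mult_ac)
    also have "\<dots> = (\<Sum>l<2 * N. (filt N l * zonal_val d 0 l) * I l)"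
      unfolding I_def
      by (subst Bochner_Integration.integral_sum)
        (auto intro!: integrable_mult_right integrable_sphere_continuous continuous_intros)
    also have "\<dots> = (\<Sum>l\<in>{m}. (filt N l * zonal_val d 0 l) * I l)"
      using N by (intro sum.mono_neutral_right) (auto simp: I0)
    finally show ?thesis using N by (simp add: filt_def)
  qed
  have "\<bar>zonal_val d 0 m * I m - poly (geg d m) (x \<bullet> y)\<bar> \<le> 0 + \<epsilon>" if e: "\<epsilon> > 0" for \<epsilon>
  proof -
    have c: "continuous_on (sphere 0 1) (\<lambda>z. poly (geg d m) (y \<bullet> z))" by (intro continuous_intros)
    obtain N0 where "\<And>N x. N \<ge> N0 \<Longrightarrow> x \<in> sphere 0 1 \<Longrightarrow>
       \<bar>(\<integral>z. poly (kernel N) (x \<bullet> z) * poly (geg d m) (y \<bullet> z) \<partial>sphere_measure) - poly (geg d m) (y \<bullet> x)\<bar> \<le> \<epsilon>"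
      using kernel_approx_identity[OF card c e] by blast
    from this[of "max N0 (Suc m)" x] show ?thesis using x by (simp add: K inner_commute[of y x])
  qed
  then have "\<bar>zonal_val d 0 m * I m - poly (geg d m) (x \<bullet> y)\<bar> \<le> 0" by (rule field_le_epsilon)
  then show ?thesis by (simp add: I_def)
qed

section \<open>Needlet bands and their telescoping sum\<close>

definition needlet_poly :: "nat \<Rightarrow> real poly" where
  "needlet_poly j = (\<Sum>l<2 ^ j. smult (h (real l / 2 ^ (j - 1))) (zonal d 0 l))"

definition band_poly :: "nat \<Rightarrow> real poly" where
  "band_poly j = (\<Sum>l<2 ^ j. smult ((h (real l / 2 ^ (j - 1)))\<^sup>2) (zonal d 0 l))"

lemma needlet_eq:
  assumes j: "j \<ge> 1"
  shows "needlet d h w \<xi> j k x = sqrt (w j k) * poly (needlet_poly j) (x \<bullet> \<xi> j k)"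
proof -
  have "(\<Sum>l. h (real l / 2 ^ (j - 1)) * harmonic_dim d l * gegenbauer d l (x \<bullet> \<xi> j k))
     = (\<Sum>l<2 ^ j. h (real l / 2 ^ (j - 1)) * harmonic_dim d l * gegenbauer d l (x \<bullet> \<xi> j k))"
  proof (rule suminf_finite)
    fix l :: nat assume "l \<notin> {..<2 ^ j}"
    then have "2 ^ j \<le> l" by simp
    then have "(2::real) ^ j \<le> real l" by (metis of_nat_le_iff of_nat_numeral of_nat_power)
    moreover have "(2::real) ^ j = 2 * 2 ^ (j - 1)" using j by (cases j) auto
    ultimately have "h (real l / 2 ^ (j - 1)) = 0" by (intro h_zero) (auto simp: field_simps)
    then show "h (real l / 2 ^ (j - 1)) * harmonic_dim d l * gegenbauer d l (x \<bullet> \<xi> j k) = 0" by simp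
  qed simp
  also have "\<dots> = poly (needlet_poly j) (x \<bullet> \<xi> j k)"
    by (simp add: needlet_poly_def poly_sum harmonic_dim_eq[OF d] gegenbauer_eq_geg[OF d] mult_ac)
  finally show ?thesis using j by (simp add: needlet_def)
qed

text \<open>Convolution of zonal polynomials multiplies their coefficients degree by degree, hence
  the square of the filter.\<close>

lemma needlet_poly_reproducing:
  fixes x y :: "real ^ 'n"
  assumes card: "CARD('n) = d + 1" and x: "x \<in> sphere 0 1" and y: "y \<in> sphere 0 1"
  shows "(\<integral>z. poly (needlet_poly j) (x \<bullet> z) * poly (needlet_poly j) (y \<bullet> z) \<partial>sphere_measure) = poly (band_poly j) (x \<bullet> y)"
proof -
  define c where "c l = h (real l / 2 ^ (j - 1))" for l
  define I where "I l m = (\<integral>z. poly (geg d l) (x \<bullet> z) * poly (geg d m) (y \<bullet> z) \<partial>sphere_measure)" for l m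
  have I0: "zonal_val d 0 l * I l m = (if l = m then poly (geg d m) (x \<bullet> y) else 0)" for l m
    using geg_orthogonal[OF card d x y, of l m] geg_reproducing[OF card x y, of m] by (auto simp: I_def)
  have "(\<integral>z. poly (needlet_poly j) (x \<bullet> z) * poly (needlet_poly j) (y \<bullet> z) \<partial>sphere_measure) =
    (\<integral>z. (\<Sum>l<2 ^ j. \<Sum>m<2 ^ j. (c l * c m * zonal_val d 0 l * zonal_val d 0 m) * (poly (geg d l) (x \<bullet> z) * poly (geg d m) (y \<bullet> z))) \<partial>sphere_measure)"
    unfolding needlet_poly_def poly_sum sum_product c_def
    by (intro Bochner_Integration.integral_cong refl sum.cong) (simp add: mult_ac)
  also have "\<dots> = (\<Sum>l<2 ^ j. \<Sum>m<2 ^ j. (c l * c m * zonal_val d 0 l * zonal_val d 0 m) * I l m)"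
    unfolding I_def
    by (subst Bochner_Integration.integral_sum, (intro Bochner_Integration.integrable_sum integrable_mult_right integrable_sphere_continuous continuous_intros))
      (intro sum.cong refl, subst Bochner_Integration.integral_sum, auto intro!: integrable_mult_right integrable_sphere_continuous continuous_intros)
  also have "\<dots> = (\<Sum>l<2 ^ j. \<Sum>m<2 ^ j. c l * c m * zonal_val d 0 m * (zonal_val d 0 l * I l m))"
    by (intro sum.cong refl) (simp add: mult_ac)
  also have "\<dots> = (\<Sum>l<2 ^ j. (c l)\<^sup>2 * (zonal_val d 0 l * poly (geg d l) (x \<bullet> y)))"
    by (simp only: I0) (simp add: if_distrib power2_eq_square mult_ac cong: if_cong)
  also have "\<dots> = poly (band_poly j) (x \<bullet> y)"
    by (simp add: band_poly_def poly_sum c_def mult.assoc)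
  finally show ?thesis .
qed

text \<open>With \<open>t = l / (2 N)\<close> the filter relation acts in the transition range
  \<open>N < l \<le> 2 N\<close>; below it \<open>h t\<close> vanishes, above it
  \<open>h (2 t)\<close> does.\<close>

lemma filt_double:
  assumes N: "N \<ge> 1"
  shows "filt (2 * N) l = filt N l + (h (real l / real (2 * N)))\<^sup>2"
proof -
  define t where "t = real l / real (2 * N)"
  have t2: "real l / real N = 2 * t" by (simp add: t_def)
  have t0: "t \<ge> 0" by (simp add: t_def)
  consider "l \<le> N" | "N < l" "l \<le> 2 * N" | "l > 2 * N" by linarith
  then show ?thesis
  proof cases
    case 1
    then have "h t = 0" using N by (intro h_zero t0) (simp add: t_def field_simps)
    then show ?thesis using 1 by (simp add: filt_def t_def)
  next
    case 2
    then have "t \<in> {1/2..1}" using N by (auto simp: t_def field_simps)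
    from h_rel[OF this] show ?thesis using 2 by (simp add: filt_def t2) (simp add: t_def)
  next
    case 3
    then have "h (2 * t) = 0" using N t0 by (intro h_zero) (auto simp: t_def field_simps)
    then show ?thesis using 3 by (simp add: filt_def t2) 
  qed
qed

lemma kernel_eq_bands: "1 + (\<Sum>j\<le>J. band_poly (Suc j)) = kernel (2 ^ J)"
proof (induction J)
  case 0
  \<comment> \<open>Band \<open>1\<close> involves the values of the filter at \<open>0\<close> and
    \<open>1\<close> only; the relation at \<open>1/2\<close> shows that it is the full component of
    degree \<open>1\<close>.\<close>
  have "h 0 = 0" by (rule h_zero) auto
  moreover have "(h 1)\<^sup>2 = 1" using h_rel[of "1/2"] h_zero[of "1/2"] by simp
  moreover have "zonal d 0 0 = 1" using zonal_val_0_0[OF d] by simp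
  moreover have "{..<2::nat} = {0, 1}" by auto
  ultimately show ?case by (simp add: band_poly_def kernel_def filt_def del: zonal.simps)
next
  case (Suc J)
  define N where "N = (2::nat) ^ J"
  have N: "N \<ge> 1" by (simp add: N_def)
  have k: "kernel N = (\<Sum>l<2 * (2 * N). smult (filt N l) (zonal d 0 l))"
    unfolding kernel_def using filt_zero[OF N]
    by (intro sum.mono_neutral_left) auto
  have b: "band_poly (Suc (Suc J)) = (\<Sum>l<2 * (2 * N). smult ((h (real l / real (2 * N)))\<^sup>2) (zonal d 0 l))"
    by (simp add: band_poly_def N_def)
  have "kernel (2 ^ Suc J) = kernel (2 * N)" by (simp add: N_def)
  also have "\<dots> = kernel N + band_poly (Suc (Suc J))"
    unfolding k b unfolding kernel_def by (simp only: filt_double[OF N] smult_add_left sum.distrib)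
  finally show ?case using Suc by (simp add: N_def)
qed

end

section \<open>Spherical polynomials and quadrature\<close>

lemma finite_multi_index: "finite {a :: 'n::finite \<Rightarrow> nat. (\<Sum>i\<in>UNIV. a i) \<le> L}"
proof (rule finite_subset)
  show "{a :: 'n \<Rightarrow> nat. (\<Sum>i\<in>UNIV. a i) \<le> L} \<subseteq> PiE UNIV (\<lambda>_. {..L})"
  proof
    fix a :: "'n \<Rightarrow> nat" assume "a \<in> {a. (\<Sum>i\<in>UNIV. a i) \<le> L}"
    then have "a i \<le> L" for i using member_le_sum[of i UNIV a] by simp
    then show "a \<in> PiE UNIV (\<lambda>_. {..L})" by (auto simp: PiE_def Pi_def extensional_def)
  qed
qed (auto intro: finite_PiE)

lemma spherical_polynomial_mono:
  assumes "spherical_polynomial L q" "L \<le> L'"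
  shows "spherical_polynomial L' q"
proof -
  obtain c where c: "\<And>x. x \<in> sphere 0 1 \<Longrightarrow> q x = (\<Sum>a | (\<Sum>i\<in>UNIV. a i) \<le> L. c a * (\<Prod>i\<in>UNIV. (x $ i) ^ a i))"
    using assms(1) unfolding spherical_polynomial_def by blast
  show ?thesis unfolding spherical_polynomial_def
  proof (intro exI[of _ "\<lambda>a. if (\<Sum>i\<in>UNIV. a i) \<le> L then c a else 0"] ballI)
    fix x :: "real ^ 'a" assume "x \<in> sphere 0 1"
    show "q x = (\<Sum>a | (\<Sum>i\<in>UNIV. a i) \<le> L'. (if (\<Sum>i\<in>UNIV. a i) \<le> L then c a else 0) * (\<Prod>i\<in>UNIV. (x $ i) ^ a i))"
      unfolding c[OF \<open>x \<in> sphere 0 1\<close>] using assms(2)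
      by (intro sum.mono_neutral_cong_left finite_multi_index) auto
  qed
qed

lemma spherical_polynomial_add:
  assumes "spherical_polynomial L p" "spherical_polynomial L q"
  shows "spherical_polynomial L (\<lambda>x. p x + q x)"
proof -
  obtain c c' where "\<forall>x\<in>sphere 0 1. p x = (\<Sum>a | (\<Sum>i\<in>UNIV. a i) \<le> L. c a * (\<Prod>i\<in>UNIV. (x $ i) ^ a i))"
    "\<forall>x\<in>sphere 0 1. q x = (\<Sum>a | (\<Sum>i\<in>UNIV. a i) \<le> L. c' a * (\<Prod>i\<in>UNIV. (x $ i) ^ a i))"
    using assms unfolding spherical_polynomial_def by blast
  then show ?thesis unfolding spherical_polynomial_def
    by (intro exI[of _ "\<lambda>a. c a + c' a"]) (auto simp: distrib_right sum.distrib)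
qed

lemma spherical_polynomial_cmult:
  assumes "spherical_polynomial L p"
  shows "spherical_polynomial L (\<lambda>x. r * p x)"
proof -
  obtain c where "\<forall>x\<in>sphere 0 1. p x = (\<Sum>a | (\<Sum>i\<in>UNIV. a i) \<le> L. c a * (\<Prod>i\<in>UNIV. (x $ i) ^ a i))"
    using assms unfolding spherical_polynomial_def by blast
  then show ?thesis unfolding spherical_polynomial_def
    by (intro exI[of _ "\<lambda>a. r * c a"]) (auto simp: sum_distrib_left mult_ac)
qed

lemma spherical_polynomial_const: "spherical_polynomial L (\<lambda>_. r)"
  unfolding spherical_polynomial_def
proof (intro exI[of _ "\<lambda>a. if a = (\<lambda>_. 0) then r else 0"] ballI)
  fix x :: "real ^ 'n"
  have "(\<Sum>a | (\<Sum>i\<in>UNIV. a i) \<le> L. (if a = (\<lambda>_. 0) then r else 0) * (\<Prod>i\<in>UNIV. (x $ i) ^ a i))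
    = (\<Sum>a\<in>{\<lambda>_. 0}. (if a = (\<lambda>_. 0) then r else 0) * (\<Prod>i\<in>UNIV. (x $ i) ^ a i))"
    by (intro sum.mono_neutral_right finite_multi_index) auto
  then show "r = (\<Sum>a | (\<Sum>i\<in>UNIV. a i) \<le> L. (if a = (\<lambda>_. 0) then r else 0) * (\<Prod>i\<in>UNIV. (x $ i) ^ a i))"
    by simp
qed

text \<open>Raising the \<open>k\<close>-th exponent is a bijection onto the multi-indices with
  nonzero \<open>k\<close>-th entry; the remaining ones receive coefficient
  \<open>0\<close>.\<close>

lemma spherical_polynomial_coord:
  assumes "spherical_polynomial L p"
  shows "spherical_polynomial (Suc L) (\<lambda>x. x $ k * p x)"
proof -
  obtain c where c: "\<And>x. x \<in> sphere 0 1 \<Longrightarrow> p x = (\<Sum>a | (\<Sum>i\<in>UNIV. a i) \<le> L. c a * (\<Prod>i\<in>UNIV. (x $ i) ^ a i))"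
    using assms unfolding spherical_polynomial_def by blast
  define c' where "c' a = (if a k = 0 then 0 else c (a(k := a k - 1)))" for a
  have upd: "(\<Sum>i\<in>UNIV. (a(k := v)) i) + a k = (\<Sum>i\<in>UNIV. a i) + v" for a :: "'a \<Rightarrow> nat" and v
  proof -
    have "sum (a(k := v)) (UNIV - {k}) = sum a (UNIV - {k})" by (rule sum.cong) auto
    then show ?thesis using sum.remove[of UNIV k "a(k := v)"] sum.remove[of UNIV k a]
      by (simp del: fun_upd_apply) (simp add: fun_upd_same)
  qed
  have updp: "(\<Prod>i\<in>UNIV. (x $ i) ^ (a(k := Suc (a k))) i) = x $ k * (\<Prod>i\<in>UNIV. (x $ i) ^ a i)" for a :: "'a \<Rightarrow> nat" and x :: "real ^ 'a"
  proof -
    have "(\<Prod>i\<in>UNIV - {k}. (x $ i) ^ (a(k := Suc (a k))) i) = (\<Prod>i\<in>UNIV - {k}. (x $ i) ^ a i)"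
      by (rule prod.cong) auto
    then show ?thesis
      using prod.remove[of UNIV k "\<lambda>i. (x $ i) ^ (a(k := Suc (a k))) i"] prod.remove[of UNIV k "\<lambda>i. (x $ i) ^ a i"]
      by (simp del: fun_upd_apply) (simp add: fun_upd_same)
  qed
  show ?thesis unfolding spherical_polynomial_def
  proof (intro exI[of _ c'] ballI)
    fix x :: "real ^ 'a" assume x: "x \<in> sphere 0 1"
    have "x $ k * p x = (\<Sum>a | (\<Sum>i\<in>UNIV. a i) \<le> L. c a * (\<Prod>i\<in>UNIV. (x $ i) ^ (a(k := Suc (a k))) i))"
      unfolding c[OF x] updp sum_distrib_left by (simp only: mult_ac)
    also have "\<dots> = (\<Sum>b | (\<Sum>i\<in>UNIV. b i) \<le> Suc L \<and> b k \<noteq> 0. c' b * (\<Prod>i\<in>UNIV. (x $ i) ^ b i))"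
    proof (rule sum.reindex_bij_witness[of _ "\<lambda>b. b(k := b k - 1)" "\<lambda>a. a(k := Suc (a k))"])
      fix a :: "'a \<Rightarrow> nat" assume a: "a \<in> {a. (\<Sum>i\<in>UNIV. a i) \<le> L}"
      show "(a(k := Suc (a k)))(k := (a(k := Suc (a k))) k - 1) = a" by simp
      show "a(k := Suc (a k)) \<in> {b. (\<Sum>i\<in>UNIV. b i) \<le> Suc L \<and> b k \<noteq> 0}"
        using a upd[of a "Suc (a k)"] by simp
      show "c' (a(k := Suc (a k))) * (\<Prod>i\<in>UNIV. (x $ i) ^ (a(k := Suc (a k))) i) = c a * (\<Prod>i\<in>UNIV. (x $ i) ^ (a(k := Suc (a k))) i)"
        by (simp add: c'_def)
    next
      fix b :: "'a \<Rightarrow> nat" assume b: "b \<in> {b. (\<Sum>i\<in>UNIV. b i) \<le> Suc L \<and> b k \<noteq> 0}"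
      then show "(b(k := b k - 1))(k := Suc ((b(k := b k - 1)) k)) = b" by (auto simp: fun_eq_iff)
      show "b(k := b k - 1) \<in> {a. (\<Sum>i\<in>UNIV. a i) \<le> L}"
        using b upd[of b "b k - 1"] by auto
    qed
    also have "\<dots> = (\<Sum>b | (\<Sum>i\<in>UNIV. b i) \<le> Suc L. c' b * (\<Prod>i\<in>UNIV. (x $ i) ^ b i))"
      by (intro sum.mono_neutral_left finite_multi_index) (auto simp: c'_def)
    finally show "x $ k * p x = \<dots>" .
  qed
qed

lemma spherical_polynomial_sum:
  "(\<And>i. i \<in> I \<Longrightarrow> spherical_polynomial L (p i)) \<Longrightarrow> spherical_polynomial L (\<lambda>x. \<Sum>i\<in>I. p i x)"
  by (induction I rule: infinite_finite_induct)
    (auto intro: spherical_polynomial_const spherical_polynomial_add)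

text \<open>The factor \<open>q\<close> is carried along so that zonal polynomials with different
  centres can be multiplied by iteration. In Horner's form each degree of \<open>p\<close> costs one
  coordinate factor.\<close>

lemma spherical_polynomial_zonal:
  assumes "spherical_polynomial L q" "degree p \<le> n"
  shows "spherical_polynomial (L + n) (\<lambda>z. poly p (x \<bullet> z) * q z)"
  using assms(2)
proof (induction p arbitrary: n rule: pCons_induct)
  case 0
  then show ?case by (simp add: spherical_polynomial_const)
next
  case (pCons a p)
  have 1: "spherical_polynomial (L + n) (\<lambda>z. a * q z)"
    by (rule spherical_polynomial_mono[OF spherical_polynomial_cmult[OF assms(1)]]) simp
  show ?case
  proof (cases "p = 0")
    case True
    then show ?thesis using 1 by simp
  next
    case False
    then obtain n' where n: "n = Suc n'" "degree p \<le> n'" using pCons.prems by (cases n) auto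
    have "spherical_polynomial (Suc (L + n')) (\<lambda>z. \<Sum>i\<in>UNIV. x $ i * (z $ i * (poly p (x \<bullet> z) * q z)))"
      by (intro spherical_polynomial_sum spherical_polynomial_cmult spherical_polynomial_coord pCons.IH n(2))
    then have "spherical_polynomial (L + n) (\<lambda>z. a * q z + (\<Sum>i\<in>UNIV. x $ i * (z $ i * (poly p (x \<bullet> z) * q z))))"
      using 1 n(1) by (intro spherical_polynomial_add) simp_all
    also have "(\<lambda>z. a * q z + (\<Sum>i\<in>UNIV. x $ i * (z $ i * (poly p (x \<bullet> z) * q z)))) = (\<lambda>z. poly (pCons a p) (x \<bullet> z) * q z)"
      by (intro ext) (simp add: inner_vec_def sum_distrib_right sum_distrib_left algebra_simps)
    finally show ?thesis .
  qed
qed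

section \<open>Needlet sums as convolution with the kernel\<close>

locale needlet_system = zonal_filter d \<kappa> h for d \<kappa> h +
  fixes N :: "nat \<Rightarrow> nat" and w :: "nat \<Rightarrow> nat \<Rightarrow> real" and \<xi> :: "nat \<Rightarrow> nat \<Rightarrow> real ^ 'n"
  assumes card: "CARD('n) = d + 1"
    and quadrature: "\<And>j. needlet_quadrature j (N j) (w j) (\<xi> j)"
begin

lemma quad_weight: "k \<in> {1..N j} \<Longrightarrow> w j k > 0"
  and quad_exact: "spherical_polynomial (2 ^ (j + 1) - 1) q \<Longrightarrow>
    (\<Sum>k=1..N j. w j k * q (\<xi> j k)) = (\<integral>x. q x \<partial>sphere_measure)"
  using quadrature[of j] unfolding needlet_quadrature_def by (blast, metis)

lemma degree_needlet_poly: "degree (needlet_poly j) \<le> 2 ^ j - 1"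
  unfolding needlet_poly_def
proof (rule degree_sum_le)
  fix l :: nat assume "l \<in> {..<2 ^ j}"
  then have "l \<le> 2 ^ j - 1" by auto
  then show "degree (smult (h (real l / 2 ^ (j - 1))) (zonal d 0 l)) \<le> 2 ^ j - 1"
    using degree_geg_le[of d l] by (simp add: degree_smult_eq)
qed simp

text \<open>The sum over \<open>k\<close> is the quadrature rule for a product of two needlet
  polynomials centred at \<open>x\<close> and \<open>y\<close>. Exactness replaces it by the
  integral, and the reproducing property evaluates that.\<close>

lemma needlet_band:
  assumes x: "x \<in> sphere 0 1" and y: "y \<in> sphere 0 1"
  shows "(\<Sum>k=1..N j. needlet d h w \<xi> j k y * needlet d h w \<xi> j k x) = (if j = 0 then 1 else poly (band_poly j) (x \<bullet> y))"
proof (cases "j = 0")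
  case True
  have "(\<Sum>k=1..N 0. needlet d h w \<xi> 0 k y * needlet d h w \<xi> 0 k x) = (\<Sum>k=1..N 0. w 0 k * 1)"
    using quad_weight[of _ 0] by (intro sum.cong refl) (simp add: needlet_def less_imp_le)
  also have "\<dots> = (\<integral>x. 1 \<partial>(sphere_measure :: (real ^ 'n) measure))"
    by (rule quad_exact) (rule spherical_polynomial_const)
  also have "\<dots> = 1" by (simp add: prob_space.prob_space[OF prob_space_sphere_measure, simplified])
  finally show ?thesis using True by simp
next
  case False
  define q where "q z = poly (needlet_poly j) (x \<bullet> z) * (poly (needlet_poly j) (y \<bullet> z) * 1)" for z
  have "spherical_polynomial (0 + (2 ^ j - 1) + (2 ^ j - 1)) q"
    unfolding q_def[abs_def]
    by (intro spherical_polynomial_zonal spherical_polynomial_const degree_needlet_poly)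
  \<comment> \<open>The two factors have total degree at most \<open>2 ^ (j + 1) - 2\<close>, within
    the exactness of the rule.\<close>
  then have sp: "spherical_polynomial (2 ^ (j + 1) - 1) q" by (rule spherical_polynomial_mono) simp
  have "(\<Sum>k=1..N j. needlet d h w \<xi> j k y * needlet d h w \<xi> j k x) = (\<Sum>k=1..N j. w j k * q (\<xi> j k))"
  proof (rule sum.cong[OF refl])
    fix k assume "k \<in> {1..N j}"
    then have "sqrt (w j k) * sqrt (w j k) = w j k" using quad_weight[of k j] by (simp add: less_imp_le)
    then show "needlet d h w \<xi> j k y * needlet d h w \<xi> j k x = w j k * q (\<xi> j k)"
      using False by (simp add: needlet_eq q_def mult_ac)
  qed
  also have "\<dots> = (\<integral>z. q z \<partial>sphere_measure)" by (rule quad_exact[OF sp])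
  also have "\<dots> = poly (band_poly j) (x \<bullet> y)"
    unfolding q_def using needlet_poly_reproducing[OF card x y, of j] by simp
  finally show ?thesis using False by simp
qed

lemma continuous_needlet: "continuous_on UNIV (needlet d h w \<xi> j k)"
proof (cases "j = 0")
  case True
  then show ?thesis by (simp add: needlet_def[abs_def])
next
  case False
  then have "needlet d h w \<xi> j k = (\<lambda>x. sqrt (w j k) * poly (needlet_poly j) (x \<bullet> \<xi> j k))"
    by (intro ext needlet_eq) simp
  then show ?thesis by (simp only:) (intro continuous_intros)
qed

lemma integrable_mult_needlet:
  assumes "integrable sphere_measure f"
  shows "integrable sphere_measure (\<lambda>z. f z * needlet d h w \<xi> j k z)"
proof (cases "j = 0")
  case True
  then show ?thesis using assms by (simp add: needlet_def)
next
  case False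
  then show ?thesis using integrable_mult_right[OF integrable_mult_zonal[OF assms, of "needlet_poly j" "\<xi> j k"], of "sqrt (w j k)"]
    by (simp add: needlet_eq mult_ac inner_commute)
qed

text \<open>Order \<open>J + 1\<close> belongs to the cutoff \<open>2 ^ J\<close> because bands
  start at \<open>j = 1\<close>. Order \<open>0\<close> is left aside, which does not affect
  limits.\<close>

lemma needlet_approx_eq_kernel:
  assumes f: "integrable sphere_measure (T \<omega>)" and x: "x \<in> sphere 0 1"
  shows "needlet_approx d h N w \<xi> (Suc J) T \<omega> x = (\<integral>z. poly (kernel (2 ^ J)) (x \<bullet> z) * T \<omega> z \<partial>sphere_measure)"
proof -
  have "needlet_approx d h N w \<xi> (Suc J) T \<omega> x =
     (\<Sum>j\<le>Suc J. \<Sum>k=1..N j. \<integral>z. T \<omega> z * needlet d h w \<xi> j k z * needlet d h w \<xi> j k x \<partial>sphere_measure)"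
    by (simp add: needlet_approx_def sphere_inner_def)
  also have "\<dots> = (\<integral>z. (\<Sum>j\<le>Suc J. \<Sum>k=1..N j. T \<omega> z * needlet d h w \<xi> j k z * needlet d h w \<xi> j k x) \<partial>sphere_measure)"
    using f by (subst Bochner_Integration.integral_sum, intro Bochner_Integration.integrable_sum integrable_mult_left integrable_mult_needlet)
       (simp_all add: Bochner_Integration.integral_sum integrable_mult_needlet)
  also have "\<dots> = (\<integral>z. poly (kernel (2 ^ J)) (x \<bullet> z) * T \<omega> z \<partial>sphere_measure)"
  proof (rule Bochner_Integration.integral_cong[OF refl])
    fix z :: "real ^ 'n" assume "z \<in> space sphere_measure"
    then have z: "z \<in> sphere 0 1" by simp
    have "(\<Sum>j\<le>Suc J. \<Sum>k=1..N j. T \<omega> z * needlet d h w \<xi> j k z * needlet d h w \<xi> j k x) =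
      T \<omega> z * (\<Sum>j\<le>Suc J. \<Sum>k=1..N j. needlet d h w \<xi> j k z * needlet d h w \<xi> j k x)"
      by (simp only: sum_distrib_left mult.assoc)
    also have "(\<Sum>j\<le>Suc J. \<Sum>k=1..N j. needlet d h w \<xi> j k z * needlet d h w \<xi> j k x) =
       (\<Sum>j\<le>Suc J. if j = 0 then 1 else poly (band_poly j) (x \<bullet> z))"
      by (simp only: needlet_band[OF x z])
    also have "\<dots> = 1 + (\<Sum>j\<le>J. poly (band_poly (Suc j)) (x \<bullet> z))"
      by (subst sum.atMost_Suc_shift) simp
    also have "\<dots> = poly (kernel (2 ^ J)) (x \<bullet> z)"
      by (simp add: kernel_eq_bands[symmetric] poly_sum)
    finally show "(\<Sum>j\<le>Suc J. \<Sum>k=1..N j. T \<omega> z * needlet d h w \<xi> j k z * needlet d h w \<xi> j k x) =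
      poly (kernel (2 ^ J)) (x \<bullet> z) * T \<omega> z" by simp
  qed
  finally show ?thesis .
qed

end

section \<open>Convergence in \<open>L\<^sub>p\<close>\<close>

lemma ennreal_tendsto_0I:
  fixes f :: "'a \<Rightarrow> ennreal"
  assumes "\<And>e::real. e > 0 \<Longrightarrow> \<forall>\<^sub>F x in F. f x \<le> ennreal e"
  shows "(f \<longlongrightarrow> 0) F"
proof (rule order_tendstoI)
  fix a :: ennreal assume "0 < a"
  then obtain r :: rat where "0 < r" "real_of_rat r < a" using ennreal_rat_dense by fastforce
  then obtain e :: real where "e > 0" "ennreal e < a" by (metis zero_less_of_rat_iff)
  with assms[of e] show "\<forall>\<^sub>F x in F. f x < a" by (auto elim!: eventually_mono)
qed simp

text \<open>Convexity, in the form of the tangent at \<open>l\<close>. For positive \<open>a\<close>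
  and \<open>l\<close> it is Young's inequality for \<open>a powr p\<close> and
  \<open>l powr p\<close> with weights \<open>1 / p\<close> and \<open>1 - 1 / p\<close>.\<close>

lemma powr_tangent:
  fixes a l p :: real
  assumes p: "p \<ge> 1" and a: "a \<ge> 0" and l: "l \<ge> 0"
  shows "l powr p + p * l powr (p - 1) * (a - l) \<le> a powr p"
proof -
  consider "l = 0" | "l > 0" "a = 0" | "l > 0" "a > 0" using a l by linarith
  then show ?thesis
  proof cases
    \<comment> \<open>\<open>0 powr (p - 1)\<close> is \<open>0\<close>, even for
      \<open>p = 1\<close>, so the left-hand side is \<open>0\<close>.\<close>
    case 1
    then show ?thesis by simp
  next
    case 2
    have "l powr (p - 1) * l = l powr p" using 2 by (simp add: powr_mult_base mult.commute)
    then have "l powr p + p * l powr (p - 1) * (a - l) = (1 - p) * l powr p" using 2 by (simp add: algebra_simps)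
    moreover have "(1 - p) * l powr p \<le> 0" using p by (intro mult_nonpos_nonneg) auto
    ultimately show ?thesis by (simp add: 2)
  next
    case 3
    have "(a powr p) powr (1 / p) * (l powr p) powr (1 - 1 / p) \<le> 1 / p * a powr p + (1 - 1 / p) * l powr p"
      using p 3 by (intro Youngs_inequality_0) auto
    moreover have "(a powr p) powr (1 / p) = a" "(l powr p) powr (1 - 1 / p) = l powr (p - 1)"
      using p 3 by (simp_all add: powr_powr right_diff_distrib)
    ultimately have "p * (a * l powr (p - 1)) \<le> p * (1 / p * a powr p + (1 - 1 / p) * l powr p)"
      using p by (intro mult_left_mono) auto
    also have "\<dots> = a powr p + (p - 1) * l powr p" using p by (simp add: field_simps)
    finally have "p * (a * l powr (p - 1)) \<le> a powr p + (p - 1) * l powr p" .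
    moreover have "l powr (p - 1) * l = l powr p" using 3 by (simp add: powr_mult_base mult.commute)
    ultimately show ?thesis by (simp add: algebra_simps)
  qed
qed

text \<open>The tangent at the weighted mean \<open>l\<close> is integrated against
  \<open>k\<close>; its linear part contributes \<open>0\<close>.\<close>

lemma weighted_Jensen:
  fixes k g :: "'a \<Rightarrow> real"
  assumes p: "p \<ge> 1" and k: "integrable M k" "\<And>x. x \<in> space M \<Longrightarrow> k x \<ge> 0" and g: "\<And>x. x \<in> space M \<Longrightarrow> g x \<ge> 0"
    and kg: "integrable M (\<lambda>x. k x * g x)" and kgp: "integrable M (\<lambda>x. k x * g x powr p)"
    and A: "(\<integral>x. k x \<partial>M) > 0"
  shows "(\<integral>x. k x * g x \<partial>M) powr p \<le> (\<integral>x. k x \<partial>M) powr (p - 1) * (\<integral>x. k x * g x powr p \<partial>M)"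
proof -
  define A m where "A = (\<integral>x. k x \<partial>M)" and "m = (\<integral>x. k x * g x \<partial>M)"
  define l where "l = m / A"
  have A0: "A > 0" using A by (simp add: A_def)
  have m0: "m \<ge> 0" unfolding m_def using k g by (intro integral_nonneg_AE AE_I2) auto
  have l0: "l \<ge> 0" using A0 m0 by (simp add: l_def)
  have "A * l powr p = (\<integral>x. l powr p * k x + p * l powr (p - 1) * (k x * g x - l * k x) \<partial>M)"
  proof -
    have "(\<integral>x. l powr p * k x + p * l powr (p - 1) * (k x * g x - l * k x) \<partial>M) = l powr p * A + p * l powr (p - 1) * (m - l * A)"
      using k kg by (simp add: A_def m_def)
    then show ?thesis using A0 by (simp add: l_def)
  qed
  also have "\<dots> \<le> (\<integral>x. k x * g x powr p \<partial>M)"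
  proof (rule integral_mono)
    show "integrable M (\<lambda>x. l powr p * k x + p * l powr (p - 1) * (k x * g x - l * k x))"
      using k kg by auto
    fix x assume x: "x \<in> space M"
    have "k x * (l powr p + p * l powr (p - 1) * (g x - l)) \<le> k x * g x powr p"
      using k(2)[OF x] g[OF x] l0 p by (intro mult_left_mono powr_tangent) auto
    then show "l powr p * k x + p * l powr (p - 1) * (k x * g x - l * k x) \<le> k x * g x powr p"
      by (simp add: algebra_simps)
  qed (rule kgp)
  finally have 1: "A * l powr p \<le> (\<integral>x. k x * g x powr p \<partial>M)" .
  have "m powr p = (A * l) powr p" using A0 by (simp add: l_def)
  also have "\<dots> = A powr (p - 1) * (A * l powr p)"
    using A0 l0 by (simp add: powr_mult powr_diff)
  also have "\<dots> \<le> A powr (p - 1) * (\<integral>x. k x * g x powr p \<partial>M)"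
    using 1 by (intro mult_left_mono) auto
  finally show ?thesis by (simp add: A_def m_def)
qed

text \<open>The \<open>p\<close>-th power of the norm, without the root: the convergence claim
  concerns this power, and Tonelli applies to it directly.\<close>

definition Lp_pow :: "real \<Rightarrow> (real ^ 'n \<Rightarrow> real) \<Rightarrow> ennreal" where
  "Lp_pow p f = (\<integral>\<^sup>+x. ennreal (\<bar>f x\<bar> powr p) \<partial>sphere_measure)"

lemma Lp_pow_cong: "(\<And>x. x \<in> sphere 0 1 \<Longrightarrow> f x = g x) \<Longrightarrow> Lp_pow p f = Lp_pow p g"
  unfolding Lp_pow_def by (intro nn_integral_cong) simp

lemma abs_le_one_powr: "p \<ge> 1 \<Longrightarrow> \<bar>y::real\<bar> \<le> 1 + \<bar>y\<bar> powr p"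
proof (cases "\<bar>y\<bar> \<le> 1")
  case False
  moreover assume "p \<ge> 1"
  ultimately have "\<bar>y\<bar> powr 1 \<le> \<bar>y\<bar> powr p" by (intro powr_mono) auto
  then show ?thesis by simp
qed (auto intro: order_trans)

lemma Lp_pow_finite:
  assumes f[measurable]: "f \<in> borel_measurable sphere_measure" and fin: "Lp_pow p f < \<infinity>"
  shows integrable_powr_Lp: "integrable sphere_measure (\<lambda>x. \<bar>f x\<bar> powr p)"
    and integrable_Lp: "p \<ge> 1 \<Longrightarrow> integrable sphere_measure f"
proof -
  show 1: "integrable sphere_measure (\<lambda>x. \<bar>f x\<bar> powr p)"
    using fin by (intro integrableI_nonneg) (auto simp: Lp_pow_def)
  assume p: "p \<ge> 1"
  show "integrable sphere_measure f"
  proof (rule Bochner_Integration.integrable_bound[of _ "\<lambda>x. 1 + \<bar>f x\<bar> powr p"])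
    show "AE x in sphere_measure. norm (f x) \<le> norm (1 + \<bar>f x\<bar> powr p)"
      using abs_le_one_powr[OF p] by (intro AE_I2) (simp add: add_nonneg_nonneg)
  qed (use 1 in auto)
qed

text \<open>A sum is at most three times its largest term. The factor \<open>3 powr p\<close> is
  harmless for limits, so this serves as the triangle inequality for \<open>Lp_pow\<close>.\<close>

lemma abs_powr_add3:
  fixes a b c :: real
  assumes p: "p \<ge> 0"
  shows "\<bar>a + b + c\<bar> powr p \<le> 3 powr p * (\<bar>a\<bar> powr p + \<bar>b\<bar> powr p + \<bar>c\<bar> powr p)"
proof -
  define m where "m = max \<bar>a\<bar> (max \<bar>b\<bar> \<bar>c\<bar>)"
  have "\<bar>a + b + c\<bar> powr p \<le> (3 * m) powr p"
    using p by (intro powr_mono2) (auto simp: m_def)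
  also have "\<dots> = 3 powr p * m powr p" by (rule powr_mult)
  also have "m powr p \<le> \<bar>a\<bar> powr p + \<bar>b\<bar> powr p + \<bar>c\<bar> powr p"
    by (auto simp: m_def max_def)
  finally show ?thesis by (simp add: mult_left_mono)
qed

lemma Lp_pow_add3:
  assumes p: "p \<ge> 0" and [measurable]: "f \<in> borel_measurable sphere_measure" "g \<in> borel_measurable sphere_measure"
    "k \<in> borel_measurable sphere_measure"
  shows "Lp_pow p (\<lambda>x. f x + g x + k x) \<le> ennreal (3 powr p) * (Lp_pow p f + Lp_pow p g + Lp_pow p k)"
proof -
  have "Lp_pow p (\<lambda>x. f x + g x + k x) \<le> (\<integral>\<^sup>+x. ennreal (3 powr p) * (ennreal (\<bar>f x\<bar> powr p) + ennreal (\<bar>g x\<bar> powr p) + ennreal (\<bar>k x\<bar> powr p)) \<partial>sphere_measure)"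
    unfolding Lp_pow_def using abs_powr_add3[OF p]
    by (intro nn_integral_mono) (simp add: ennreal_plus[symmetric] ennreal_mult[symmetric] del: ennreal_plus)
  also have "\<dots> = ennreal (3 powr p) * (Lp_pow p f + Lp_pow p g + Lp_pow p k)"
    unfolding Lp_pow_def by (simp add: nn_integral_cmult nn_integral_add)
  finally show ?thesis .
qed

text \<open>Regularity encloses \<open>A\<close> between a compact and an open set whose difference
  has measure below \<open>e\<close>; Urysohn's function for this pair differs from the indicator on
  the difference only.\<close>

lemma L1_dense_indicator:
  fixes A :: "(real ^ 'n) set"
  assumes A: "A \<in> sets sphere_measure" and e: "e > 0"
  obtains \<phi> :: "real ^ 'n \<Rightarrow> real" where "continuous_on UNIV \<phi>"
    "(\<integral>x. \<bar>indicator A x - \<phi> x\<bar> \<partial>sphere_measure) < e"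
proof -
  let ?M = "cone_measure :: (real ^ 'n) measure"
  interpret C: prob_space ?M by (rule prob_space_cone_measure)
  have AB[measurable]: "A \<in> sets borel"
    using A by (auto simp: sets_sphere_measure sets_restrict_space closed_sphere)
  have sM: "sets ?M = sets borel" by simp
  have fM: "emeasure ?M (space ?M) \<noteq> \<infinity>" by (simp add: C.emeasure_space_1)
  obtain K where K: "K \<subseteq> A" "compact K" "measure ?M A < measure ?M K + e / 2"
  proof (rule ccontr)
    assume nt: "\<not> thesis"
    note ex = that
    have no: "measure ?M K \<le> measure ?M A - e / 2" if K: "K \<subseteq> A" "compact K" for K
      using nt ex[OF K] by argo
    have "emeasure ?M A \<le> ennreal (measure ?M A - e / 2)"
      unfolding inner_regular[OF sM fM AB]
      by (rule SUP_least) (use no in \<open>auto simp: C.emeasure_eq_measure intro: ennreal_leI\<close>)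
    then have "measure ?M A \<le> measure ?M A - e / 2"
      using no[of "{}"] by (simp add: C.emeasure_eq_measure ennreal_le_iff)
    then show False using e by simp
  qed
  obtain U where U: "A \<subseteq> U" "open U" "emeasure ?M U < emeasure ?M A + ennreal (e / 2)"
  proof -
    have "(INF U\<in>{U. A \<subseteq> U \<and> open U}. emeasure ?M U) < emeasure ?M A + ennreal (e / 2)"
      unfolding outer_regular[OF sM fM AB, symmetric] using e by (simp add: C.emeasure_eq_measure ennreal_plus[symmetric] ennreal_less_iff del: ennreal_plus)
    then show thesis using that by (auto simp: INF_less_iff)
  qed
  have KM: "K \<in> sets borel" using K by (simp add: borel_compact)
  have UM: "U \<in> sets borel" using U by (simp add: borel_open)
  note K(3)
  moreover have "measure ?M U < measure ?M A + e / 2"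
    using U(3) e by (simp add: C.emeasure_eq_measure ennreal_plus[symmetric] ennreal_less_iff del: ennreal_plus)
  moreover have "measure ?M (U - K) = measure ?M U - measure ?M K"
    using K U KM UM by (intro C.finite_measure_Diff) auto
  ultimately have UK: "measure ?M (U - K) < e" by linarith
  have "closed K" "closed (- U)" "K \<inter> - U = {}" using K U by (auto simp: compact_imp_closed)
  then obtain \<phi> where phi: "continuous_on UNIV \<phi>" "\<And>x. \<phi> x \<in> closed_segment 1 (0::real)"
    "\<And>x. x \<in> K \<Longrightarrow> \<phi> x = 1" "\<And>x. x \<in> - U \<Longrightarrow> \<phi> x = 0"
    using Urysohn[of K "- U" 1 "0::real"] by metis
  have p01: "0 \<le> \<phi> x" "\<phi> x \<le> 1" for x using phi(2)[of x] by (auto simp: closed_segment_eq_real_ivl)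
  have [measurable]: "\<phi> \<in> borel_measurable borel" by (rule borel_measurable_continuous_onI[OF phi(1)])
  note KM[measurable] UM[measurable]
  have pw: "\<bar>indicator A x - \<phi> x\<bar> \<le> (indicator (U - K) x :: real)" for x
    using p01[of x] phi(3,4)[of x] K(1) U(1) by (auto simp: indicator_def)
  have "(\<integral>x. \<bar>indicator A x - \<phi> x\<bar> \<partial>sphere_measure) = (\<integral>x. \<bar>indicator A x - \<phi> x\<bar> \<partial>?M)"
    by (rule integral_sphere_measure) measurable
  also have "\<dots> \<le> (\<integral>x. indicator (U - K) x \<partial>?M)"
    by (rule integral_mono_AE') (auto intro!: AE_I2 pw simp: integrable_indicator_iff C.emeasure_eq_measure)
  also have "\<dots> = measure ?M (U - K)" by simp
  finally show thesis using that[OF phi(1)] UK by simp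
qed

lemma L1_dense:
  fixes f :: "real ^ 'n \<Rightarrow> real"
  assumes "integrable sphere_measure f"
  shows "\<forall>e>0. \<exists>\<phi>. continuous_on UNIV \<phi> \<and> (\<integral>x. \<bar>f x - \<phi> x\<bar> \<partial>sphere_measure) < e"
  using assms
proof (induction rule: integrable_induct)
  case (base A c)
  show ?case
  proof (intro allI impI)
    fix e :: real assume e: "e > 0"
    obtain \<phi> :: "real ^ 'n \<Rightarrow> real" where phi: "continuous_on UNIV \<phi>" "(\<integral>x. \<bar>indicator A x - \<phi> x\<bar> \<partial>sphere_measure) < e / (\<bar>c\<bar> + 1)"
      using L1_dense_indicator[OF base(1), of "e / (\<bar>c\<bar> + 1)"] e by (auto simp: add_nonneg_pos)
    have "(\<integral>x. \<bar>indicator A x *\<^sub>R c - c * \<phi> x\<bar> \<partial>sphere_measure) = \<bar>c\<bar> * (\<integral>x. \<bar>indicator A x - \<phi> x\<bar> \<partial>sphere_measure)"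
    proof -
      have "\<bar>indicator A x *\<^sub>R c - c * \<phi> x\<bar> = \<bar>c\<bar> * \<bar>indicator A x - \<phi> x\<bar>" for x
        by (simp add: abs_mult[symmetric] algebra_simps)
      then show ?thesis by simp
    qed
    also have "\<dots> \<le> (\<bar>c\<bar> + 1) * (\<integral>x. \<bar>indicator A x - \<phi> x\<bar> \<partial>sphere_measure)"
      by (intro mult_right_mono) (auto intro!: integral_nonneg_AE)
    also have "\<dots> < e" using phi(2) by (simp add: pos_less_divide_eq add_nonneg_pos mult.commute)
    finally show "\<exists>\<phi>. continuous_on UNIV \<phi> \<and> (\<integral>x. \<bar>indicator A x *\<^sub>R c - \<phi> x\<bar> \<partial>sphere_measure) < e"
      using phi(1) by (intro exI[of _ "\<lambda>x. c * \<phi> x"] conjI continuous_intros)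
  qed
next
  case (add f g)
  show ?case
  proof (intro allI impI)
    fix e :: real assume e: "e > 0"
    then have "e / 2 > 0" by simp
    with add obtain \<phi> \<psi> where phi: "continuous_on UNIV \<phi>" "(\<integral>x. \<bar>f x - \<phi> x\<bar> \<partial>sphere_measure) < e / 2"
      and psi: "continuous_on UNIV \<psi>" "(\<integral>x. \<bar>g x - \<psi> x\<bar> \<partial>sphere_measure) < e / 2" by meson
    have i: "integrable sphere_measure (\<lambda>x. \<bar>f x - \<phi> x\<bar>)" "integrable sphere_measure (\<lambda>x. \<bar>g x - \<psi> x\<bar>)"
      by (intro integrable_abs Bochner_Integration.integrable_diff add.hyps integrable_sphere_continuous phi psi)+
    have "(\<integral>x. \<bar>f x + g x - (\<phi> x + \<psi> x)\<bar> \<partial>sphere_measure) \<le> (\<integral>x. \<bar>f x - \<phi> x\<bar> + \<bar>g x - \<psi> x\<bar> \<partial>sphere_measure)"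
      using i by (intro integral_mono_AE') (auto intro!: AE_I2)
    also have "\<dots> < e" using i phi psi by simp
    finally show "\<exists>\<phi>. continuous_on UNIV \<phi> \<and> (\<integral>x. \<bar>f x + g x - \<phi> x\<bar> \<partial>sphere_measure) < e"
      using phi psi by (intro exI[of _ "\<lambda>x. \<phi> x + \<psi> x"] conjI continuous_intros)
  qed
next
  case (lim f s)
  have "(\<lambda>i. \<integral>x. \<bar>f x - s i x\<bar> \<partial>sphere_measure) \<longlonglongrightarrow> (\<integral>x. 0 \<partial>(sphere_measure :: (real ^ 'n) measure))"
  proof (rule integral_dominated_convergence[where w = "\<lambda>x. 3 * \<bar>f x\<bar>"])
    show "AE x in sphere_measure. (\<lambda>i. \<bar>f x - s i x\<bar>) \<longlonglongrightarrow> 0"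
    proof (rule AE_I2)
      fix x :: "real ^ 'n" assume "x \<in> space sphere_measure"
      then have "(\<lambda>i. \<bar>f x - s i x\<bar>) \<longlonglongrightarrow> \<bar>f x - f x\<bar>"
        by (intro tendsto_intros lim.hyps(2))
      then show "(\<lambda>i. \<bar>f x - s i x\<bar>) \<longlonglongrightarrow> 0" by simp
    qed
    show "AE x in sphere_measure. norm \<bar>f x - s i x\<bar> \<le> 3 * \<bar>f x\<bar>" for i
    proof (rule AE_I2)
      fix x :: "real ^ 'n" assume "x \<in> space sphere_measure"
      from lim.hyps(3)[OF this, of i] show "norm \<bar>f x - s i x\<bar> \<le> 3 * \<bar>f x\<bar>" by simp
    qed
  qed (use lim in auto)
  then have l0: "(\<lambda>i. \<integral>x. \<bar>f x - s i x\<bar> \<partial>sphere_measure) \<longlonglongrightarrow> 0" by simp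
  show ?case
  proof (intro allI impI)
    fix e :: real assume e: "e > 0"
    then have "\<forall>\<^sub>F i in sequentially. (\<integral>x. \<bar>f x - s i x\<bar> \<partial>sphere_measure) < e / 2"
      by (intro order_tendstoD[OF l0]) simp
    then obtain i where si: "(\<integral>x. \<bar>f x - s i x\<bar> \<partial>sphere_measure) < e / 2" by (auto simp: eventually_sequentially)
    obtain \<phi> where phi: "continuous_on UNIV \<phi>" "(\<integral>x. \<bar>s i x - \<phi> x\<bar> \<partial>sphere_measure) < e / 2"
      using lim.IH[of i] e by (meson half_gt_zero)
    have ii: "integrable sphere_measure (\<lambda>x. \<bar>f x - s i x\<bar>)" "integrable sphere_measure (\<lambda>x. \<bar>s i x - \<phi> x\<bar>)"
      by (intro integrable_abs Bochner_Integration.integrable_diff lim.hyps(1,4) integrable_sphere_continuous phi)+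
    have "(\<integral>x. \<bar>f x - \<phi> x\<bar> \<partial>sphere_measure) \<le> (\<integral>x. \<bar>f x - s i x\<bar> + \<bar>s i x - \<phi> x\<bar> \<partial>sphere_measure)"
      using ii by (intro integral_mono_AE') (auto intro!: AE_I2)
    also have "\<dots> < e" using ii phi si by simp
    finally show "\<exists>\<phi>. continuous_on UNIV \<phi> \<and> (\<integral>x. \<bar>f x - \<phi> x\<bar> \<partial>sphere_measure) < e"
      using phi(1) by blast
  qed
qed

text \<open>Truncation makes the function bounded by \<open>b\<close>. Between functions with values
  in \<open>[-b, b]\<close> the \<open>p\<close>-th power of the difference is at most
  \<open>(2 * b) powr (p - 1)\<close> times the difference, so density in \<open>L\<^sub>1\<close>
  suffices once the approximation is clipped to that range.\<close>

lemma Lp_dense: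
  fixes f :: "real ^ 'n \<Rightarrow> real"
  assumes p: "p \<ge> 1" and f[measurable]: "f \<in> borel_measurable sphere_measure" and fin: "Lp_pow p f < \<infinity>" and e: "e > 0"
  obtains \<phi> where "continuous_on UNIV \<phi>" "Lp_pow p (\<lambda>x. f x - \<phi> x) \<le> ennreal e"
proof -
  define t where "t n x = max (- real n) (min (real n) (f x))" for n x
  have tm[measurable]: "t n \<in> borel_measurable sphere_measure" for n unfolding t_def by measurable
  have "(\<lambda>n. \<integral>\<^sup>+x. ennreal (\<bar>f x - t n x\<bar> powr p) \<partial>sphere_measure) \<longlonglongrightarrow> (\<integral>\<^sup>+x. 0 \<partial>(sphere_measure :: (real ^ 'n) measure))"
  proof (rule nn_integral_dominated_convergence[where w = "\<lambda>x. ennreal (\<bar>f x\<bar> powr p)"])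
    show "AE x in sphere_measure. ennreal (\<bar>f x - t n x\<bar> powr p) \<le> ennreal (\<bar>f x\<bar> powr p)" for n
      using p by (intro AE_I2 ennreal_leI powr_mono2) (auto simp: t_def)
    show "(\<integral>\<^sup>+x. ennreal (\<bar>f x\<bar> powr p) \<partial>sphere_measure) < \<infinity>" using fin by (simp add: Lp_pow_def)
    show "AE x in sphere_measure. (\<lambda>n. ennreal (\<bar>f x - t n x\<bar> powr p)) \<longlonglongrightarrow> 0"
    proof (rule AE_I2)
      fix x :: "real ^ 'n"
      obtain n0 where n0: "\<bar>f x\<bar> \<le> real n0" using real_arch_simple by blast
      have "ennreal (\<bar>f x - t n x\<bar> powr p) = 0" if "n \<ge> n0" for n
      proof -
        have "t n x = f x" using n0 that by (auto simp: t_def)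
        then show ?thesis by simp
      qed
      then show "(\<lambda>n. ennreal (\<bar>f x - t n x\<bar> powr p)) \<longlonglongrightarrow> 0"
        by (intro tendsto_eventually) (auto simp: eventually_sequentially)
    qed
  qed auto
  then have lim: "(\<lambda>n. Lp_pow p (\<lambda>x. f x - t n x)) \<longlonglongrightarrow> 0" by (simp add: Lp_pow_def)
  \<comment> \<open>Truncation and approximation contribute \<open>q\<close> each, and
    \<open>3 powr p * (q + q) = e\<close>.\<close>
  define q where "q = e / (2 * 3 powr p)"
  have q: "q > 0" using e by (simp add: q_def)
  have "\<forall>\<^sub>F n in sequentially. Lp_pow p (\<lambda>x. f x - t n x) < ennreal q"
    using q by (intro order_tendstoD[OF lim]) simp
  then obtain n0 where n0: "\<And>n. n \<ge> n0 \<Longrightarrow> Lp_pow p (\<lambda>x. f x - t n x) < ennreal q" by (auto simp: eventually_sequentially)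
  define n where "n = Suc n0"
  define b where "b = real n"
  have b: "b > 0" and tn: "Lp_pow p (\<lambda>x. f x - t n x) < ennreal q"
    using n0[of n] by (auto simp: n_def b_def)
  have tb: "\<bar>t n x\<bar> \<le> b" for x by (auto simp: t_def b_def)
  have ti: "integrable sphere_measure (t n)"
    using tb by (intro sph.integrable_const_bound[where B = b]) auto
  have qq: "q / (2 * b) powr (p - 1) > 0" using q b by simp
  obtain \<phi> where phi: "continuous_on UNIV \<phi>" "(\<integral>x. \<bar>t n x - \<phi> x\<bar> \<partial>sphere_measure) < q / (2 * b) powr (p - 1)"
    using L1_dense[OF ti] qq by blast
  define \<psi> where "\<psi> x = max (- b) (min b (\<phi> x))" for x
  have psi: "continuous_on UNIV \<psi>" unfolding \<psi>_def by (intro continuous_intros phi)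
  have [measurable]: "\<psi> \<in> borel_measurable sphere_measure"
    by (intro measurable_sphere_measureI borel_measurable_continuous_onI psi)
  have phii: "integrable sphere_measure (\<lambda>x. \<bar>t n x - \<phi> x\<bar>)"
    using ti integrable_sphere_continuous[OF phi(1)] by auto
  have "\<bar>t n x - \<psi> x\<bar> powr p \<le> (2 * b) powr (p - 1) * \<bar>t n x - \<phi> x\<bar>" for x
  proof -
    have 1: "\<bar>t n x - \<psi> x\<bar> \<le> \<bar>t n x - \<phi> x\<bar>" "\<bar>t n x - \<psi> x\<bar> \<le> 2 * b"
      using tb[of x] by (auto simp: \<psi>_def)
    have "\<bar>t n x - \<psi> x\<bar> powr p = \<bar>t n x - \<psi> x\<bar> powr (p - 1) * \<bar>t n x - \<psi> x\<bar>"
      by (simp add: powr_mult_base mult.commute)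
    also have "\<dots> \<le> (2 * b) powr (p - 1) * \<bar>t n x - \<phi> x\<bar>"
      using 1 p by (intro mult_mono powr_mono2) auto
    finally show ?thesis .
  qed
  then have "Lp_pow p (\<lambda>x. t n x - \<psi> x) \<le> (\<integral>\<^sup>+x. ennreal ((2 * b) powr (p - 1) * \<bar>t n x - \<phi> x\<bar>) \<partial>sphere_measure)"
    unfolding Lp_pow_def by (intro nn_integral_mono ennreal_leI)
  also have "\<dots> = ennreal ((2 * b) powr (p - 1) * (\<integral>x. \<bar>t n x - \<phi> x\<bar> \<partial>sphere_measure))"
    using phii by (subst nn_integral_eq_integral) auto
  also have "\<dots> \<le> ennreal q"
    using phi(2) b by (intro ennreal_leI) (simp add: pos_less_divide_eq mult.commute less_imp_le)
  finally have tp: "Lp_pow p (\<lambda>x. t n x - \<psi> x) \<le> ennreal q" .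
  have "Lp_pow p (\<lambda>x. f x - \<psi> x) = Lp_pow p (\<lambda>x. (f x - t n x) + (t n x - \<psi> x) + 0)" by simp
  also have "\<dots> \<le> ennreal (3 powr p) * (Lp_pow p (\<lambda>x. f x - t n x) + Lp_pow p (\<lambda>x. t n x - \<psi> x) + Lp_pow p (\<lambda>x :: real ^ 'n. 0))"
    using p by (intro Lp_pow_add3[of p "\<lambda>x. f x - t n x" "\<lambda>x. t n x - \<psi> x" "\<lambda>x. 0"]) auto
  also have "\<dots> \<le> ennreal (3 powr p) * (ennreal q + ennreal q + 0)"
    using tn tp by (intro mult_left_mono add_mono) (auto simp: Lp_pow_def)
  also have "\<dots> = ennreal e"
    using q by (simp add: ennreal_plus[symmetric] ennreal_mult[symmetric] q_def del: ennreal_plus)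
  finally show thesis using that psi by blast
qed

section \<open>Convolution with the kernel on \<open>L\<^sub>p\<close>\<close>

context zonal_filter
begin

definition conv :: "nat \<Rightarrow> (real ^ 'n \<Rightarrow> real) \<Rightarrow> real ^ 'n \<Rightarrow> real" where
  "conv N f x = (\<integral>z. poly (kernel N) (x \<bullet> z) * f z \<partial>sphere_measure)"

lemma conv_diff:
  "integrable sphere_measure f \<Longrightarrow> integrable sphere_measure g \<Longrightarrow> conv N (\<lambda>x. f x - g x) x = conv N f x - conv N g x"
  unfolding conv_def by (simp add: right_diff_distrib integrable_mult_zonal)

lemma borel_measurable_conv:
  assumes [measurable]: "f \<in> borel_measurable sphere_measure"
  shows "conv N f \<in> borel_measurable sphere_measure"
proof -
  have [measurable]: "(\<lambda>x. x) \<in> borel_measurable sphere_measure" by (rule measurable_sphere_measureI) simp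
  have [measurable]: "poly (kernel N) \<in> borel_measurable borel"
    by (intro borel_measurable_continuous_onI continuous_intros)
  show ?thesis unfolding conv_def[abs_def] by measurable
qed

text \<open>Jensen with weight \<open>\<bar>K\<bar>\<close> for fixed \<open>x\<close>, then
  Tonelli. The kernel depends on \<open>x \<bullet> z\<close> alone, so \<open>C\<close> bounds its
  integral in either variable.\<close>

lemma conv_Lp_bound:
  fixes g :: "real ^ 'n \<Rightarrow> real"
  assumes card: "CARD('n) = d + 1" and p: "p \<ge> 1" and g[measurable]: "g \<in> borel_measurable sphere_measure"
    and fin: "Lp_pow p g < \<infinity>" and N: "N \<ge> 1"
    and C: "\<And>x :: real ^ 'n. x \<in> sphere 0 1 \<Longrightarrow> (\<integral>z. \<bar>poly (kernel N) (x \<bullet> z)\<bar> \<partial>sphere_measure) \<le> C"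
  shows "Lp_pow p (conv N g) \<le> ennreal (C powr p) * Lp_pow p g"
proof -
  note ig = integrable_Lp[OF g fin p] and igp = integrable_powr_Lp[OF g fin]
  define K where "K x z = \<bar>poly (kernel N) (x \<bullet> z)\<bar>" for x z :: "real ^ 'n"
  have Kc: "K x = (\<lambda>z. \<bar>poly (kernel N) (x \<bullet> z)\<bar>)" for x by (simp add: K_def fun_eq_iff)
  have Ki: "integrable sphere_measure (K x)" for x
    unfolding Kc by (intro integrable_sphere_continuous continuous_intros)
  have Kg: "integrable sphere_measure (\<lambda>z. K x z * \<bar>g z\<bar>)" for x
    using integrable_abs[OF integrable_mult_zonal[OF ig, of "kernel N" x]] by (simp add: K_def abs_mult)
  have Kgp: "integrable sphere_measure (\<lambda>z. K x z * \<bar>g z\<bar> powr p)" for x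
    using integrable_abs[OF integrable_mult_zonal[OF igp, of "kernel N" x]] by (simp add: K_def abs_mult)
  \<comment> \<open>The kernel has integral \<open>1\<close>, so its \<open>L\<^sub>1\<close> norm
    is at least \<open>1\<close>; this provides the positive total weight for Jensen.\<close>
  have A: "1 \<le> (\<integral>z. K x z \<partial>sphere_measure)" "(\<integral>z. K x z \<partial>sphere_measure) \<le> C" if x: "x \<in> sphere 0 1" for x
  proof -
    have "1 = (\<integral>z. poly (kernel N) (x \<bullet> z) \<partial>sphere_measure)" by (simp add: kernel_integral[OF card N x])
    also have "\<dots> \<le> (\<integral>z. K x z \<partial>sphere_measure)"
      by (intro integral_mono Ki integrable_sphere_continuous continuous_intros) (simp add: K_def)
    finally show "1 \<le> (\<integral>z. K x z \<partial>sphere_measure)" .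
    show "(\<integral>z. K x z \<partial>sphere_measure) \<le> C" using C[OF x] by (simp add: K_def)
  qed
  have C1: "C \<ge> 1"
  proof -
    obtain k :: 'n where True by simp
    have "axis k 1 \<in> sphere (0::real^'n) 1" by simp
    from A[OF this] show ?thesis by linarith
  qed
  have [measurable]: "(\<lambda>x. x) \<in> borel_measurable sphere_measure" by (rule measurable_sphere_measureI) simp
  have [measurable]: "poly (kernel N) \<in> borel_measurable borel"
    by (intro borel_measurable_continuous_onI continuous_intros)
  interpret P: pair_sigma_finite "sphere_measure :: (real ^ 'n) measure" "sphere_measure :: (real ^ 'n) measure"
    by (intro pair_sigma_finite.intro sph.sigma_finite_measure_axioms)
  have "Lp_pow p (conv N g) \<le> (\<integral>\<^sup>+x. ennreal (C powr (p - 1)) * (\<integral>\<^sup>+z. ennreal (K x z * \<bar>g z\<bar> powr p) \<partial>sphere_measure) \<partial>sphere_measure)"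
    unfolding Lp_pow_def
  proof (rule nn_integral_mono)
    fix x :: "real ^ 'n" assume "x \<in> space sphere_measure"
    then have x: "x \<in> sphere 0 1" by simp
    have "\<bar>conv N g x\<bar> \<le> (\<integral>z. K x z * \<bar>g z\<bar> \<partial>sphere_measure)"
      unfolding conv_def K_def abs_mult[symmetric] by (rule integral_abs_bound)
    then have "\<bar>conv N g x\<bar> powr p \<le> (\<integral>z. K x z * \<bar>g z\<bar> \<partial>sphere_measure) powr p"
      using p by (intro powr_mono2) auto
    also have "\<dots> \<le> (\<integral>z. K x z \<partial>sphere_measure) powr (p - 1) * (\<integral>z. K x z * \<bar>g z\<bar> powr p \<partial>sphere_measure)"
      using A[OF x] by (intro weighted_Jensen p Ki Kg Kgp) (auto simp: K_def)
    also have "\<dots> \<le> C powr (p - 1) * (\<integral>z. K x z * \<bar>g z\<bar> powr p \<partial>sphere_measure)"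
      using A[OF x] p by (intro mult_right_mono powr_mono2 integral_nonneg_AE) (auto simp: K_def)
    finally have "ennreal (\<bar>conv N g x\<bar> powr p) \<le> ennreal (C powr (p - 1)) * ennreal (\<integral>z. K x z * \<bar>g z\<bar> powr p \<partial>sphere_measure)"
      by (subst ennreal_mult'[symmetric]) (auto intro: ennreal_leI)
    also have "ennreal (\<integral>z. K x z * \<bar>g z\<bar> powr p \<partial>sphere_measure) = (\<integral>\<^sup>+z. ennreal (K x z * \<bar>g z\<bar> powr p) \<partial>sphere_measure)"
      using Kgp by (intro nn_integral_eq_integral[symmetric]) (auto simp: K_def)
    finally show "ennreal (\<bar>conv N g x\<bar> powr p) \<le> ennreal (C powr (p - 1)) * (\<integral>\<^sup>+z. ennreal (K x z * \<bar>g z\<bar> powr p) \<partial>sphere_measure)" .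
  qed
  also have "\<dots> = ennreal (C powr (p - 1)) * (\<integral>\<^sup>+x. \<integral>\<^sup>+z. ennreal (K x z * \<bar>g z\<bar> powr p) \<partial>sphere_measure \<partial>sphere_measure)"
    unfolding K_def by (intro nn_integral_cmult) measurable
  also have "(\<integral>\<^sup>+x. \<integral>\<^sup>+z. ennreal (K x z * \<bar>g z\<bar> powr p) \<partial>sphere_measure \<partial>sphere_measure) =
     (\<integral>\<^sup>+z. \<integral>\<^sup>+x. ennreal (K x z * \<bar>g z\<bar> powr p) \<partial>sphere_measure \<partial>sphere_measure)"
    unfolding K_def by (rule P.Fubini'[symmetric]) measurable
  also have "\<dots> \<le> (\<integral>\<^sup>+z. ennreal C * ennreal (\<bar>g z\<bar> powr p) \<partial>sphere_measure)"
  proof (rule nn_integral_mono)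
    fix z :: "real ^ 'n" assume "z \<in> space sphere_measure"
    then have z: "z \<in> sphere 0 1" by simp
    have "(\<integral>\<^sup>+x. ennreal (K x z * \<bar>g z\<bar> powr p) \<partial>sphere_measure) = (\<integral>\<^sup>+x. ennreal (K z x) * ennreal (\<bar>g z\<bar> powr p) \<partial>sphere_measure)"
      by (intro nn_integral_cong) (simp add: K_def ennreal_mult'' inner_commute)
    also have "\<dots> = (\<integral>\<^sup>+x. ennreal (K z x) \<partial>sphere_measure) * ennreal (\<bar>g z\<bar> powr p)"
      by (intro nn_integral_multc measurable_compose[OF borel_measurable_integrable[OF Ki] measurable_ennreal])
    also have "(\<integral>\<^sup>+x. ennreal (K z x) \<partial>sphere_measure) = ennreal (\<integral>x. K z x \<partial>sphere_measure)"
      by (intro nn_integral_eq_integral Ki) (simp add: K_def)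
    also have "\<dots> \<le> ennreal C" using A(2)[OF z] by (rule ennreal_leI)
    finally show "(\<integral>\<^sup>+x. ennreal (K x z * \<bar>g z\<bar> powr p) \<partial>sphere_measure) \<le> ennreal C * ennreal (\<bar>g z\<bar> powr p)"
      by (simp add: mult_right_mono)
  qed
  also have "\<dots> = ennreal C * Lp_pow p g"
    unfolding Lp_pow_def by (intro nn_integral_cmult) measurable
  finally have "Lp_pow p (conv N g) \<le> ennreal (C powr (p - 1)) * (ennreal C * Lp_pow p g)"
    by (simp add: mult_left_mono)
  also have "\<dots> = ennreal (C powr (p - 1) * C) * Lp_pow p g"
    using C1 by (simp add: ennreal_mult mult.assoc)
  also have "C powr (p - 1) * C = C powr p" using C1 by (simp add: powr_mult_base mult.commute)
  finally show ?thesis .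
qed

text \<open>With \<open>\<phi>\<close> continuous and close to \<open>f\<close>, the error splits
  into \<open>f - \<phi>\<close>, the error for \<open>\<phi>\<close>, and the convolution of
  \<open>\<phi> - f\<close>. They contribute \<open>q\<close>, \<open>q\<close> and
  \<open>C powr p * q\<close>, and \<open>q\<close> is chosen so that the total is \<open>e\<close>
  after the factor \<open>3 powr p\<close>.\<close>

lemma conv_Lp_tendsto:
  fixes f :: "real ^ 'n \<Rightarrow> real"
  assumes card: "CARD('n) = d + 1" and p: "p \<ge> 1" and f[measurable]: "f \<in> borel_measurable sphere_measure"
    and fin: "Lp_pow p f < \<infinity>"
  shows "(\<lambda>N. Lp_pow p (\<lambda>x. f x - conv N f x)) \<longlonglongrightarrow> 0"
proof (rule ennreal_tendsto_0I)
  fix e :: real assume e: "e > 0"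
  obtain C where C: "C > 0" "\<And>N x. N \<ge> 2 * (d div 2 + 1) \<Longrightarrow> (x :: real ^ 'n) \<in> sphere 0 1 \<Longrightarrow>
       (\<integral>z. \<bar>poly (kernel N) (x \<bullet> z)\<bar> \<partial>sphere_measure) \<le> C"
    using kernel_L1_bound[OF card] by blast
  define q where "q = e / (3 powr p * (2 + C powr p))"
  have den: "2 + C powr p > 0" by (simp add: add_pos_nonneg)
  have q: "q > 0" using e den by (simp add: q_def)
  obtain \<phi> where phi: "continuous_on UNIV \<phi>" "Lp_pow p (\<lambda>x. f x - \<phi> x) \<le> ennreal q"
    using Lp_dense[OF p f fin q] by blast
  have phis: "continuous_on (sphere 0 1) \<phi>" using phi(1) by (rule continuous_on_subset) simp
  have q': "q powr (1 / p) > 0" using q by simp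
  obtain N0 where N0: "\<And>N x. N \<ge> N0 \<Longrightarrow> x \<in> sphere 0 1 \<Longrightarrow> \<bar>conv N \<phi> x - \<phi> x\<bar> \<le> q powr (1 / p)"
    using kernel_approx_identity[OF card phis q'] unfolding conv_def by blast
  have [measurable]: "\<phi> \<in> borel_measurable sphere_measure"
    by (intro measurable_sphere_measureI borel_measurable_continuous_onI phi)
  have phii: "integrable sphere_measure \<phi>" by (rule integrable_sphere_continuous[OF phi(1)])
  have fi: "integrable sphere_measure f" by (rule integrable_Lp[OF f fin p])
  have "Lp_pow p (\<lambda>x. f x - conv N f x) \<le> ennreal e" if N: "N \<ge> max N0 (2 * (d div 2 + 1))" for N
  proof -
    note [measurable] = borel_measurable_conv
    have 1: "Lp_pow p (\<lambda>x. \<phi> x - conv N \<phi> x) \<le> ennreal q"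
    proof -
      have "Lp_pow p (\<lambda>x. \<phi> x - conv N \<phi> x) \<le> (\<integral>\<^sup>+x. ennreal q \<partial>(sphere_measure :: (real ^ 'n) measure))"
        unfolding Lp_pow_def
      proof (rule nn_integral_mono, rule ennreal_leI)
        fix x :: "real ^ 'n" assume "x \<in> space sphere_measure"
        then have "\<bar>\<phi> x - conv N \<phi> x\<bar> \<le> q powr (1 / p)" using N0[of N x] N by (simp add: abs_minus_commute)
        then have "\<bar>\<phi> x - conv N \<phi> x\<bar> powr p \<le> (q powr (1 / p)) powr p" using p by (intro powr_mono2) auto
        also have "\<dots> = q" using p q by (simp add: powr_powr)
        finally show "\<bar>\<phi> x - conv N \<phi> x\<bar> powr p \<le> q" .
      qed
      also have "\<dots> = ennreal q"
        by (simp add: prob_space.emeasure_space_1[OF prob_space_sphere_measure, simplified])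
      finally show ?thesis .
    qed
    have "Lp_pow p (\<lambda>x. - (f x - \<phi> x)) = Lp_pow p (\<lambda>x. f x - \<phi> x)" unfolding Lp_pow_def by (simp only: abs_minus_cancel)
    then have m: "Lp_pow p (\<lambda>x. \<phi> x - f x) \<le> ennreal q" using phi(2) by simp
    have 2: "Lp_pow p (conv N (\<lambda>x. \<phi> x - f x)) \<le> ennreal (C powr p) * ennreal q"
    proof (rule order_trans[OF conv_Lp_bound[OF card p]])
      show "Lp_pow p (\<lambda>x. \<phi> x - f x) < \<infinity>" using m by (rule le_less_trans) simp
      show "ennreal (C powr p) * Lp_pow p (\<lambda>x. \<phi> x - f x) \<le> ennreal (C powr p) * ennreal q"
        using m by (rule mult_left_mono) simp
    qed (use N C in auto)
    have "Lp_pow p (\<lambda>x. f x - conv N f x) = Lp_pow p (\<lambda>x. (f x - \<phi> x) + (\<phi> x - conv N \<phi> x) + conv N (\<lambda>x. \<phi> x - f x) x)"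
      by (simp add: conv_diff[OF phii fi])
    also have "\<dots> \<le> ennreal (3 powr p) * (Lp_pow p (\<lambda>x. f x - \<phi> x) + Lp_pow p (\<lambda>x. \<phi> x - conv N \<phi> x) + Lp_pow p (conv N (\<lambda>x. \<phi> x - f x)))"
      using p by (intro Lp_pow_add3[of p "\<lambda>x. f x - \<phi> x" "\<lambda>x. \<phi> x - conv N \<phi> x"]) measurable
    also have "\<dots> \<le> ennreal (3 powr p) * (ennreal q + ennreal q + ennreal (C powr p) * ennreal q)"
      using phi(2) 1 2 by (intro mult_left_mono add_mono) auto
    also have "\<dots> = ennreal (3 powr p * (q + q + C powr p * q))"
      using q by (simp add: ennreal_plus[symmetric] ennreal_mult[symmetric] del: ennreal_plus)
    also have "3 powr p * (q + q + C powr p * q) = e"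
    proof -
      have "3 powr p * (q + q + C powr p * q) = q * (3 powr p * (2 + C powr p))" by (simp add: algebra_simps)
      then show ?thesis using den by (simp add: q_def)
    qed
    finally show ?thesis .
  qed
  then show "\<forall>\<^sub>F N in sequentially. Lp_pow p (\<lambda>x. f x - conv N f x) \<le> ennreal e"
    unfolding eventually_sequentially by blast
qed

end

section \<open>Random fields\<close>

lemma enn_powr_Lp_norm:
  assumes p: "1 \<le> p" "p \<noteq> \<infinity>"
  shows "enn_powr (Lp_norm p f) (enn2real p) = Lp_pow (enn2real p) f"
proof -
  define r where "r = enn2real p"
  have "enn2real 1 \<le> enn2real p" using p by (intro enn2real_mono) (auto simp: top.not_eq_extremum)
  then have r: "r \<ge> 1" by (simp add: r_def)
  have N: "Lp_norm p f = enn_powr (Lp_pow r f) (1 / r)" using p(2) by (simp add: Lp_norm_def Lp_pow_def r_def)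
  show ?thesis
  proof (cases "Lp_pow r f = \<infinity>")
    case True
    then show ?thesis by (simp add: N enn_powr_def r_def[symmetric])
  next
    case False
    then have "ennreal ((enn2real (Lp_pow r f) powr (1 / r)) powr r) = Lp_pow r f"
      using r by (simp add: powr_powr ennreal_enn2real_if)
    then show ?thesis using False r by (simp add: N enn_powr_def r_def[symmetric])
  qed
qed

lemma random_field_measurable:
  assumes "random_field M T"
  shows "(\<lambda>(\<omega>, x). T \<omega> x) \<in> borel_measurable (M \<Otimes>\<^sub>M sphere_measure)"
proof -
  have "sets (M \<Otimes>\<^sub>M sphere_measure) = sets (M \<Otimes>\<^sub>M restrict_space borel (sphere 0 1))"
    by (intro sets_pair_measure_cong refl sets_sphere_measure)
  from measurable_cong_sets[OF this refl] show ?thesis using assms unfolding random_field_def by blast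
qed

lemma random_field_path_measurable:
  assumes "random_field M T" "\<omega> \<in> space M"
  shows "T \<omega> \<in> borel_measurable sphere_measure"
  using measurable_Pair2[OF random_field_measurable[OF assms(1)] assms(2)] by simp

text \<open>All \<open>n\<close> points are taken equal, and rotations act transitively on the
  sphere. For even \<open>n\<close> the signed moment is the absolute one.\<close>

lemma isotropic_moment_constant:
  fixes T :: "'w \<Rightarrow> real ^ 'n \<Rightarrow> real"
  assumes iso: "fin_weakly_isotropic M n T" and n: "even n" "n \<ge> 1" and card: "2 \<le> CARD('n)"
    and x: "x \<in> sphere 0 1" and y: "y \<in> sphere 0 1"
  shows "(\<integral>\<omega>. \<bar>T \<omega> x\<bar> ^ n \<partial>M) = (\<integral>\<omega>. \<bar>T \<omega> y\<bar> ^ n \<partial>M)"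
proof -
  obtain f where f: "orthogonal_transformation f" "det (matrix f) = 1" "f x = y"
    using rotation_exists_1[of x y] card x y by auto
  have rot: "rotation_matrix (matrix f)"
    using f by (simp add: rotation_matrix_def orthogonal_transformation_matrix)
  have "matrix f *v x = y"
    using f(3) fun_cong[OF matrix_vector_mul(2)[OF orthogonal_transformation_linear[OF f(1)]], of x] by simp
  moreover have "(\<integral>\<omega>. (\<Prod>i<n. T \<omega> x) \<partial>M) = (\<integral>\<omega>. (\<Prod>i<n. T \<omega> (matrix f *v x)) \<partial>M)"
    using iso n x rot unfolding fin_weakly_isotropic_def
    by (elim conjE) (drule bspec[of _ _ n], simp, drule spec[of _ "\<lambda>_. x"], drule spec[of _ "matrix f"], simp)
  ultimately show ?thesis using n by (simp add: power_even_abs)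
qed

text \<open>Tonelli reduces the expectation to moments at single points. Finiteness at each point
  alone would not make them integrable over the sphere; their constancy does.\<close>

lemma isotropic_even_moment_finite:
  fixes T :: "'w \<Rightarrow> real ^ 'n \<Rightarrow> real"
  assumes M: "prob_space M" and T: "random_field M T" and iso: "fin_weakly_isotropic M n T"
    and n: "even n" "n \<ge> 1" and card: "2 \<le> CARD('n)" and p: "1 \<le> p" "p \<le> real n"
  shows "(\<integral>\<^sup>+\<omega>. Lp_pow p (T \<omega>) \<partial>M) < \<infinity>"
proof -
  interpret M: prob_space M by (rule M)
  interpret P: pair_sigma_finite M "sphere_measure :: (real ^ 'n) measure"
    by (intro pair_sigma_finite.intro sph.sigma_finite_measure_axioms M.sigma_finite_measure_axioms)
  have Tm[measurable]: "(\<lambda>(\<omega>, x). T \<omega> x) \<in> borel_measurable (M \<Otimes>\<^sub>M sphere_measure)"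
    by (rule random_field_measurable[OF T])
  obtain k :: 'n where True by simp
  define x0 :: "real ^ 'n" where "x0 = axis k 1"
  have x0: "x0 \<in> sphere 0 1" by (simp add: x0_def)
  define m where "m = (\<integral>\<omega>. \<bar>T \<omega> x0\<bar> ^ n \<partial>M)"
  have pw: "ennreal (\<bar>t\<bar> powr p) \<le> 1 + ennreal (\<bar>t\<bar> ^ n)" for t :: real
  proof -
    have "\<bar>t\<bar> powr p \<le> 1 + \<bar>t\<bar> ^ n"
    proof (cases "\<bar>t\<bar> \<le> 1")
      case True
      then have "\<bar>t\<bar> powr p \<le> 1" using p by (simp add: powr_le1)
      then show ?thesis by (simp add: add_increasing2)
    next
      case False
      then have "\<bar>t\<bar> powr p \<le> \<bar>t\<bar> powr real n" using p by (intro powr_mono) auto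
      also have "\<dots> = \<bar>t\<bar> ^ n" using False by (intro powr_realpow) auto
      finally show ?thesis by simp
    qed
    then have "ennreal (\<bar>t\<bar> powr p) \<le> ennreal (1 + \<bar>t\<bar> ^ n)" by (rule ennreal_leI)
    then show ?thesis by simp
  qed
  have "(\<integral>\<^sup>+\<omega>. Lp_pow p (T \<omega>) \<partial>M) \<le> (\<integral>\<^sup>+\<omega>. \<integral>\<^sup>+x. 1 + ennreal (\<bar>T \<omega> x\<bar> ^ n) \<partial>sphere_measure \<partial>M)"
    unfolding Lp_pow_def by (intro nn_integral_mono pw)
  also have "\<dots> = (\<integral>\<^sup>+x. \<integral>\<^sup>+\<omega>. 1 + ennreal (\<bar>T \<omega> x\<bar> ^ n) \<partial>M \<partial>sphere_measure)"
    by (rule P.Fubini'[symmetric]) measurable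
  also have "\<dots> = (\<integral>\<^sup>+x. 1 + ennreal m \<partial>(sphere_measure :: (real ^ 'n) measure))"
  proof (rule nn_integral_cong)
    fix x :: "real ^ 'n" assume xs: "x \<in> space sphere_measure"
    then have x: "x \<in> sphere 0 1" by simp
    have i: "integrable M (\<lambda>\<omega>. \<bar>T \<omega> x\<bar> ^ n)" using iso x by (simp add: fin_weakly_isotropic_def)
    have "(\<integral>\<^sup>+\<omega>. 1 + ennreal (\<bar>T \<omega> x\<bar> ^ n) \<partial>M) = 1 + (\<integral>\<^sup>+\<omega>. ennreal (\<bar>T \<omega> x\<bar> ^ n) \<partial>M)"
      using i M.emeasure_space_1 by (subst nn_integral_add) auto
    also have "(\<integral>\<^sup>+\<omega>. ennreal (\<bar>T \<omega> x\<bar> ^ n) \<partial>M) = ennreal m"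
      unfolding m_def isotropic_moment_constant[OF iso n card x0 x]
      by (rule nn_integral_eq_integral[OF i]) simp
    finally show "(\<integral>\<^sup>+\<omega>. 1 + ennreal (\<bar>T \<omega> x\<bar> ^ n) \<partial>M) = 1 + ennreal m" .
  qed
  also have "\<dots> < \<infinity>"
    by (simp add: prob_space.emeasure_space_1[OF prob_space_sphere_measure, simplified])
  finally show ?thesis .
qed

text \<open>Serves measurability in \<open>\<omega>\<close>: a supremum over a countable dense set
  is measurable.\<close>

lemma SUP_dense_sphere:
  fixes g :: "real ^ 'n \<Rightarrow> real"
  assumes g: "continuous_on (sphere 0 1) g" and D: "D \<subseteq> sphere 0 1" "sphere 0 1 \<subseteq> closure D"
  shows "(SUP x\<in>sphere 0 1. ennreal \<bar>g x\<bar>) = (SUP x\<in>D. ennreal \<bar>g x\<bar>)"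
proof (rule antisym)
  show "(SUP x\<in>D. ennreal \<bar>g x\<bar>) \<le> (SUP x\<in>sphere 0 1. ennreal \<bar>g x\<bar>)"
    by (rule SUP_subset_mono[OF D(1)]) simp
  have cl: "closure D = sphere 0 1"
    using D closure_minimal[OF D(1)] by (auto simp: closed_sphere)
  show "(SUP x\<in>sphere 0 1. ennreal \<bar>g x\<bar>) \<le> (SUP x\<in>D. ennreal \<bar>g x\<bar>)"
  proof (rule SUP_least)
    fix x :: "real ^ 'n" assume x: "x \<in> sphere 0 1"
    show "ennreal \<bar>g x\<bar> \<le> (SUP x\<in>D. ennreal \<bar>g x\<bar>)"
    proof (cases "(SUP x\<in>D. ennreal \<bar>g x\<bar>)")
      case (real S)
      have "\<bar>g x\<bar> \<le> S"
      proof (rule continuous_le_on_closure[of D "\<lambda>x. \<bar>g x\<bar>"])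
        show "continuous_on (closure D) (\<lambda>x. \<bar>g x\<bar>)" unfolding cl by (intro continuous_intros g)
        show "x \<in> closure D" using x by (simp only: cl)
        fix y assume "y \<in> D"
        then have "ennreal \<bar>g y\<bar> \<le> ennreal S" using real by (metis SUP_upper)
        then show "\<bar>g y\<bar> \<le> S" using real by simp
      qed
      then show ?thesis using real by (simp add: ennreal_leI)
    next
      case top
      then show ?thesis by (simp only: top_greatest)
    qed
  qed
qed

section \<open>Passing from single paths to the expectation\<close>

context needlet_system
begin

lemma measurable_needlet_approx:
  assumes T: "random_field M T"
  shows "(\<lambda>(\<omega>, x). needlet_approx d h N w \<xi> J T \<omega> x) \<in> borel_measurable (M \<Otimes>\<^sub>M sphere_measure)"
    and "x \<in> sphere 0 1 \<Longrightarrow> (\<lambda>\<omega>. needlet_approx d h N w \<xi> J T \<omega> x) \<in> borel_measurable M"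
proof -
  have Tm[measurable]: "(\<lambda>(\<omega>, x). T \<omega> x) \<in> borel_measurable (M \<Otimes>\<^sub>M sphere_measure)"
    by (rule random_field_measurable[OF T])
  have nm[measurable]: "needlet d h w \<xi> j k \<in> borel_measurable sphere_measure" for j k
    by (intro measurable_sphere_measureI borel_measurable_continuous_onI continuous_needlet)
  have [measurable]: "(\<lambda>\<omega>. sphere_inner (T \<omega>) (needlet d h w \<xi> j k)) \<in> borel_measurable M" for j k
    unfolding sphere_inner_def by measurable
  show "(\<lambda>(\<omega>, x). needlet_approx d h N w \<xi> J T \<omega> x) \<in> borel_measurable (M \<Otimes>\<^sub>M sphere_measure)"
    unfolding needlet_approx_def by measurable
  show "(\<lambda>\<omega>. needlet_approx d h N w \<xi> J T \<omega> x) \<in> borel_measurable M"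
    unfolding needlet_approx_def by measurable
qed

lemma kernel_power_bound:
  obtains C where "C > 0"
    "\<And>J x. J \<ge> 2 * (d div 2 + 1) \<Longrightarrow> (x :: real ^ 'n) \<in> sphere 0 1 \<Longrightarrow>
       (\<integral>z. \<bar>poly (kernel (2 ^ J)) (x \<bullet> z)\<bar> \<partial>sphere_measure) \<le> C"
proof -
  obtain C where C: "C > 0" "\<And>N x. N \<ge> 2 * (d div 2 + 1) \<Longrightarrow> (x :: real ^ 'n) \<in> sphere 0 1 \<Longrightarrow>
       (\<integral>z. \<bar>poly (kernel N) (x \<bullet> z)\<bar> \<partial>sphere_measure) \<le> C"
    using kernel_L1_bound[OF card] by blast
  have "n \<le> (2::nat) ^ J" if "n \<le> J" for n J
    using that less_exp[of J] by linarith
  then show thesis using C that by blast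
qed

lemma filterlim_power2: "filterlim (\<lambda>J. (2::nat) ^ J) sequentially sequentially"
  by (rule filterlim_subseq) (simp add: strict_mono_def)

text \<open>Almost every path lies in \<open>L\<^sub>p\<close>, and for such a path the convergence
  is \<open>conv_Lp_tendsto\<close> along the powers of \<open>2\<close>. The shift by
  \<open>J0\<close> skips the orders for which no \<open>L\<^sub>1\<close> bound of the kernel, and
  so no dominating function, has been established.\<close>

lemma needlet_approx_Lp_convergence:
  assumes M: "prob_space M" and T: "random_field M T" and p: "p \<ge> 1"
    and fin: "(\<integral>\<^sup>+\<omega>. Lp_pow p (T \<omega>) \<partial>M) < \<infinity>"
  shows "(\<lambda>J. \<integral>\<^sup>+\<omega>. Lp_pow p (\<lambda>x. T \<omega> x - needlet_approx d h N w \<xi> J T \<omega> x) \<partial>M) \<longlonglongrightarrow> 0"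
proof -
  interpret M: prob_space M by (rule M)
  have Tm[measurable]: "(\<lambda>(\<omega>, x). T \<omega> x) \<in> borel_measurable (M \<Otimes>\<^sub>M sphere_measure)"
    by (rule random_field_measurable[OF T])
  note measurable_needlet_approx(1)[OF T, measurable]
  obtain C where C: "C > 0"
    "\<And>J x. J \<ge> 2 * (d div 2 + 1) \<Longrightarrow> (x :: real ^ 'n) \<in> sphere 0 1 \<Longrightarrow>
       (\<integral>z. \<bar>poly (kernel (2 ^ J)) (x \<bullet> z)\<bar> \<partial>sphere_measure) \<le> C"
    using kernel_power_bound by blast
  define J0 where "J0 = 2 * (d div 2 + 1)"
  define u where "u J \<omega> = Lp_pow p (\<lambda>x. T \<omega> x - needlet_approx d h N w \<xi> (Suc J) T \<omega> x)" for J \<omega>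
  have um[measurable]: "u J \<in> borel_measurable M" for J
    unfolding u_def Lp_pow_def by measurable
  have Lm[measurable]: "(\<lambda>\<omega>. Lp_pow p (T \<omega>)) \<in> borel_measurable M"
    unfolding Lp_pow_def by measurable
  have "AE \<omega> in M. Lp_pow p (T \<omega>) \<noteq> \<infinity>"
    using fin by (intro nn_integral_noteq_infinite Lm) simp
  then have AEfin: "AE \<omega> in M. T \<omega> \<in> borel_measurable sphere_measure \<and> Lp_pow p (T \<omega>) < \<infinity>"
    by (rule AE_mp) (auto intro!: AE_I2 random_field_path_measurable[OF T] simp: top.not_eq_extremum)
  have ueq: "u J \<omega> = Lp_pow p (\<lambda>x. T \<omega> x - conv (2 ^ J) (T \<omega>) x)"
    if "T \<omega> \<in> borel_measurable sphere_measure" "Lp_pow p (T \<omega>) < \<infinity>" for J \<omega>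
    unfolding u_def conv_def
    by (intro Lp_pow_cong) (simp only: needlet_approx_eq_kernel[where T = T, OF integrable_Lp[OF that p]])
  define B where "B = ennreal (3 powr p) * (1 + ennreal (C powr p))"
  have "(\<lambda>J. \<integral>\<^sup>+\<omega>. u (J + J0) \<omega> \<partial>M) \<longlonglongrightarrow> (\<integral>\<^sup>+\<omega>. 0 \<partial>M)"
  proof (rule nn_integral_dominated_convergence[where w = "\<lambda>\<omega>. B * Lp_pow p (T \<omega>)"])
    show "(\<integral>\<^sup>+\<omega>. B * Lp_pow p (T \<omega>) \<partial>M) < \<infinity>"
      using fin by (simp add: nn_integral_cmult B_def ennreal_mult_less_top)
    show "AE \<omega> in M. u (J + J0) \<omega> \<le> B * Lp_pow p (T \<omega>)" for J
      using AEfin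
    proof eventually_elim
      case (elim \<omega>)
      let ?K = "conv (2 ^ (J + J0)) (T \<omega>)"
      have [measurable]: "T \<omega> \<in> borel_measurable sphere_measure" using elim by blast
      note [measurable] = borel_measurable_conv
      have "u (J + J0) \<omega> = Lp_pow p (\<lambda>x. T \<omega> x + - ?K x + 0)"
        using elim by (simp add: ueq)
      also have "\<dots> \<le> ennreal (3 powr p) * (Lp_pow p (T \<omega>) + Lp_pow p (\<lambda>x. - ?K x) + Lp_pow p (\<lambda>x :: real ^ 'n. 0))"
        using p by (intro Lp_pow_add3[of p "T \<omega>" "\<lambda>x. - ?K x" "\<lambda>x. 0"]) auto
      also have "\<dots> = ennreal (3 powr p) * (Lp_pow p (T \<omega>) + Lp_pow p ?K)"
        by (simp add: Lp_pow_def)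
      also have "Lp_pow p ?K \<le> ennreal (C powr p) * Lp_pow p (T \<omega>)"
        by (intro conv_Lp_bound[OF card p] C(2)) (use elim in \<open>auto simp: J0_def\<close>)
      finally have "u (J + J0) \<omega> \<le> ennreal (3 powr p) * (Lp_pow p (T \<omega>) + ennreal (C powr p) * Lp_pow p (T \<omega>))"
        by (simp add: add_mono mult_left_mono)
      then show ?case by (simp add: B_def distrib_right distrib_left mult.assoc)
    qed
    show "AE \<omega> in M. (\<lambda>J. u (J + J0) \<omega>) \<longlonglongrightarrow> 0"
      using AEfin
    proof eventually_elim
      case (elim \<omega>)
      have "(\<lambda>J. Lp_pow p (\<lambda>x. T \<omega> x - conv (2 ^ J) (T \<omega>) x)) \<longlonglongrightarrow> 0"
        using elim by (intro filterlim_compose[OF conv_Lp_tendsto[OF card p] filterlim_power2]) auto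
      then have "(\<lambda>J. u J \<omega>) \<longlonglongrightarrow> 0" using elim by (simp add: ueq)
      then show ?case by (rule LIMSEQ_ignore_initial_segment)
    qed
  qed auto
  then have "(\<lambda>J. \<integral>\<^sup>+\<omega>. u (J + J0) \<omega> \<partial>M) \<longlonglongrightarrow> 0" by simp
  then have "(\<lambda>J. \<integral>\<^sup>+\<omega>. u J \<omega> \<partial>M) \<longlonglongrightarrow> 0" by (rule LIMSEQ_offset)
  then show ?thesis unfolding u_def by (rule LIMSEQ_imp_Suc)
qed

text \<open>Paths are continuous only almost surely, so measurability of their sup norms in
  \<open>\<omega>\<close> is not at hand. The suprema \<open>u\<close> and \<open>v\<close> over a
  countable dense set are measurable and agree with the norms almost surely; dominated convergence
  is applied to them.\<close>

lemma needlet_approx_sup_convergence: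
  assumes M: "prob_space M" and T: "random_field M T"
    and cont: "AE \<omega> in M. continuous_on (sphere 0 1) (T \<omega>)"
    and fin: "(\<integral>\<^sup>+\<omega>. Lp_norm \<infinity> (T \<omega>) \<partial>M) < \<infinity>"
  shows "(\<lambda>J. \<integral>\<^sup>+\<omega>. Lp_norm \<infinity> (\<lambda>x. T \<omega> x - needlet_approx d h N w \<xi> J T \<omega> x) \<partial>M) \<longlonglongrightarrow> 0"
proof -
  interpret M: prob_space M by (rule M)
  have Tm[measurable]: "(\<lambda>(\<omega>, x). T \<omega> x) \<in> borel_measurable (M \<Otimes>\<^sub>M sphere_measure)"
    by (rule random_field_measurable[OF T])
  obtain C where C: "C > 0"
    "\<And>J x. J \<ge> 2 * (d div 2 + 1) \<Longrightarrow> (x :: real ^ 'n) \<in> sphere 0 1 \<Longrightarrow>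
       (\<integral>z. \<bar>poly (kernel (2 ^ J)) (x \<bullet> z)\<bar> \<partial>sphere_measure) \<le> C"
    using kernel_power_bound by blast
  define J0 where "J0 = 2 * (d div 2 + 1)"
  obtain D :: "(real ^ 'n) set" where D: "countable D" "D \<subseteq> sphere 0 1" "sphere 0 1 \<subseteq> closure D"
    using separable[of "sphere (0 :: real ^ 'n) 1"] by blast
  define R where "R J \<omega> x = T \<omega> x - needlet_approx d h N w \<xi> (Suc J) T \<omega> x" for J \<omega> x
  have [measurable]: "(\<lambda>\<omega>. T \<omega> x) \<in> borel_measurable M" if "x \<in> D" for x
    using measurable_Pair1[OF Tm, of x] D(2) that by auto
  have Rm[measurable]: "(\<lambda>\<omega>. R J \<omega> x) \<in> borel_measurable M" if "x \<in> D" for J x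
    using measurable_needlet_approx(2)[OF T, of x] D(2) that unfolding R_def by auto
  define u where "u J \<omega> = (SUP x\<in>D. ennreal \<bar>R J \<omega> x\<bar>)" for J \<omega>
  define v where "v \<omega> = (SUP x\<in>D. ennreal \<bar>T \<omega> x\<bar>)" for \<omega>
  have um: "u J \<in> borel_measurable M" for J
    unfolding u_def using D(1) by (intro borel_measurable_SUP) measurable
  have vm: "v \<in> borel_measurable M"
    unfolding v_def using D(1) by (intro borel_measurable_SUP) measurable
  have Ti: "integrable sphere_measure (T \<omega>)" if c: "continuous_on (sphere 0 1) (T \<omega>)" for \<omega>
  proof -
    obtain b where "\<And>z. z \<in> sphere 0 1 \<Longrightarrow> \<bar>T \<omega> z\<bar> \<le> b"
      using compact_continuous_image[OF c compact_sphere]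
      by (metis bounded_iff compact_imp_bounded imageI real_norm_def)
    then show ?thesis
      by (intro sph.integrable_const_bound[where B = b] AE_I2 measurable_sphere_continuous c) auto
  qed
  have Req: "R J \<omega> x = T \<omega> x - conv (2 ^ J) (T \<omega>) x" if "continuous_on (sphere 0 1) (T \<omega>)" "x \<in> sphere 0 1" for J \<omega> x
    unfolding R_def conv_def using needlet_approx_eq_kernel[where T = T, OF Ti[OF that(1)] that(2)] by simp
  have Rc: "continuous_on (sphere 0 1) (R J \<omega>)" if "continuous_on (sphere 0 1) (T \<omega>)" for J \<omega>
    unfolding R_def needlet_approx_def
    by (intro continuous_intros that continuous_on_subset[OF continuous_needlet]) auto
  have uN: "AE \<omega> in M. Lp_norm \<infinity> (R J \<omega>) = u J \<omega>" for J
    using cont by eventually_elim (simp add: Lp_norm_def u_def SUP_dense_sphere[OF Rc D(2,3)])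
  have vN: "AE \<omega> in M. Lp_norm \<infinity> (T \<omega>) = v \<omega>"
    using cont by eventually_elim (simp add: Lp_norm_def v_def SUP_dense_sphere[OF _ D(2,3)])
  have vfin: "(\<integral>\<^sup>+\<omega>. v \<omega> \<partial>M) < \<infinity>" using fin nn_integral_cong_AE[OF vN] by simp
  have "(\<lambda>J. \<integral>\<^sup>+\<omega>. u (J + J0) \<omega> \<partial>M) \<longlonglongrightarrow> (\<integral>\<^sup>+\<omega>. 0 \<partial>M)"
  proof (rule nn_integral_dominated_convergence[where w = "\<lambda>\<omega>. ennreal (1 + C) * v \<omega>"])
    show "(\<integral>\<^sup>+\<omega>. ennreal (1 + C) * v \<omega> \<partial>M) < \<infinity>"
      using vfin vm by (simp add: nn_integral_cmult ennreal_mult_less_top)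
    show "AE \<omega> in M. u (J + J0) \<omega> \<le> ennreal (1 + C) * v \<omega>" for J
      using cont
    proof eventually_elim
      case (elim \<omega>)
      have v: "v \<omega> = (SUP x\<in>sphere 0 1. ennreal \<bar>T \<omega> x\<bar>)"
        unfolding v_def by (rule SUP_dense_sphere[OF elim D(2,3), symmetric])
      show ?case
      proof (cases "v \<omega>")
        case (real b)
        have Tb: "\<bar>T \<omega> x\<bar> \<le> b" if "x \<in> sphere 0 1" for x
        proof -
          have "ennreal \<bar>T \<omega> x\<bar> \<le> ennreal b" unfolding real(2)[symmetric] v by (rule SUP_upper[OF that])
          then show ?thesis using real(1) by simp
        qed
        show ?thesis unfolding u_def
        proof (rule SUP_least)
          fix x assume "x \<in> D"
          then have x: "x \<in> sphere 0 1" using D by blast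
          let ?k = "\<lambda>z. poly (kernel (2 ^ (J + J0))) (x \<bullet> z)"
          have "\<bar>conv (2 ^ (J + J0)) (T \<omega>) x\<bar> \<le> (\<integral>z. \<bar>?k z * T \<omega> z\<bar> \<partial>sphere_measure)"
            unfolding conv_def by (rule integral_abs_bound)
          also have "\<dots> \<le> (\<integral>z. \<bar>?k z\<bar> * b \<partial>sphere_measure)"
          proof (rule integral_mono)
            show "integrable sphere_measure (\<lambda>z. \<bar>?k z * T \<omega> z\<bar>)"
              by (intro integrable_abs integrable_mult_zonal Ti elim)
            show "integrable sphere_measure (\<lambda>z. \<bar>?k z\<bar> * b)"
              by (intro integrable_sphere_continuous continuous_intros)
            show "\<bar>?k z * T \<omega> z\<bar> \<le> \<bar>?k z\<bar> * b" if "z \<in> space sphere_measure" for z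
              using Tb[of z] that by (simp add: abs_mult mult_left_mono)
          qed
          also have "\<dots> = (\<integral>z. \<bar>?k z\<bar> \<partial>sphere_measure) * b" by simp
          also have "\<dots> \<le> C * b" using C(2)[of "J + J0" x] x real(1) by (intro mult_right_mono) (auto simp: J0_def)
          finally have "\<bar>R (J + J0) \<omega> x\<bar> \<le> (1 + C) * b"
            using Tb[OF x] by (simp add: Req[OF elim x] algebra_simps)
          then show "ennreal \<bar>R (J + J0) \<omega> x\<bar> \<le> ennreal (1 + C) * v \<omega>"
            using C(1) real by (simp add: ennreal_mult[symmetric] ennreal_leI del: ennreal_plus)
        qed
      next
        case top
        then show ?thesis using C(1) by (simp add: ennreal_mult_top)
      qed
    qed
    show "AE \<omega> in M. (\<lambda>J. u (J + J0) \<omega>) \<longlonglongrightarrow> 0"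
      using cont
    proof eventually_elim
      case (elim \<omega>)
      have "(\<lambda>J. u J \<omega>) \<longlonglongrightarrow> 0"
      proof (rule ennreal_tendsto_0I)
        fix e :: real assume e: "e > 0"
        obtain N0 where N0: "\<And>N x. N \<ge> N0 \<Longrightarrow> x \<in> sphere 0 1 \<Longrightarrow> \<bar>conv N (T \<omega>) x - T \<omega> x\<bar> \<le> e"
          using kernel_approx_identity[OF card elim e] unfolding conv_def by blast
        have "u J \<omega> \<le> ennreal e" if "J \<ge> N0" for J
          unfolding u_def
        proof (rule SUP_least, rule ennreal_leI)
          fix x assume "x \<in> D"
          then have x: "x \<in> sphere 0 1" using D by blast
          have "N0 \<le> 2 ^ J" using that less_exp[of J] by linarith
          then show "\<bar>R J \<omega> x\<bar> \<le> e" using N0[OF _ x] by (simp add: Req[OF elim x] abs_minus_commute)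
        qed
        then show "\<forall>\<^sub>F J in sequentially. u J \<omega> \<le> ennreal e" unfolding eventually_sequentially by blast
      qed
      then show ?case by (rule LIMSEQ_ignore_initial_segment)
    qed
  qed (use um vm in auto)
  then have "(\<lambda>J. \<integral>\<^sup>+\<omega>. u (J + J0) \<omega> \<partial>M) \<longlonglongrightarrow> 0" by simp
  then have "(\<lambda>J. \<integral>\<^sup>+\<omega>. u J \<omega> \<partial>M) \<longlonglongrightarrow> 0" by (rule LIMSEQ_offset)
  moreover have "(\<integral>\<^sup>+\<omega>. u J \<omega> \<partial>M) = (\<integral>\<^sup>+\<omega>. Lp_norm \<infinity> (R J \<omega>) \<partial>M)" for J
    using uN[of J] by (intro nn_integral_cong_AE) (auto elim: eventually_mono)
  ultimately have "(\<lambda>J. \<integral>\<^sup>+\<omega>. Lp_norm \<infinity> (R J \<omega>) \<partial>M) \<longlonglongrightarrow> 0" by simp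
  then show ?thesis unfolding R_def by (rule LIMSEQ_imp_Suc)
qed

end

theorem theorem3p4:
  fixes M :: "'w measure"
    and T :: "'w \<Rightarrow> real ^ 'n \<Rightarrow> real"
    and d \<kappa> :: nat
    and p :: ennreal
    and h :: "real \<Rightarrow> real"
    and N :: "nat \<Rightarrow> nat"
    and w :: "nat \<Rightarrow> nat \<Rightarrow> real"
    and \<xi> :: "nat \<Rightarrow> nat \<Rightarrow> real ^ 'n"
  assumes dim: "CARD('n) = d + 1" "d \<ge> 2"
    and p: "1 \<le> p"
    and prob: "prob_space M"
    and field: "random_field M T"
    and isotropic: "weakly_isotropic M (ceil_ennreal p) T"
    and moments: "p = \<infinity> \<Longrightarrow> laws_determined_by_moments M T"
    and odd_order: "p \<noteq> \<infinity> \<Longrightarrow> odd \<lceil>enn2real p\<rceil> \<Longrightarrow>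
      (\<integral>\<^sup>+ \<omega>. enn_powr (Lp_norm p (T \<omega>)) (enn2real p) \<partial>M) < \<infinity>"
    and filter: "needlet_filter \<kappa> h" "int \<kappa> \<ge> \<lfloor>(real d + 3) / 2\<rfloor>"
    and quadrature: "\<And>j. needlet_quadrature j (N j) (w j) (\<xi> j)"
  shows "(\<forall>J \<omega>. \<forall>x\<in>sphere 0 1.
            needlet_approx d h N w \<xi> J T \<omega> x = (\<Sum>j\<le>J. order_contribution d h N w \<xi> j T \<omega> x)) \<and>
         (p \<noteq> \<infinity> \<longrightarrow>
            (\<lambda>J. \<integral>\<^sup>+ \<omega>. enn_powr (Lp_norm p (\<lambda>x. T \<omega> x - needlet_approx d h N w \<xi> J T \<omega> x))
                          (enn2real p) \<partial>M) \<longlonglongrightarrow> 0) \<and>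
         (p = \<infinity> \<longrightarrow>
            (\<lambda>J. \<integral>\<^sup>+ \<omega>. Lp_norm \<infinity> (\<lambda>x. T \<omega> x - needlet_approx d h N w \<xi> J T \<omega> x) \<partial>M) \<longlonglongrightarrow> 0)"
proof (intro conjI impI)
  \<comment> \<open>Converts the smoothness hypothesis into the order required by
    \<open>zonal_filter\<close>.\<close>
  have "real (2 * (d div 2)) \<le> real d" by (simp only: of_nat_le_iff times_div_less_eq_dividend)
  then have "int (d div 2 + 1) \<le> \<lfloor>(real d + 3) / 2\<rfloor>" by (subst le_floor_iff) simp
  then have kappa: "\<kappa> \<ge> d div 2 + 1" using filter(2) by linarith
  interpret needlet_system d \<kappa> h N w \<xi>
    by unfold_locales (fact dim filter kappa quadrature)+
  show "\<forall>J \<omega>. \<forall>x\<in>sphere 0 1. needlet_approx d h N w \<xi> J T \<omega> x = (\<Sum>j\<le>J. order_contribution d h N w \<xi> j T \<omega> x)"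
    by (simp add: needlet_approx_def order_contribution_def)
  {
    assume fin: "p \<noteq> \<infinity>"
    define r where "r = enn2real p"
    have "enn2real 1 \<le> enn2real p" using p fin by (intro enn2real_mono) (auto simp: top.not_eq_extremum)
    then have r: "r \<ge> 1" by (simp add: r_def)
    have "(\<integral>\<^sup>+\<omega>. Lp_pow r (T \<omega>) \<partial>M) < \<infinity>"
    \<comment> \<open>For odd order the finite moment is assumed as \<open>odd_order\<close>; for
      even order isotropy supplies it, with \<open>n\<close> the ceiling of
      \<open>r\<close>.\<close>
    proof (cases "odd \<lceil>r\<rceil>")
      case True
      then show ?thesis using odd_order[OF fin] by (simp add: enn_powr_Lp_norm[OF p fin] r_def)
    next
      case False
      define n where "n = nat \<lceil>r\<rceil>"
      have c: "\<lceil>r\<rceil> \<ge> 1" using r by linarith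
      have "fin_weakly_isotropic M n T" "n \<ge> 1"
        using isotropic fin by (simp_all add: weakly_isotropic_def ceil_ennreal_def r_def n_def)
      moreover have "even n" using False c by (simp add: n_def even_nat_iff)
      moreover have "r \<le> real n" unfolding n_def by (rule real_nat_ceiling_ge)
      ultimately show ?thesis using prob field dim r by (intro isotropic_even_moment_finite[of M T n r]) auto
    qed
    from needlet_approx_Lp_convergence[OF prob field r this]
    show "(\<lambda>J. \<integral>\<^sup>+ \<omega>. enn_powr (Lp_norm p (\<lambda>x. T \<omega> x - needlet_approx d h N w \<xi> J T \<omega> x)) (enn2real p) \<partial>M) \<longlonglongrightarrow> 0"
      by (simp add: enn_powr_Lp_norm[OF p fin] r_def)
  }
  {
    assume inf: "p = \<infinity>"
    have "(\<integral>\<^sup>+ \<omega>. Lp_norm \<infinity> (T \<omega>) \<partial>M) < \<infinity>" "AE \<omega> in M. continuous_on (sphere 0 1) (T \<omega>)"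
      using isotropic inf by (simp_all add: weakly_isotropic_def ceil_ennreal_def)
    then show "(\<lambda>J. \<integral>\<^sup>+ \<omega>. Lp_norm \<infinity> (\<lambda>x. T \<omega> x - needlet_approx d h N w \<xi> J T \<omega> x) \<partial>M) \<longlonglongrightarrow> 0"
      by (intro needlet_approx_sup_convergence[OF prob field])
  }
qed

end
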